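(* Let $\mathcal{M}_0=\{f(\cdot\mid\theta,\eta):\theta\in\Theta,\ \eta\in\mathcal{E}\}$ be a regular parametric family of one-dimensional densities (as described in the context), and let $Z_1,Z_2,\ldots$ be real random variables. Let $H_0^*$ be the hypothesis that $Z_1,\ldots,Z_N$ are i.i.d. with density $f(\cdot\mid\theta,\eta)\in\mathcal{M}_0$, where $(\theta,\eta)$ is the true parameter. Let $\xi_r(j)$, $\bar C_{02}^N$, $C_{04}$ and the projected likelihood contrast statistic $\Lambda_N$ be as defined in the context. Assume that $E_{H_0^*}\,\xi_1(1)\,\xi_2(1)=0$ and $C_{04}<0$. Then, under $H_0^*$, as $N\to\infty$: (i) if $\bar C_{02}^N=0$, then $\Lambda_N\to 0$ in probability; (ii) if $\sqrt{N}\,\bar C_{02}^N$ converges in distribution to $N(0,\sigma^2)$ for some $\sigma^2>0$, then there is a constant $c^2>0$ such that $\Lambda_N$ converges in distribution to $c^2\,\max(0,Z)^2$, where $Z$ is a standard normal random variable.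
   Context: Model. $\mathcal{M}_0=\{f(\cdot\mid\theta,\eta):\theta\in\Theta,\eta\in\mathcal{E}\}$ is a family of probability densities on $\mathbb{R}$, where $\theta$ is the real parameter of interest and $\eta$ is a real nuisance parameter. The associated two-component mixture with known mixing proportion $0.5$ and common nuisance parameter is $$g(z\mid\theta_1,\theta_2,\eta)=0.5\,f(z\mid\theta_1,\eta)+0.5\,f(z\mid\theta_2,\eta).$$ For observations $Z_1,\ldots,Z_N$ put $$L_N(\theta_1,\theta_2,\eta)=\sum_{i=1}^N\log g(Z_i\mid\theta_1,\theta_2,\eta),\qquad\text{so that}\qquad L_N(\theta,\theta,\eta)=\sum_{i=1}^N\log f(Z_i\mid\theta,\eta).$$ PLC statistic. Let $(\hat\theta_N,\hat\eta_N)$ be the maximum likelihood estimator of $(\theta,\eta)$ under the homogeneous model, i.e. the maximizer of $(\theta,\eta)\mapsto L_N(\theta,\theta,\eta)$. The projected likelihood contrast (PLC) statistic is $$\Lambda_N=2\Big(\max_{\theta_1,\theta_2}L_N(\theta_1,\theta_2,\hat\eta_N)-L_N(\hat\theta_N,\hat\theta_N,\hat\eta_N)\Big).$$ Scores. For $r\ge1$ and $1\le j\le N$, with $(\theta,\eta)$ the true parameter under $H_0^*$, $$\xi_r(j)=\frac{D_\theta^r f(Z_j\mid\theta,\eta)}{f(Z_j\mid\theta,\eta)},$$ where $D_x^r$ denotes the $r$-th partial derivative with respect to $x$. $E_{H_0^*}$ denotes expectation under $H_0^*$. Derivatives of the likelihood. Write $L_N(\theta_1,\theta_2)=L_N(\theta_1,\theta_2,\hat\eta_N)$,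 with $\hat\eta_N$ held fixed under differentiation. For nonnegative integers $i,j$, $$C_{ij}^N=(D_{\theta_1}+D_{\theta_2})^i(D_{\theta_1}-D_{\theta_2})^jL_N(\theta_1,\theta_2)\Big|_{\theta_1=\theta_2=\hat\theta_N},\qquad \bar C_{ij}^N=N^{-1}C_{ij}^N.$$ $C_{ij}$ denotes the asymptotic expected value of $\bar C_{ij}^N$ under $H_0^*$, that is, the limit in probability of $\bar C_{ij}^N$ under $H_0^*$ as $N\to\infty$. In particular $$\bar C_{02}^N=\frac1N\sum_{j=1}^N\frac{D_\theta^2f(Z_j\mid\hat\theta_N,\hat\eta_N)}{f(Z_j\mid\hat\theta_N,\hat\eta_N)}.$$ Standing regularity assumptions. The family $\mathcal{M}_0$ satisfies the usual regularity conditions of large-sample maximum likelihood theory: smoothness in the parameters, differentiation under the integral sign, an information matrix for $(\theta,\eta)$ and the classical asymptotics of the maximum likelihood estimator and of averages of smooth functions evaluated at it. The scores $\xi_r$ are well behaved with finite moments, and $E_{H_0^*}\xi_r(1)=0$ for every $r\ge1$.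
   Formalization: Regularity is made explicit, adding: the half-half mixture is identifiable at the true parameter, log-likelihood ratios have local integrable upper envelopes, and the maximum over (θ1,θ2) is attained in a fixed compact set with probability tending to one; without these Λ_N need not vanish in (i). *)

theory Defs
  imports "HOL-Probability.Probability"
begin

text \<open>
  A family is a curried function \<open>f\<close>, where \<open>f z t e\<close> is the density at \<open>z\<close> for the parameter of
  interest \<open>t\<close> and the nuisance parameter \<open>e\<close>.
\<close>

definition mixture_density ::
  "(real \<Rightarrow> real \<Rightarrow> real \<Rightarrow> real) \<Rightarrow> real \<Rightarrow> real \<Rightarrow> real \<Rightarrow> real \<Rightarrow> real"
  where "mixture_density f z t1 t2 e = 1/2 * f z t1 e + 1/2 * f z t2 e"

text \<open>
  The convention \<open>ln 0 = 0\<close> is harmless below: the support is common to the whole family, so a zero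
  argument only arises if some observation lies outside it, which is a null event.
\<close>

definition loglik ::
  "(real \<Rightarrow> real \<Rightarrow> real \<Rightarrow> real) \<Rightarrow> (nat \<Rightarrow> real) \<Rightarrow> nat \<Rightarrow> real \<Rightarrow> real \<Rightarrow> real \<Rightarrow> real"
  where "loglik f z N t1 t2 e = (\<Sum>i=1..N. ln (mixture_density f (z i) t1 t2 e))"

definition theta_deriv ::
  "(real \<Rightarrow> real \<Rightarrow> real \<Rightarrow> real) \<Rightarrow> nat \<Rightarrow> real \<Rightarrow> real \<Rightarrow> real \<Rightarrow> real"
  where "theta_deriv f r z t e = (deriv ^^ r) (\<lambda>s. f z s e) t"

definition score ::
  "(real \<Rightarrow> real \<Rightarrow> real \<Rightarrow> real) \<Rightarrow> nat \<Rightarrow> real \<Rightarrow> real \<Rightarrow> real \<Rightarrow> real"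
  where "score f r t e z = theta_deriv f r z t e / f z t e"

definition eta_score :: "(real \<Rightarrow> real \<Rightarrow> real \<Rightarrow> real) \<Rightarrow> real \<Rightarrow> real \<Rightarrow> real \<Rightarrow> real"
  where "eta_score f t e z = deriv (\<lambda>e'. f z t e') e / f z t e"

definition D_sum :: "(real \<Rightarrow> real \<Rightarrow> real) \<Rightarrow> real \<Rightarrow> real \<Rightarrow> real"
  where "D_sum h = (\<lambda>x y. deriv (\<lambda>s. h s y) x + deriv (\<lambda>s. h x s) y)"

definition D_diff :: "(real \<Rightarrow> real \<Rightarrow> real) \<Rightarrow> real \<Rightarrow> real \<Rightarrow> real"
  where "D_diff h = (\<lambda>x y. deriv (\<lambda>s. h s y) x - deriv (\<lambda>s. h x s) y)"

text \<open>
  \<open>C_coef f z N t e i j\<close> is the mixed derivative evaluated on the diagonal at \<open>t\<close>, the nuisance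
  parameter being held fixed at \<open>e\<close>; it is used with \<open>(t, e)\<close> the homogeneous maximum likelihood
  estimate.
\<close>

definition C_coef ::
  "(real \<Rightarrow> real \<Rightarrow> real \<Rightarrow> real) \<Rightarrow> (nat \<Rightarrow> real) \<Rightarrow> nat \<Rightarrow> real \<Rightarrow> real \<Rightarrow> nat \<Rightarrow> nat \<Rightarrow> real"
  where "C_coef f z N t e i j =
    (D_sum ^^ i) ((D_diff ^^ j) (\<lambda>t1 t2. loglik f z N t1 t2 e)) t t"

definition C_bar ::
  "(real \<Rightarrow> real \<Rightarrow> real \<Rightarrow> real) \<Rightarrow> (nat \<Rightarrow> real) \<Rightarrow> nat \<Rightarrow> real \<Rightarrow> real \<Rightarrow> nat \<Rightarrow> nat \<Rightarrow> real"
  where "C_bar f z N t e i j = C_coef f z N t e i j / real N"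

definition is_mle ::
  "(real \<Rightarrow> real \<Rightarrow> real \<Rightarrow> real) \<Rightarrow> real set \<Rightarrow> real set \<Rightarrow> (nat \<Rightarrow> real) \<Rightarrow> nat \<Rightarrow> real \<Rightarrow> real \<Rightarrow> bool"
  where "is_mle f \<Theta> \<E> z N t e \<longleftrightarrow>
    is_arg_max (\<lambda>(t', e'). loglik f z N t' t' e') (\<lambda>p. p \<in> \<Theta> \<times> \<E>) (t, e)"

text \<open>
  The maximum is written as a supremum. Wherever the statistic is used, the supremum is attained
  with probability tending to one.
\<close>

definition plc ::
  "(real \<Rightarrow> real \<Rightarrow> real \<Rightarrow> real) \<Rightarrow> real set \<Rightarrow> (nat \<Rightarrow> real) \<Rightarrow> nat \<Rightarrow> real \<Rightarrow> real \<Rightarrow> real"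
  where "plc f \<Theta> z N t e =
    2 * ((SUP (t1, t2) \<in> \<Theta> \<times> \<Theta>. loglik f z N t1 t2 e) - loglik f z N t t e)"

definition converges_in_prob :: "'a measure \<Rightarrow> (nat \<Rightarrow> 'a \<Rightarrow> real) \<Rightarrow> real \<Rightarrow> bool"
  where "converges_in_prob M X c \<longleftrightarrow>
    (\<forall>N. X N \<in> borel_measurable M) \<and>
    (\<forall>\<epsilon>>0. (\<lambda>N. \<P>(\<omega> in M. \<bar>X N \<omega> - c\<bar> > \<epsilon>)) \<longlonglongrightarrow> 0)"

definition converges_in_distr :: "'a measure \<Rightarrow> (nat \<Rightarrow> 'a \<Rightarrow> real) \<Rightarrow> real measure \<Rightarrow> bool"
  where "converges_in_distr M X \<mu> \<longleftrightarrow>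
    (\<forall>N. X N \<in> borel_measurable M) \<and> weak_conv_m (\<lambda>N. distr M borel (X N)) \<mu>"

definition model_law ::
  "(real \<Rightarrow> real \<Rightarrow> real \<Rightarrow> real) \<Rightarrow> real \<Rightarrow> real \<Rightarrow> real measure"
  where "model_law f t e = density lborel (\<lambda>z. ennreal (f z t e))"

text \<open>
  The usual regularity conditions on the family, at the true parameter \<open>(\<theta>, \<eta>)\<close>. Conditions
  \<open>score_envelope\<close> (Cramer: locally dominated scores, with moments of every order) and
  \<open>loglik_envelope\<close>, \<open>identifiable\<close> (Wald) are the ones behind the laws of large numbers for smooth
  functions evaluated at estimators. Identifiability is required of the mixture: a homogeneous
  density that is also a nontrivial half-half mixture would destroy the asymptotics of the
  contrast statistic.
\<close>

locale regular_family =
  fixes f :: "real \<Rightarrow> real \<Rightarrow> real \<Rightarrow> real" and \<Theta> \<E> :: "real set" and \<theta> \<eta> :: real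
  assumes open_params: "open \<Theta>" "open \<E>"
    and true_param: "\<theta> \<in> \<Theta>" "\<eta> \<in> \<E>"
    and density_measurable: "\<And>t e. t \<in> \<Theta> \<Longrightarrow> e \<in> \<E> \<Longrightarrow> (\<lambda>z. f z t e) \<in> borel_measurable borel"
    and density_nonneg: "\<And>z t e. t \<in> \<Theta> \<Longrightarrow> e \<in> \<E> \<Longrightarrow> 0 \<le> f z t e"
    and density_total: "\<And>t e. t \<in> \<Theta> \<Longrightarrow> e \<in> \<E> \<Longrightarrow> (\<integral>\<^sup>+z. ennreal (f z t e) \<partial>lborel) = 1"
    and common_support:
      "\<And>z t e. t \<in> \<Theta> \<Longrightarrow> e \<in> \<E> \<Longrightarrow> 0 < f z t e \<longleftrightarrow> 0 < f z \<theta> \<eta>"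
    and smooth_theta:
      "\<And>z t e r. 0 < f z \<theta> \<eta> \<Longrightarrow> t \<in> \<Theta> \<Longrightarrow> e \<in> \<E> \<Longrightarrow>
        (\<lambda>s. theta_deriv f r z s e) field_differentiable (at t)"
    and continuous_theta_deriv:
      "\<And>z r. 0 < f z \<theta> \<eta> \<Longrightarrow>
        continuous_on (\<Theta> \<times> \<E>) (\<lambda>(t, e). theta_deriv f r z t e)"
    and smooth_eta:
      "\<And>z t e. 0 < f z \<theta> \<eta> \<Longrightarrow> t \<in> \<Theta> \<Longrightarrow> e \<in> \<E> \<Longrightarrow>
        (\<lambda>e'. f z t e') field_differentiable (at e)"
    and score_envelope:
      "\<And>r. 1 \<le> r \<Longrightarrow> \<exists>U H. open U \<and> (\<theta>, \<eta>) \<in> U \<and>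
        (\<forall>p::nat. integrable (model_law f \<theta> \<eta>) (\<lambda>z. H z ^ p)) \<and>
        (\<forall>(t, e) \<in> U \<inter> \<Theta> \<times> \<E>. \<forall>z. 0 < f z \<theta> \<eta> \<longrightarrow> \<bar>score f r t e z\<bar> \<le> H z)"
    and score_mean_zero:
      "\<And>r. 1 \<le> r \<Longrightarrow> (\<integral>z. score f r \<theta> \<eta> z \<partial>model_law f \<theta> \<eta>) = 0"
    and eta_score_square_integrable:
      "integrable (model_law f \<theta> \<eta>) (\<lambda>z. (eta_score f \<theta> \<eta> z)\<^sup>2)"
    and information_pos_def:
      "\<And>a b. (a, b) \<noteq> (0, 0) \<Longrightarrow>
        0 < a\<^sup>2 * (\<integral>z. (score f 1 \<theta> \<eta> z)\<^sup>2 \<partial>model_law f \<theta> \<eta>)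
          + 2 * a * b * (\<integral>z. score f 1 \<theta> \<eta> z * eta_score f \<theta> \<eta> z \<partial>model_law f \<theta> \<eta>)
          + b\<^sup>2 * (\<integral>z. (eta_score f \<theta> \<eta> z)\<^sup>2 \<partial>model_law f \<theta> \<eta>)"
    and identifiable:
      "\<And>t1 t2. t1 \<in> \<Theta> \<Longrightarrow> t2 \<in> \<Theta> \<Longrightarrow>
        (AE z in lborel. mixture_density f z t1 t2 \<eta> = f z \<theta> \<eta>) \<Longrightarrow> t1 = \<theta> \<and> t2 = \<theta>"
    and loglik_envelope:
      "\<And>t. t \<in> \<Theta> \<Longrightarrow> \<exists>U G. open U \<and> (t, \<eta>) \<in> U \<and> integrable (model_law f \<theta> \<eta>) G \<and>
        (\<forall>(s, e) \<in> U \<inter> \<Theta> \<times> \<E>. \<forall>z. 0 < f z \<theta> \<eta> \<longrightarrow> ln (f z s e / f z \<theta> \<eta>) \<le> G z)"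

text \<open>
  Maximum likelihood estimation in the homogeneous family: existence of the maximizer (with
  probability tending to one) and its consistency. Asymptotic normality follows from these and the
  conditions above.
\<close>

definition consistent_mle ::
  "'a measure \<Rightarrow> (nat \<Rightarrow> 'a \<Rightarrow> real) \<Rightarrow> (real \<Rightarrow> real \<Rightarrow> real \<Rightarrow> real) \<Rightarrow> real set \<Rightarrow> real set
    \<Rightarrow> (nat \<Rightarrow> 'a \<Rightarrow> real) \<Rightarrow> (nat \<Rightarrow> 'a \<Rightarrow> real) \<Rightarrow> real \<Rightarrow> real \<Rightarrow> bool"
  where "consistent_mle M Z f \<Theta> \<E> \<theta>h \<eta>h \<theta> \<eta> \<longleftrightarrow>
    (\<forall>N. \<forall>\<omega>\<in>space M. \<theta>h N \<omega> \<in> \<Theta> \<and> \<eta>h N \<omega> \<in> \<E>) \<and>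
    (\<lambda>N. \<P>(\<omega> in M. is_mle f \<Theta> \<E> (\<lambda>i. Z i \<omega>) N (\<theta>h N \<omega>) (\<eta>h N \<omega>))) \<longlonglongrightarrow> 1 \<and>
    converges_in_prob M \<theta>h \<theta> \<and> converges_in_prob M \<eta>h \<eta>"

text \<open>
  The maximum in the contrast statistic exists, and is attained in a fixed compact set, with
  probability tending to one. This replaces compactness of the parameter space in Wald's consistency
  theorem.
\<close>

definition mixture_max_tight ::
  "'a measure \<Rightarrow> (nat \<Rightarrow> 'a \<Rightarrow> real) \<Rightarrow> (real \<Rightarrow> real \<Rightarrow> real \<Rightarrow> real) \<Rightarrow> real set
    \<Rightarrow> (nat \<Rightarrow> 'a \<Rightarrow> real) \<Rightarrow> bool"
  where "mixture_max_tight M Z f \<Theta> \<eta>h \<longleftrightarrow>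
    (\<exists>K. compact K \<and> K \<subseteq> \<Theta> \<and>
      (\<lambda>N. \<P>(\<omega> in M. \<exists>p \<in> K \<times> K. is_arg_max
          (\<lambda>(t1, t2). loglik f (\<lambda>i. Z i \<omega>) N t1 t2 (\<eta>h N \<omega>)) (\<lambda>q. q \<in> \<Theta> \<times> \<Theta>) p)) \<longlonglongrightarrow> 1)"

text \<open>The null hypothesis, for the whole sequence (indices start at 1).\<close>

definition iid_model ::
  "'a measure \<Rightarrow> (nat \<Rightarrow> 'a \<Rightarrow> real) \<Rightarrow> (real \<Rightarrow> real \<Rightarrow> real \<Rightarrow> real) \<Rightarrow> real \<Rightarrow> real \<Rightarrow> bool"
  where "iid_model M Z f \<theta> \<eta> \<longleftrightarrow>
    prob_space.indep_vars M (\<lambda>_. borel) Z {1..} \<and>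
    (\<forall>i\<ge>1. distributed M lborel (Z i) (\<lambda>z. ennreal (f z \<theta> \<eta>)))"

end

theory Submission
  imports Defs
begin

text \<open>
  Fix the nuisance parameter at its estimate and move the two components of the mixture to \<open>c + v\<close> and
  \<open>c - v\<close>. The mixture is symmetric, so only even powers of \<open>v\<close> appear, and the homogeneous maximum
  \<open>\<theta>h\<close> is a critical point along the diagonal. Per observation, the log-likelihood gained over \<open>\<theta>h\<close> is

  \<open>- A (c - \<theta>h)\<^sup>2 / 2 + B (c - \<theta>h) v\<^sup>2 / 2 + C02 v\<^sup>2 / 2 + C04 v\<^sup>4 / 24\<close>

  up to small relative errors, where \<open>A\<close> tends to the Fisher information and \<open>B\<close> to \<open>- E \<xi>\<^sub>1 \<xi>\<^sub>2\<close>. Orthogonality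
  of the first two scores makes \<open>B\<close> negligible: since \<open>\<bar>(c - \<theta>h) v\<^sup>2\<bar> \<le> (c - \<theta>h)\<^sup>2 + v\<^sup>4 / 4\<close>, the cross term is then
  absorbed by the two negative ones. What remains is a quadratic function of \<open>v\<^sup>2 \<ge> 0\<close>, whose maximum is
  \<open>(3/2) (max 0 C02)\<^sup>2 / (- C04)\<close>. Multiplied by \<open>2 N\<close>, this shows that the contrast statistic is

  \<open>3 / (- C04) \<cdot> (max 0 (sqrt N \<cdot> C02))\<^sup>2\<close>

  up to a factor arbitrarily close to \<open>1\<close>, with probability tending to one (\<open>contrast_sandwich\<close>). Because the
  error is a factor, \<open>C02 = 0\<close> forces the statistic to vanish, and a normal limit of \<open>sqrt N \<cdot> C02\<close> yields the
  limit \<open>c\<^sup>2 (max 0 Z)\<^sup>2\<close> with \<open>c\<^sup>2 = 3 \<sigma>\<^sup>2 / (- C04)\<close> (\<open>converges_in_distr_squared_positive_part\<close>).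

  Three facts justify the expansion. Averages of the derivatives involved, at any parameters near the true ones,
  are near their means: this is a uniform law of large numbers (\<open>uniform_law\<close>), applied with Lagrange
  remainders (\<open>loglik_contrast_le\<close>, \<open>loglik_contrast_ge\<close>). Derivatives of the log-likelihood of the mixture are
  dominated by powers of the score envelopes (\<open>mixture_ratio_le\<close>). And the maximizing pair lies near \<open>(\<theta>, \<theta>)\<close>, so
  that the expansion applies to it; this is Wald's consistency argument (\<open>loglik_gap\<close>), based on the
  one-sided uniform law (\<open>uniform_upper_law\<close>) and on identifiability of the mixture.
\<close>


section \<open>Events whose probability tends to one\<close>

text \<open>Asymptotic arguments are carried out pathwise, on events that are not always visibly
  measurable (existence of a maximizer, bounds holding uniformly in a parameter). Asking only for a
  measurable event that \<^emph>\<open>implies\<close> the property avoids measurability questions and keeps the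
  notion closed under finite conjunction and weakening.\<close>

definition whp :: "'a measure \<Rightarrow> (nat \<Rightarrow> 'a \<Rightarrow> bool) \<Rightarrow> bool" where
  "whp M P \<longleftrightarrow> (\<exists>A. (\<forall>N. A N \<in> sets M) \<and> (\<lambda>N. measure M (A N)) \<longlonglongrightarrow> 1 \<and> (\<forall>N. \<forall>\<omega>\<in>A N. P N \<omega>))"

lemma whpE:
  assumes "whp M P"
  obtains A where "\<And>N. A N \<in> sets M" "(\<lambda>N. measure M (A N)) \<longlonglongrightarrow> 1" "\<And>N \<omega>. \<omega> \<in> A N \<Longrightarrow> P N \<omega>"
proof -
  from assms obtain A where "(\<forall>N. A N \<in> sets M) \<and> (\<lambda>N. measure M (A N)) \<longlonglongrightarrow> 1 \<and> (\<forall>N. \<forall>\<omega>\<in>A N. P N \<omega>)"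
    unfolding whp_def by (elim exE)
  then show ?thesis by (intro that[of A]) simp_all
qed

lemma whpI:
  assumes "\<And>N. A N \<in> sets M" "(\<lambda>N. measure M (A N)) \<longlonglongrightarrow> 1" "\<And>N \<omega>. \<omega> \<in> A N \<Longrightarrow> P N \<omega>"
  shows "whp M P"
  unfolding whp_def using assms by (intro exI[of _ A]) simp

context prob_space
begin

lemma whp_mono:
  assumes "whp M P" and "\<And>N \<omega>. \<omega> \<in> space M \<Longrightarrow> P N \<omega> \<Longrightarrow> Q N \<omega>"
  shows "whp M Q"
proof -
  obtain A where A: "\<And>N. A N \<in> events" "(\<lambda>N. prob (A N)) \<longlonglongrightarrow> 1" "\<And>N \<omega>. \<omega> \<in> A N \<Longrightarrow> P N \<omega>"
    by (rule whpE[OF assms(1)]) (rule that)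
  show ?thesis
  proof (rule whpI[OF A(1,2)])
    fix N \<omega> assume w: "\<omega> \<in> A N"
    then have "\<omega> \<in> space M" using sets.sets_into_space[OF A(1)] by blast
    then show "Q N \<omega>" by (rule assms(2)) (rule A(3)[OF w])
  qed
qed

lemma whp_conj:
  assumes "whp M P" "whp M Q"
  shows "whp M (\<lambda>N \<omega>. P N \<omega> \<and> Q N \<omega>)"
proof -
  obtain A where A: "\<And>N. A N \<in> events" "(\<lambda>N. prob (A N)) \<longlonglongrightarrow> 1" "\<And>N \<omega>. \<omega> \<in> A N \<Longrightarrow> P N \<omega>"
    by (rule whpE[OF assms(1)]) (rule that)
  obtain B where B: "\<And>N. B N \<in> events" "(\<lambda>N. prob (B N)) \<longlonglongrightarrow> 1" "\<And>N \<omega>. \<omega> \<in> B N \<Longrightarrow> Q N \<omega>"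
    by (rule whpE[OF assms(2)]) (rule that)
  have *: "prob (A N) + prob (B N) - 1 \<le> prob (A N \<inter> B N)" for N
  proof -
    have "prob (A N \<union> B N) = prob (A N) + prob (B N - A N)"
      "prob (B N - A N) = prob (B N) - prob (A N \<inter> B N)"
      using A(1) B(1) finite_measure_Union'[of "A N" "B N"] finite_measure_Diff'[of "B N" "A N"]
      by (simp_all add: Int_commute)
    then show ?thesis using prob_le_1[of "A N \<union> B N"] by linarith
  qed
  have "(\<lambda>N. prob (A N) + prob (B N) - 1) \<longlonglongrightarrow> 1 + 1 - 1"
    by (intro tendsto_intros A B)
  then have lim: "(\<lambda>N. prob (A N) + prob (B N) - 1) \<longlonglongrightarrow> 1" by simp
  have "(\<lambda>N. prob (A N \<inter> B N)) \<longlonglongrightarrow> 1"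
  proof (rule tendsto_sandwich[OF _ _ lim tendsto_const])
    show "\<forall>\<^sub>F N in sequentially. prob (A N) + prob (B N) - 1 \<le> prob (A N \<inter> B N)"
      by (rule always_eventually) (rule allI, rule *)
    show "\<forall>\<^sub>F N in sequentially. prob (A N \<inter> B N) \<le> 1" 
      by (rule always_eventually) (rule allI, rule prob_le_1)
  qed
  show ?thesis
  proof (rule whpI)
    show "A N \<inter> B N \<in> events" for N using A(1) B(1) by (rule sets.Int)
    show "P N \<omega> \<and> Q N \<omega>" if "\<omega> \<in> A N \<inter> B N" for N \<omega> using that A(3) B(3) by simp
  qed fact
qed

text \<open>Sets outside the sigma-algebra have measure \<open>0\<close>, so a limit of \<open>1\<close> forces measurability eventually.\<close>

lemma whp_prob:
  assumes "(\<lambda>N. prob (A N)) \<longlonglongrightarrow> 1"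
  shows "whp M (\<lambda>N \<omega>. \<omega> \<in> A N)"
  unfolding whp_def
proof (intro exI[of _ "\<lambda>N. if A N \<in> events then A N else {}"] conjI)
  have "prob (if A N \<in> events then A N else {}) = prob (A N)" for N
    by (simp add: measure_notin_sets)
  with assms show "(\<lambda>N. prob (if A N \<in> events then A N else {})) \<longlonglongrightarrow> 1" by simp
qed auto

lemma whp_eventually:
  assumes "eventually (\<lambda>N. \<forall>\<omega>\<in>space M. P N \<omega>) sequentially"
  shows "whp M P"
  unfolding whp_def
proof (intro exI[of _ "\<lambda>N. if \<forall>\<omega>\<in>space M. P N \<omega> then space M else {}"] conjI)
  have "eventually (\<lambda>N. prob (if \<forall>\<omega>\<in>space M. P N \<omega> then space M else {}) = 1) sequentially"
    using assms by eventually_elim (simp add: prob_space)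
  then show "(\<lambda>N. prob (if \<forall>\<omega>\<in>space M. P N \<omega> then space M else {})) \<longlonglongrightarrow> 1"
    by (rule tendsto_eventually)
qed auto

lemma whp_AE:
  assumes "\<And>N. AE \<omega> in M. P N \<omega>"
  shows "whp M P"
proof -
  have "\<exists>A. A \<in> events \<and> prob A = 1 \<and> (\<forall>\<omega>\<in>A. P N \<omega>)" for N
  proof -
    obtain S where "S \<subseteq> {\<omega>\<in>space M. P N \<omega>}" "S \<in> events" "prob S = 1"
      by (rule AE_E_prob[OF assms[of N]])
    then show ?thesis by (intro exI[of _ S]) auto
  qed
  then obtain A where "\<And>N. A N \<in> events \<and> prob (A N) = 1 \<and> (\<forall>\<omega>\<in>A N. P N \<omega>)"
    by metis
  then show ?thesis by (intro whpI[of A]) simp_all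
qed

lemma whp_Ball:
  assumes "finite I" "\<And>i. i \<in> I \<Longrightarrow> whp M (P i)"
  shows "whp M (\<lambda>N \<omega>. \<forall>i\<in>I. P i N \<omega>)"
  using assms
proof (induction I)
  case empty
  then show ?case by (intro whp_eventually) auto
next
  case (insert i I)
  then show ?case using whp_conj[of "P i" "\<lambda>N \<omega>. \<forall>i\<in>I. P i N \<omega>"] by simp
qed

lemma whp_not_imp_prob_zero:
  assumes "whp M (\<lambda>N \<omega>. \<omega> \<notin> B N)" "\<And>N. B N \<in> events"
  shows "(\<lambda>N. prob (B N)) \<longlonglongrightarrow> 0"
proof -
  obtain A where A: "\<And>N. A N \<in> events" "(\<lambda>N. prob (A N)) \<longlonglongrightarrow> 1" "\<And>N \<omega>. \<omega> \<in> A N \<Longrightarrow> \<omega> \<notin> B N"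
    by (rule whpE[OF assms(1)]) (rule that)
  have le: "prob (B N) \<le> 1 - prob (A N)" for N
  proof -
    have "B N \<subseteq> space M - A N" using A(3) sets.sets_into_space[OF assms(2)] by auto
    then have "prob (B N) \<le> prob (space M - A N)" using A(1) by (intro finite_measure_mono) auto
    then show ?thesis using A(1) by (simp add: prob_compl)
  qed
  have "(\<lambda>N. 1 - prob (A N)) \<longlonglongrightarrow> 1 - 1" by (intro tendsto_intros A)
  then have lim: "(\<lambda>N. 1 - prob (A N)) \<longlonglongrightarrow> 0" by simp
  show ?thesis
  proof (rule tendsto_sandwich[OF _ _ tendsto_const lim])
    show "\<forall>\<^sub>F N in sequentially. 0 \<le> prob (B N)" by (rule always_eventually) simp
    show "\<forall>\<^sub>F N in sequentially. prob (B N) \<le> 1 - prob (A N)"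
      by (rule always_eventually) (rule allI, rule le)
  qed
qed

lemma whp_witness:
  assumes "whp M P"
  shows "eventually (\<lambda>N. \<exists>\<omega>\<in>space M. P N \<omega>) sequentially"
proof -
  obtain A where A: "\<And>N. A N \<in> events" "(\<lambda>N. prob (A N)) \<longlonglongrightarrow> 1" "\<And>N \<omega>. \<omega> \<in> A N \<Longrightarrow> P N \<omega>"
    by (rule whpE[OF assms]) (rule that)
  have "eventually (\<lambda>N. prob (A N) > 0) sequentially"
    using A(2) by (rule order_tendstoD) simp
  then show ?thesis
  proof eventually_elim
    case (elim N)
    then have "A N \<noteq> {}" by force
    then show ?case using A(1,3) sets.sets_into_space by blast
  qed
qed

lemma converges_in_prob_whp:
  assumes "converges_in_prob M X c" "\<epsilon> > 0"
  shows "whp M (\<lambda>N \<omega>. \<bar>X N \<omega> - c\<bar> \<le> \<epsilon>)"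
proof -
  have [measurable]: "X N \<in> borel_measurable M" for N
    using assms(1) by (simp add: converges_in_prob_def)
  have "(\<lambda>N. 1 - prob {\<omega>\<in>space M. \<bar>X N \<omega> - c\<bar> > \<epsilon>}) \<longlonglongrightarrow> 1 - 0"
    using assms by (intro tendsto_intros) (simp add: converges_in_prob_def)
  moreover have "1 - prob {\<omega>\<in>space M. \<bar>X N \<omega> - c\<bar> > \<epsilon>} = prob {\<omega>\<in>space M. \<bar>X N \<omega> - c\<bar> \<le> \<epsilon>}" for N
    by (subst prob_compl[symmetric]) (auto intro!: arg_cong[where f=prob])
  ultimately have "(\<lambda>N. prob {\<omega>\<in>space M. \<bar>X N \<omega> - c\<bar> \<le> \<epsilon>}) \<longlonglongrightarrow> 1" by simp
  from whp_prob[OF this] show ?thesis by (rule whp_mono) auto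
qed

lemma whp_converges_in_prob:
  assumes [measurable]: "\<And>N. X N \<in> borel_measurable M"
    and "\<And>\<epsilon>. \<epsilon> > 0 \<Longrightarrow> whp M (\<lambda>N \<omega>. \<bar>X N \<omega> - c\<bar> \<le> \<epsilon>)"
  shows "converges_in_prob M X c"
  unfolding converges_in_prob_def
proof (intro conjI allI impI)
  fix \<epsilon> :: real assume "\<epsilon> > 0"
  from assms(2)[OF this] have "whp M (\<lambda>N \<omega>. \<omega> \<notin> {\<omega>\<in>space M. \<bar>X N \<omega> - c\<bar> > \<epsilon>})"
    by (rule whp_mono) auto
  then show "(\<lambda>N. prob {\<omega>\<in>space M. \<bar>X N \<omega> - c\<bar> > \<epsilon>}) \<longlonglongrightarrow> 0"
    by (rule whp_not_imp_prob_zero) measurable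
qed measurable

end

section \<open>Laws of large numbers\<close>

locale iid_sample = prob_space M for M :: "'a measure" +
  fixes Z :: "nat \<Rightarrow> 'a \<Rightarrow> real" and D :: "real measure"
  assumes indep: "indep_vars (\<lambda>_. borel) Z {1..}"
    and law: "\<And>i. 1 \<le> i \<Longrightarrow> distr M borel (Z i) = D"
begin

lemma Z_measurable [measurable]: "1 \<le> i \<Longrightarrow> Z i \<in> borel_measurable M"
  using indep by (auto simp: indep_vars_def)

lemma sets_D [measurable_cong]: "sets D = sets borel"
  using law[of 1] by (metis le_refl sets_distr)

lemma prob_space_D: "prob_space D"
  using law[of 1] by (metis le_refl prob_space_distr Z_measurable)

lemma integrable_iff: 
  fixes \<phi> :: "real \<Rightarrow> real"
  assumes "1 \<le> i" "\<phi> \<in> borel_measurable D"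
  shows "integrable D \<phi> \<longleftrightarrow> integrable M (\<lambda>\<omega>. \<phi> (Z i \<omega>))"
proof -
  have "\<phi> \<in> borel_measurable borel" using assms(2) by measurable
  then show ?thesis using assms(1) by (simp flip: law[OF assms(1)] add: integrable_distr_eq)
qed

lemma integral_eq: 
  fixes \<phi> :: "real \<Rightarrow> real"
  assumes "1 \<le> i" "\<phi> \<in> borel_measurable D"
  shows "(\<integral>\<omega>. \<phi> (Z i \<omega>) \<partial>M) = (\<integral>z. \<phi> z \<partial>D)"
proof -
  have "\<phi> \<in> borel_measurable borel" using assms(2) by measurable
  then show ?thesis using assms(1) by (simp flip: law[OF assms(1)] add: integral_distr)
qed

abbreviation avg :: "(real \<Rightarrow> real) \<Rightarrow> nat \<Rightarrow> 'a \<Rightarrow> real" where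
  "avg \<phi> N \<omega> \<equiv> (\<Sum>i=1..N. \<phi> (Z i \<omega>)) / real N"

lemma weak_law_bounded:
  fixes \<phi> :: "real \<Rightarrow> real"
  assumes [measurable]: "\<phi> \<in> borel_measurable borel" and bd: "\<And>z. \<bar>\<phi> z\<bar> \<le> b" and "0 < \<epsilon>" "0 < b"
  shows "(\<lambda>N. prob {\<omega>\<in>space M. \<bar>avg \<phi> N \<omega> - (\<integral>z. \<phi> z \<partial>D)\<bar> \<ge> \<epsilon>}) \<longlonglongrightarrow> 0"
proof -
  have bnd: "prob {\<omega>\<in>space M. \<bar>avg \<phi> N \<omega> - (\<integral>z. \<phi> z \<partial>D)\<bar> \<ge> \<epsilon>} \<le>
      2 * exp (-2 * real N * \<epsilon>\<^sup>2 / (b - (-b))\<^sup>2)" if "N \<ge> 1" for N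
  proof -
    have Z1: "Z 1 \<in> borel_measurable M" by simp
    interpret H: Hoeffding_ineq_iid M "{1..N}" "\<lambda>i \<omega>. \<phi> (Z i \<omega>)" "\<lambda>\<omega>. \<phi> (Z 1 \<omega>)" "-b" b "(\<integral>\<omega>. \<phi> (Z 1 \<omega>) \<partial>M)"
    proof unfold_locales
      show "indep_vars (\<lambda>_. borel) (\<lambda>i \<omega>. \<phi> (Z i \<omega>)) {1..N}"
        by (rule indep_vars_compose2[OF indep_vars_subset[OF indep]]) auto
      show "random_variable borel (\<lambda>\<omega>. \<phi> (Z 1 \<omega>))" using Z1 by measurable
      show "distr M borel (\<lambda>\<omega>. \<phi> (Z i \<omega>)) = distr M borel (\<lambda>\<omega>. \<phi> (Z 1 \<omega>))" if "i \<in> {1..N}" for i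
      proof -
        have "distr (distr M borel (Z i)) borel \<phi> = distr (distr M borel (Z 1)) borel \<phi>"
          using law that by simp
        then show ?thesis using that by (simp add: distr_distr comp_def)
      qed
      show "AE x in M. \<phi> (Z 1 x) \<in> {- b..b}" 
      proof -
        have "- b \<le> \<phi> z" "\<phi> z \<le> b" for z using bd[of z] by linarith+
        then show ?thesis by simp
      qed
    qed simp_all
    show ?thesis
    proof -
      have mean: "(\<integral>\<omega>. \<phi> (Z 1 \<omega>) \<partial>M) = (\<integral>z. \<phi> z \<partial>D)"
        by (rule integral_eq) simp_all
      have "0 \<le> \<epsilon>" "- b < b" "{1..N} \<noteq> {}" using \<open>0 < \<epsilon>\<close> \<open>0 < b\<close> that by auto
      from H.Hoeffding_ineq_abs_ge'[OF this] show ?thesis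
        unfolding mean by simp
    qed
  qed
  have "((\<lambda>N. 2 * exp (-2 * real N * \<epsilon>\<^sup>2 / (b - (-b))\<^sup>2)) \<longlonglongrightarrow> 0)"
  proof -
    define c where "c = 2 * \<epsilon>\<^sup>2 / (b - (-b))\<^sup>2"
    have "c > 0" using assms by (simp add: c_def)
    have "2 * exp (-2 * real N * \<epsilon>\<^sup>2 / (b - (-b))\<^sup>2) = 2 * exp (- c) ^ N" for N
      by (simp add: c_def flip: exp_of_nat_mult)
    moreover have "(\<lambda>N. 2 * exp (- c) ^ N) \<longlonglongrightarrow> 2 * 0"
      using \<open>c > 0\<close> by (intro tendsto_intros LIMSEQ_realpow_zero) auto
    ultimately show ?thesis by simp
  qed
  then show ?thesis
    by (rule tendsto_sandwich[OF _ _ tendsto_const, rotated 2])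
       (use bnd in \<open>auto intro!: eventually_sequentiallyI[of 1]\<close>)
qed

text \<open>Khinchin's law. The integrand is truncated: the bounded part concentrates by Hoeffding's
  inequality, and the mean of the tail is small, so its average is controlled by Markov's.\<close>

lemma weak_law:
  fixes \<phi> :: "real \<Rightarrow> real"
  assumes int: "integrable D \<phi>" and "0 < \<epsilon>"
  shows "whp M (\<lambda>N \<omega>. \<bar>avg \<phi> N \<omega> - (\<integral>z. \<phi> z \<partial>D)\<bar> < \<epsilon>)"
proof -
  have [measurable]: "\<phi> \<in> borel_measurable borel" using int by measurable
  define \<mu> where "\<mu> = (\<integral>z. \<phi> z \<partial>D)"
  define \<phi>m where "\<phi>m = (\<lambda>(m::nat) z. if \<bar>\<phi> z\<bar> \<le> m then \<phi> z else 0)"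
  have [measurable]: "\<phi>m m \<in> borel_measurable borel" for m unfolding \<phi>m_def by measurable
  have intm: "integrable D (\<phi>m m)" for m
    using int by (rule Bochner_Integration.integrable_bound) (auto simp: \<phi>m_def)
  have tail: "(\<lambda>m. \<integral>z. \<bar>\<phi> z - \<phi>m m z\<bar> \<partial>D) \<longlonglongrightarrow> (\<integral>z. 0 \<partial>D)"
  proof (rule integral_dominated_convergence[where w="\<lambda>z. \<bar>\<phi> z\<bar>"])
    show "AE z in D. (\<lambda>m. \<bar>\<phi> z - \<phi>m m z\<bar>) \<longlonglongrightarrow> 0"
    proof (rule AE_I2)
      fix z
      obtain m0 :: nat where "\<bar>\<phi> z\<bar> \<le> m0" using real_arch_simple by blast
      then have "eventually (\<lambda>m. \<bar>\<phi> z - \<phi>m m z\<bar> = 0) sequentially"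
        by (intro eventually_sequentiallyI[of m0]) (simp add: \<phi>m_def)
      then show "(\<lambda>m. \<bar>\<phi> z - \<phi>m m z\<bar>) \<longlonglongrightarrow> 0" by (rule tendsto_eventually)
    qed
  qed (use int in \<open>auto simp: \<phi>m_def\<close>)
  have avgm [measurable]: "avg g N \<in> borel_measurable M" if "g \<in> borel_measurable borel" for g N
    using that by measurable
  define A where "A N = {\<omega>\<in>space M. \<bar>avg \<phi> N \<omega> - \<mu>\<bar> < \<epsilon>}" for N
  have "(\<lambda>N. prob (space M - A N)) \<longlonglongrightarrow> 0"
  proof (rule LIMSEQ_I)
    fix r :: real assume "r > 0"
    have "eventually (\<lambda>m. (\<integral>z. \<bar>\<phi> z - \<phi>m m z\<bar> \<partial>D) < min (\<epsilon>/4) (r * \<epsilon> / 4)) sequentially"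
      using tail \<open>0 < \<epsilon>\<close> \<open>r > 0\<close> by (intro order_tendstoD) auto
    then obtain m where m: "(\<integral>z. \<bar>\<phi> z - \<phi>m m z\<bar> \<partial>D) < min (\<epsilon>/4) (r * \<epsilon> / 4)"
      by (auto simp: eventually_sequentially)
    have "(\<lambda>N. prob {\<omega>\<in>space M. \<bar>avg (\<phi>m m) N \<omega> - (\<integral>z. \<phi>m m z \<partial>D)\<bar> \<ge> \<epsilon>/4}) \<longlonglongrightarrow> 0"
      using \<open>0 < \<epsilon>\<close> by (intro weak_law_bounded[where b="real m + 1"]) (auto simp: \<phi>m_def)
    then have "eventually (\<lambda>N. prob {\<omega>\<in>space M. \<bar>avg (\<phi>m m) N \<omega> - (\<integral>z. \<phi>m m z \<partial>D)\<bar> \<ge> \<epsilon>/4} < r/2) sequentially"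
      using \<open>r > 0\<close> by (intro order_tendstoD) auto
    then obtain N0 where N0: "\<forall>N\<ge>N0. prob {\<omega>\<in>space M. \<bar>avg (\<phi>m m) N \<omega> - (\<integral>z. \<phi>m m z \<partial>D)\<bar> \<ge> \<epsilon>/4} < r/2"
      unfolding eventually_sequentially by (elim exE)
    define R where "R z = \<bar>\<phi> z - \<phi>m m z\<bar>" for z
    have [measurable]: "R \<in> borel_measurable borel" unfolding R_def by measurable
    have intR: "integrable D R" unfolding R_def using int intm by auto
    have "prob (space M - A N) < r" if N: "N \<ge> max 1 N0" for N
    proof -
      define B where "B = {\<omega>\<in>space M. \<bar>avg (\<phi>m m) N \<omega> - (\<integral>z. \<phi>m m z \<partial>D)\<bar> \<ge> \<epsilon>/4}"
      define C where "C = {\<omega>\<in>space M. avg R N \<omega> \<ge> \<epsilon>/2}"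
      have [measurable]: "B \<in> events" "C \<in> events" unfolding B_def C_def by measurable
      have sub: "space M - A N \<subseteq> B \<union> C"
      proof (rule ccontr)
        assume "\<not> ?thesis"
        then obtain \<omega> where w0: "\<omega> \<in> space M" "\<omega> \<notin> A N" "\<omega> \<notin> B" "\<omega> \<notin> C" by blast
        then have w: "\<not> \<bar>avg \<phi> N \<omega> - \<mu>\<bar> < \<epsilon>"
          "\<bar>avg (\<phi>m m) N \<omega> - (\<integral>z. \<phi>m m z \<partial>D)\<bar> < \<epsilon>/4" "avg R N \<omega> < \<epsilon>/2"
          by (simp_all add: A_def B_def C_def not_le)
        have "\<bar>avg \<phi> N \<omega> - avg (\<phi>m m) N \<omega>\<bar> = \<bar>\<Sum>i=1..N. \<phi> (Z i \<omega>) - \<phi>m m (Z i \<omega>)\<bar> / N"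
          by (simp add: sum_subtractf flip: diff_divide_distrib)
        also have "\<dots> \<le> avg R N \<omega>"
          by (intro divide_right_mono order.trans[OF sum_abs]) (auto simp: R_def)
        finally have 1: "\<bar>avg \<phi> N \<omega> - avg (\<phi>m m) N \<omega>\<bar> < \<epsilon>/2" using w(3) by linarith
        have "\<bar>(\<integral>z. \<phi>m m z \<partial>D) - \<mu>\<bar> = \<bar>\<integral>z. \<phi> z - \<phi>m m z \<partial>D\<bar>"
          unfolding \<mu>_def using int intm by (subst Bochner_Integration.integral_diff) auto
        also have "\<dots> \<le> (\<integral>z. \<bar>\<phi> z - \<phi>m m z\<bar> \<partial>D)" by (rule integral_abs_bound)
        also have "\<dots> < \<epsilon>/4" using m by simp
        finally show False using 1 w by linarith
      qed
      have "prob C \<le> (\<integral>\<omega>. avg R N \<omega> \<partial>M) / (\<epsilon>/2)"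
      proof -
        have "integrable M (\<lambda>\<omega>. avg R N \<omega>)"
          using intR by (intro integrable_divide Bochner_Integration.integrable_sum) (auto simp: integrable_iff[symmetric])
        then show ?thesis unfolding C_def using \<open>0 < \<epsilon>\<close>
          by (intro integral_Markov_inequality_measure[where A="{}"])
             (auto intro!: divide_nonneg_nonneg sum_nonneg simp: R_def)
      qed
      also have "(\<integral>\<omega>. avg R N \<omega> \<partial>M) = (\<integral>z. R z \<partial>D)"
      proof -
        have "(\<integral>\<omega>. avg R N \<omega> \<partial>M) = (\<Sum>i=1..N. (\<integral>\<omega>. R (Z i \<omega>) \<partial>M)) / N"
          using intR by (subst integral_divide_zero, subst Bochner_Integration.integral_sum) (auto simp: integrable_iff[symmetric])
        also have "(\<Sum>i=1..N. (\<integral>\<omega>. R (Z i \<omega>) \<partial>M)) = (\<Sum>i=1..N. (\<integral>z. R z \<partial>D))"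
          by (intro sum.cong integral_eq) auto
        finally show ?thesis using N by simp
      qed
      also have "(\<integral>z. R z \<partial>D) / (\<epsilon>/2) < r/2"
        using m \<open>0 < \<epsilon>\<close> unfolding R_def by (simp add: field_simps)
      finally have "prob C < r/2" .
      moreover have "prob B < r/2" using N0 N by (simp add: B_def)
      moreover have "prob (space M - A N) \<le> prob (B \<union> C)"
        by (intro finite_measure_mono sub) auto
      moreover have "prob (B \<union> C) \<le> prob B + prob C" by (intro measure_Un_le) auto
      ultimately show ?thesis by linarith
    qed
    then show "\<exists>no. \<forall>n\<ge>no. norm (prob (space M - A n) - 0) < r"
      by (intro exI[of _ "max 1 N0"]) auto
  qed
  then have "(\<lambda>N. 1 - prob (space M - A N)) \<longlonglongrightarrow> 1 - 0" by (intro tendsto_intros)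
  moreover have "A N \<in> events" for N unfolding A_def by measurable
  ultimately have "(\<lambda>N. prob (A N)) \<longlonglongrightarrow> 1" by (simp add: prob_compl)
  from whp_prob[OF this] show ?thesis by (rule whp_mono) (auto simp: A_def \<mu>_def)
qed

end


section \<open>Suprema and random arguments of continuous families of measurable functions\<close>

lemma le_on_dense_imp_le:
  fixes g :: "'p::topological_space \<Rightarrow> real"
  assumes "continuous_on S g" "T \<subseteq> S" "S \<subseteq> closure T" "\<And>p. p \<in> T \<Longrightarrow> g p \<le> c" "p \<in> S"
  shows "g p \<le> c"
proof -
  have "closedin (top_of_set S) (S \<inter> g -` {..c})"
    using assms(1) by (rule continuous_closedin_preimage) simp
  then obtain C where C: "closed C" "S \<inter> g -` {..c} = S \<inter> C"
    by (auto simp: closedin_closed)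
  have "T \<subseteq> C" using C(2) assms(2,4) by blast
  then have "closure T \<subseteq> C" using C(1) by (rule closure_minimal)
  then show ?thesis using C(2) assms(3,5) by blast
qed

lemma SUP_dense_eq:
  fixes g :: "'p::topological_space \<Rightarrow> real"
  assumes "continuous_on S g" "T \<subseteq> S" "S \<subseteq> closure T"
  shows "(SUP p\<in>S. g p) = (SUP p\<in>T. g p)"
proof -
  have "(\<forall>x\<in>g ` S. x \<le> c) \<longleftrightarrow> (\<forall>x\<in>g ` T. x \<le> c)" for c
    using le_on_dense_imp_le[OF assms] assms(2) by blast
  then show ?thesis by (simp add: Sup_real_def)
qed

text \<open>By continuity the supremum may be taken over a countable dense set. This also applies where the family is
  unbounded, since boundedness can be tested on the dense set.\<close>

lemma borel_measurable_SUP_continuous: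
  fixes \<phi> :: "'a \<Rightarrow> 'p::{metric_space, second_countable_topology} \<Rightarrow> real"
  assumes meas: "\<And>p. p \<in> S \<Longrightarrow> (\<lambda>\<omega>. \<phi> \<omega> p) \<in> borel_measurable M"
    and cont: "\<And>\<omega>. \<omega> \<in> space M \<Longrightarrow> continuous_on S (\<phi> \<omega>)"
  shows "(\<lambda>\<omega>. SUP p\<in>S. \<phi> \<omega> p) \<in> borel_measurable M"
proof -
  obtain T where T: "countable T" "T \<subseteq> S" "S \<subseteq> closure T" by (rule separable)
  have mT: "(\<lambda>\<omega>. \<phi> \<omega> p) \<in> borel_measurable M" if "p \<in> T" for p
    using meas T(2) that by blast
  define b where "b \<omega> \<longleftrightarrow> (\<exists>n::nat. \<forall>p\<in>T. \<phi> \<omega> p \<le> n)" for \<omega>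
  have "{\<omega>\<in>space M. b \<omega>} = (\<Union>n::nat. {\<omega>\<in>space M. \<forall>p\<in>T. \<phi> \<omega> p \<le> n})"
    by (auto simp: b_def)
  also have "\<dots> \<in> sets M"
    using mT T(1) by (intro sets.countable_UN'' sets.sets_Collect_countable_Ball) (auto)
  finally have [measurable]: "Measurable.pred M b" by (simp add: pred_def)
  \<comment> \<open>An unbounded set of reals has the junk value below as its supremum.\<close>
  define junk where "junk = (LEAST z::real. False)"
  have "(SUP p\<in>S. \<phi> \<omega> p) = (if b \<omega> then (SUP p\<in>T. if b \<omega> then \<phi> \<omega> p else 0) else junk)"
    if w: "\<omega> \<in> space M" for \<omega>
  proof -
    have "(SUP p\<in>T. \<phi> \<omega> p) = junk" if "\<not> b \<omega>"
    proof -
      have "\<not> (\<forall>x\<in>\<phi> \<omega> ` T. x \<le> z)" for z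
      proof
        assume "\<forall>x\<in>\<phi> \<omega> ` T. x \<le> z"
        moreover obtain n :: nat where "z \<le> n" using real_arch_simple by blast
        ultimately have "\<forall>p\<in>T. \<phi> \<omega> p \<le> n" by force
        then show False using that unfolding b_def by blast
      qed
      then have "(\<lambda>z. \<forall>x\<in>\<phi> \<omega> ` T. x \<le> z) = (\<lambda>z. False)" by (intro ext) blast
      then show ?thesis unfolding Sup_real_def junk_def by simp
    qed
    then show ?thesis using SUP_dense_eq[OF cont[OF w] T(2,3)] by auto
  qed
  moreover have "(\<lambda>\<omega>. if b \<omega> then (SUP p\<in>T. if b \<omega> then \<phi> \<omega> p else 0) else junk) \<in> borel_measurable M"
  proof -
    have "(\<lambda>\<omega>. SUP p\<in>T. if b \<omega> then \<phi> \<omega> p else 0) \<in> borel_measurable M"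
    proof (rule borel_measurable_cSUP[OF T(1)])
      show "(\<lambda>\<omega>. if b \<omega> then \<phi> \<omega> p else 0) \<in> borel_measurable M" if "p \<in> T" for p
        using mT[OF that] by measurable
      show "bdd_above ((\<lambda>p. if b \<omega> then \<phi> \<omega> p else 0) ` T)" for \<omega>
        by (cases "b \<omega>") (auto simp: b_def bdd_above_def)
    qed
    then show ?thesis by measurable
  qed
  ultimately show ?thesis by (subst measurable_cong) auto
qed

text \<open>A function that is measurable in one variable and continuous in the other may be evaluated at a
  random point: approximate the point by a measurable choice from a countable dense set.\<close>

lemma borel_measurable_Caratheodory:
  fixes \<phi> :: "'a \<Rightarrow> 'p::{metric_space, second_countable_topology} \<Rightarrow> real"
  assumes meas: "\<And>p. p \<in> S \<Longrightarrow> (\<lambda>\<omega>. \<phi> \<omega> p) \<in> borel_measurable M"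
    and cont: "\<And>\<omega>. \<omega> \<in> space M \<Longrightarrow> continuous_on S (\<phi> \<omega>)"
    and [measurable]: "Y \<in> borel_measurable M" and YS: "\<And>\<omega>. \<omega> \<in> space M \<Longrightarrow> Y \<omega> \<in> S"
  shows "(\<lambda>\<omega>. \<phi> \<omega> (Y \<omega>)) \<in> borel_measurable M"
proof (cases "space M = {}")
  case True
  then show ?thesis by (simp add: measurable_def)
next
  case False
  obtain T where T: "countable T" "T \<subseteq> S" "S \<subseteq> closure T" by (rule separable)
  have "T \<noteq> {}" using False YS T(3) by auto
  define d where "d = from_nat_into T"
  have dT: "d k \<in> T" for k using \<open>T \<noteq> {}\<close> by (simp add: d_def from_nat_into)
  define K where "K n \<omega> = (LEAST k. dist (Y \<omega>) (d k) < 1 / Suc n)" for n \<omega>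
  have [measurable]: "K n \<in> measurable M (count_space UNIV)" for n
    unfolding K_def by measurable
  have near: "dist (Y \<omega>) (d (K n \<omega>)) < 1 / Suc n" if "\<omega> \<in> space M" for n \<omega>
  proof -
    have "Y \<omega> \<in> closure T" using YS[OF that] T(3) by blast
    then obtain y where "y \<in> T" "dist y (Y \<omega>) < 1 / Suc n"
      unfolding closure_approachable by (metis of_nat_0_less_iff zero_less_Suc zero_less_divide_1_iff)
    moreover then obtain k where "y = d k" using T(1) by (metis d_def from_nat_into_surj)
    ultimately have "dist (Y \<omega>) (d k) < 1 / Suc n" by (simp add: dist_commute)
    then show ?thesis unfolding K_def by (rule LeastI)
  qed
  show ?thesis
  proof (rule borel_measurable_LIMSEQ_real)
    show "(\<lambda>\<omega>. \<phi> \<omega> (d (K n \<omega>))) \<in> borel_measurable M" for n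
      by (rule measurable_compose_countable[where f="\<lambda>k \<omega>. \<phi> \<omega> (d k)"]) (use meas dT T(2) in auto)
    fix \<omega> assume w: "\<omega> \<in> space M"
    have "(\<lambda>n. dist (d (K n \<omega>)) (Y \<omega>)) \<longlonglongrightarrow> 0"
    proof (rule tendsto_sandwich[OF _ _ tendsto_const LIMSEQ_Suc[OF lim_1_over_n]])
      show "\<forall>\<^sub>F n in sequentially. dist (d (K n \<omega>)) (Y \<omega>) \<le> 1 / of_nat (Suc n)"
        using near[OF w] by (intro always_eventually allI) (simp add: dist_commute less_imp_le)
    qed simp
    then have "(\<lambda>n. d (K n \<omega>)) \<longlonglongrightarrow> Y \<omega>" using tendsto_dist_iff by blast
    then show "(\<lambda>n. \<phi> \<omega> (d (K n \<omega>))) \<longlonglongrightarrow> \<phi> \<omega> (Y \<omega>)"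
      using YS[OF w] dT T(2)
      by (intro continuous_on_tendsto_compose[OF cont[OF w]] always_eventually allI) blast+
  qed
qed

section \<open>Uniform laws of large numbers near a parameter\<close>

context iid_sample
begin

text \<open>Wald's argument. The supremum of the summand over a small ball decreases to its value at the
  centre as the ball shrinks, so by dominated convergence its mean comes within \<open>\<epsilon>\<close> of the mean
  at the centre; the weak law applied to that supremum bounds all averages over the ball at once.
  Domination is one-sided because log-likelihood ratios have an envelope from above only.\<close>

lemma uniform_upper_law:
  fixes \<phi> :: "real \<Rightarrow> 'p::{metric_space, second_countable_topology} \<Rightarrow> real"
  assumes meas: "\<And>p. p \<in> S \<Longrightarrow> (\<lambda>z. \<phi> z p) \<in> borel_measurable borel"
    and cont: "\<And>z. continuous_on S (\<phi> z)"
    and p0: "p0 \<in> S" and U: "open U" "p0 \<in> U"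
    and dom: "\<And>z p. p \<in> U \<inter> S \<Longrightarrow> \<phi> z p \<le> G z"
    and intG: "integrable D G" and int0: "integrable D (\<lambda>z. \<phi> z p0)" and "0 < \<epsilon>"
  shows "\<exists>W. open W \<and> p0 \<in> W \<and>
    whp M (\<lambda>N \<omega>. \<forall>p\<in>W \<inter> S. avg (\<lambda>z. \<phi> z p) N \<omega> \<le> (\<integral>z. \<phi> z p0 \<partial>D) + \<epsilon>)"
proof -
  obtain r where r: "r > 0" "ball p0 r \<subseteq> U" using U by (rule openE)
  define B where "B n = ball p0 (r / Suc n) \<inter> S" for n :: nat
  define h where "h n z = (SUP p\<in>B n. \<phi> z p)" for n z
  have Br: "ball p0 (r / Suc n) \<subseteq> ball p0 r" for n
    using r(1) by (intro subset_ball) (simp add: field_simps mult_nonneg_nonneg)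
  then have BU: "B n \<subseteq> U \<inter> S" for n unfolding B_def using r(2) by blast
  have p0B: "p0 \<in> B n" for n using r(1) p0 by (simp add: B_def)
  have bdd: "bdd_above (\<phi> z ` B n)" for z n
    using dom BU by (intro bdd_aboveI2[of _ _ "G z"]) blast
  have h_ge: "\<phi> z p \<le> h n z" if "p \<in> B n" for z p n
    unfolding h_def using that bdd by (rule cSUP_upper)
  have h_le: "h n z \<le> G z" for n z
    unfolding h_def using p0B dom BU by (intro cSUP_least) blast+
  have [measurable]: "h n \<in> borel_measurable D" for n
    unfolding h_def
  proof (rule borel_measurable_SUP_continuous)
    show "(\<lambda>z. \<phi> z p) \<in> borel_measurable D" if "p \<in> B n" for p
    proof -
      have "p \<in> S" using that by (simp add: B_def)
      from meas[OF this] show ?thesis by measurable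
    qed
    show "continuous_on (B n) (\<phi> z)" for z
      using cont by (rule continuous_on_subset) (simp add: B_def)
  qed
  have h_lim: "(\<lambda>n. h n z) \<longlonglongrightarrow> \<phi> z p0" for z
  proof (rule LIMSEQ_I)
    fix e :: real assume "e > 0"
    then obtain d where d: "d > 0" "\<And>p. p \<in> S \<Longrightarrow> dist p p0 < d \<Longrightarrow> dist (\<phi> z p) (\<phi> z p0) < e/2"
      using cont[of z] p0 unfolding continuous_on_iff by (metis half_gt_zero)
    obtain n0 where n0: "inverse (real (Suc n0)) < d / r"
      using reals_Archimedean[of "d/r"] d(1) r(1) by auto
    have "norm (h n z - \<phi> z p0) < e" if "n \<ge> n0" for n
    proof -
      have "h n z \<le> \<phi> z p0 + e/2"
        unfolding h_def
      proof (rule cSUP_least)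
        fix p assume p: "p \<in> B n"
        have "r / Suc n \<le> r / Suc n0" using that r(1) by (intro divide_left_mono) auto
        also have "\<dots> < d" using n0 r(1) by (simp add: field_simps)
        finally have "dist p p0 < d" using p by (simp add: B_def dist_commute)
        then have "\<bar>\<phi> z p - \<phi> z p0\<bar> < e/2" using d(2)[of p] p by (simp add: B_def dist_real_def)
        then show "\<phi> z p \<le> \<phi> z p0 + e/2" by linarith
      qed (use p0B in blast)
      moreover have "\<phi> z p0 \<le> h n z" by (rule h_ge[OF p0B])
      ultimately show ?thesis using \<open>e > 0\<close> by (simp add: abs_if)
    qed
    then show "\<exists>no. \<forall>n\<ge>no. norm (h n z - \<phi> z p0) < e" by blast
  qed
  have h_abs: "\<bar>h n z\<bar> \<le> \<bar>\<phi> z p0\<bar> + \<bar>G z\<bar>" for n z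
    using h_ge[OF p0B, of z n] h_le[of n z] by linarith
  have intw: "integrable D (\<lambda>z. \<bar>\<phi> z p0\<bar> + \<bar>G z\<bar>)" using intG int0 by auto
  have "(\<lambda>n. \<integral>z. h n z \<partial>D) \<longlonglongrightarrow> (\<integral>z. \<phi> z p0 \<partial>D)"
    using h_lim h_abs int0 intw by (intro integral_dominated_convergence[where w="\<lambda>z. \<bar>\<phi> z p0\<bar> + \<bar>G z\<bar>"]) auto
  then have "\<forall>\<^sub>F n in sequentially. (\<integral>z. h n z \<partial>D) < (\<integral>z. \<phi> z p0 \<partial>D) + \<epsilon>/2"
    using \<open>0 < \<epsilon>\<close> by (intro order_tendstoD) auto
  then obtain n where n: "(\<integral>z. h n z \<partial>D) < (\<integral>z. \<phi> z p0 \<partial>D) + \<epsilon>/2"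
    by (rule eventually_happens'[OF sequentially_bot, THEN exE])
  have "integrable D (h n)"
    using intw by (rule Bochner_Integration.integrable_bound) (use h_abs in auto)
  from weak_law[OF this, of "\<epsilon>/2"] \<open>0 < \<epsilon>\<close>
  have "whp M (\<lambda>N \<omega>. \<bar>avg (h n) N \<omega> - (\<integral>z. h n z \<partial>D)\<bar> < \<epsilon>/2)" by simp
  then have "whp M (\<lambda>N \<omega>. \<forall>p\<in>ball p0 (r / Suc n) \<inter> S. avg (\<lambda>z. \<phi> z p) N \<omega> \<le> (\<integral>z. \<phi> z p0 \<partial>D) + \<epsilon>)"
  proof (rule whp_mono, intro ballI)
    fix N \<omega> p
    assume "\<bar>avg (h n) N \<omega> - (\<integral>z. h n z \<partial>D)\<bar> < \<epsilon>/2" and p: "p \<in> ball p0 (r / Suc n) \<inter> S"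
    moreover have "avg (\<lambda>z. \<phi> z p) N \<omega> \<le> avg (h n) N \<omega>"
      using p by (intro divide_right_mono sum_mono h_ge) (auto simp: B_def)
    ultimately show "avg (\<lambda>z. \<phi> z p) N \<omega> \<le> (\<integral>z. \<phi> z p0 \<partial>D) + \<epsilon>" using n by linarith
  qed
  then show ?thesis using r(1) by (intro exI[of _ "ball p0 (r / Suc n)"]) auto
qed

lemma uniform_law:
  fixes \<phi> :: "real \<Rightarrow> 'p::{metric_space, second_countable_topology} \<Rightarrow> real"
  assumes meas: "\<And>p. p \<in> S \<Longrightarrow> (\<lambda>z. \<phi> z p) \<in> borel_measurable borel"
    and cont: "\<And>z. continuous_on S (\<phi> z)"
    and p0: "p0 \<in> S" and U: "open U" "p0 \<in> U"
    and dom: "\<And>z p. p \<in> U \<inter> S \<Longrightarrow> \<bar>\<phi> z p\<bar> \<le> G z"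
    and intG: "integrable D G" and "0 < \<epsilon>"
  shows "\<exists>W. open W \<and> p0 \<in> W \<and>
    whp M (\<lambda>N \<omega>. \<forall>p\<in>W \<inter> S. \<bar>avg (\<lambda>z. \<phi> z p) N \<omega> - (\<integral>z. \<phi> z p0 \<partial>D)\<bar> \<le> \<epsilon>)"
proof -
  have m0 [measurable]: "(\<lambda>z. \<phi> z p0) \<in> borel_measurable borel" by (rule meas[OF p0])
  have dom0: "\<bar>\<phi> z p0\<bar> \<le> \<bar>G z\<bar>" for z using dom[of p0 z] p0 U(2) by auto
  have int0: "integrable D (\<lambda>z. \<phi> z p0)"
    using intG by (rule Bochner_Integration.integrable_bound) (use dom0 in auto)
  have d: "\<phi> z p \<le> G z" "- \<phi> z p \<le> G z" if "p \<in> U \<inter> S" for z p using dom[OF that, of z] by auto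
  obtain W1 where W1: "open W1" "p0 \<in> W1"
    "whp M (\<lambda>N \<omega>. \<forall>p\<in>W1 \<inter> S. avg (\<lambda>z. \<phi> z p) N \<omega> \<le> (\<integral>z. \<phi> z p0 \<partial>D) + \<epsilon>)"
    using uniform_upper_law[OF meas cont p0 U d(1) intG int0 \<open>0 < \<epsilon>\<close>] by blast
  have "\<exists>W. open W \<and> p0 \<in> W \<and>
    whp M (\<lambda>N \<omega>. \<forall>p\<in>W \<inter> S. avg (\<lambda>z. - \<phi> z p) N \<omega> \<le> (\<integral>z. - \<phi> z p0 \<partial>D) + \<epsilon>)"
    by (rule uniform_upper_law[where U=U and G=G])
       (use meas cont p0 U d(2) intG int0 \<open>0 < \<epsilon>\<close> in \<open>auto intro!: continuous_on_minus\<close>)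
  then obtain W2 where W2: "open W2" "p0 \<in> W2"
    "whp M (\<lambda>N \<omega>. \<forall>p\<in>W2 \<inter> S. avg (\<lambda>z. - \<phi> z p) N \<omega> \<le> (\<integral>z. - \<phi> z p0 \<partial>D) + \<epsilon>)"
    by blast
  have "whp M (\<lambda>N \<omega>. \<forall>p\<in>(W1 \<inter> W2) \<inter> S. \<bar>avg (\<lambda>z. \<phi> z p) N \<omega> - (\<integral>z. \<phi> z p0 \<partial>D)\<bar> \<le> \<epsilon>)"
    using whp_conj[OF W1(3) W2(3)]
  proof (rule whp_mono, intro ballI)
    fix N \<omega> p
    assume "(\<forall>p\<in>W1 \<inter> S. avg (\<lambda>z. \<phi> z p) N \<omega> \<le> (\<integral>z. \<phi> z p0 \<partial>D) + \<epsilon>) \<and>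
        (\<forall>p\<in>W2 \<inter> S. avg (\<lambda>z. - \<phi> z p) N \<omega> \<le> (\<integral>z. - \<phi> z p0 \<partial>D) + \<epsilon>)"
      and p: "p \<in> (W1 \<inter> W2) \<inter> S"
    then have "avg (\<lambda>z. \<phi> z p) N \<omega> \<le> (\<integral>z. \<phi> z p0 \<partial>D) + \<epsilon>"
      "avg (\<lambda>z. - \<phi> z p) N \<omega> \<le> (\<integral>z. - \<phi> z p0 \<partial>D) + \<epsilon>" by blast+
    then show "\<bar>avg (\<lambda>z. \<phi> z p) N \<omega> - (\<integral>z. \<phi> z p0 \<partial>D)\<bar> \<le> \<epsilon>"
      by (simp add: sum_negf abs_le_iff)
  qed
  then show ?thesis using W1 W2 by (intro exI[of _ "W1 \<inter> W2"]) auto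
qed

end


section \<open>Derivatives of the logarithm of a positive function\<close>

text \<open>If \<open>m 0, m 1, \<dots>\<close> are the successive derivatives of \<open>m 0\<close>, then \<open>log_deriv k m\<close> is the
  \<open>k\<close>-th derivative of \<open>ln (m 0)\<close>, for \<open>k \<le> 4\<close>. Its own derivative, when the \<open>m k\<close> move with velocities
  \<open>c k\<close>, is \<open>log_deriv_velocity k m c\<close> (for \<open>k < 4\<close>). Keeping \<open>c\<close> free serves partial derivatives as well
  as derivatives along a line: the former have velocities other than \<open>m (k + 1)\<close>, but the velocity
  enters linearly, so a difference of partial derivatives only sees the difference of velocities.\<close>

fun log_deriv :: "nat \<Rightarrow> (nat \<Rightarrow> real) \<Rightarrow> real" where
  "log_deriv 0 m = ln (m 0)"
| "log_deriv (Suc 0) m = m 1 / m 0"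
| "log_deriv (Suc (Suc 0)) m = m 2 / m 0 - (m 1 / m 0)\<^sup>2"
| "log_deriv (Suc (Suc (Suc 0))) m = m 3 / m 0 - 3 * (m 1 / m 0) * (m 2 / m 0) + 2 * (m 1 / m 0) ^ 3"
| "log_deriv (Suc (Suc (Suc (Suc _)))) m = m 4 / m 0 - 4 * (m 1 / m 0) * (m 3 / m 0) - 3 * (m 2 / m 0)\<^sup>2
    + 12 * (m 1 / m 0)\<^sup>2 * (m 2 / m 0) - 6 * (m 1 / m 0) ^ 4"

definition ratio_velocity :: "(nat \<Rightarrow> real) \<Rightarrow> (nat \<Rightarrow> real) \<Rightarrow> nat \<Rightarrow> real" where
  "ratio_velocity m c k = c k / m 0 - m k / m 0 * (c 0 / m 0)"

fun log_deriv_velocity :: "nat \<Rightarrow> (nat \<Rightarrow> real) \<Rightarrow> (nat \<Rightarrow> real) \<Rightarrow> real" where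
  "log_deriv_velocity 0 m c = c 0 / m 0"
| "log_deriv_velocity (Suc 0) m c = ratio_velocity m c 1"
| "log_deriv_velocity (Suc (Suc 0)) m c = ratio_velocity m c 2 - 2 * (m 1 / m 0) * ratio_velocity m c 1"
| "log_deriv_velocity (Suc (Suc (Suc _))) m c = ratio_velocity m c 3
    - 3 * (ratio_velocity m c 1 * (m 2 / m 0) + m 1 / m 0 * ratio_velocity m c 2)
    + 6 * (m 1 / m 0)\<^sup>2 * ratio_velocity m c 1"

lemma less_4_cases:
  assumes "k < (4::nat)"
  obtains "k = 0" | "k = Suc 0" | "k = Suc (Suc 0)" | "k = Suc (Suc (Suc 0))"
  using assms by (auto simp: numeral_eq_Suc less_Suc_eq)

lemma DERIV_log_deriv:
  assumes d: "\<And>k. ((\<lambda>s. m s k) has_field_derivative c k) (at x)" and pos: "m x 0 > 0" and "k < 4"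
  shows "((\<lambda>s. log_deriv k (m s)) has_field_derivative log_deriv_velocity k (m x) c) (at x)"
proof -
  define Q where "Q k s = m s k / m s 0" for k s
  define R where "R k = ratio_velocity (m x) c k" for k
  note [derivative_intros] = d
  have q [derivative_intros]: "(Q k has_field_derivative R k) (at x)" for k
    using pos unfolding ratio_velocity_def R_def Q_def[abs_def]
    by (auto intro!: derivative_eq_intros simp: field_simps)
  show ?thesis
    using \<open>k < 4\<close>
  proof (cases rule: less_4_cases)
    case 1
    then show ?thesis using pos by (auto intro!: derivative_eq_intros)
  next
    case 2
    then show ?thesis using q[of 1] by (simp add: Q_def[abs_def] R_def)
  next
    case 3
    have "((\<lambda>s. Q 2 s - (Q 1 s)\<^sup>2) has_field_derivative R 2 - 2 * Q 1 x * R 1) (at x)"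
      by (auto intro!: derivative_eq_intros)
    then show ?thesis using 3 by (simp add: Q_def[abs_def] R_def)
  next
    case 4
    have "((\<lambda>s. Q 3 s - 3 * Q 1 s * Q 2 s + 2 * Q 1 s ^ 3) has_field_derivative
      R 3 - 3 * (R 1 * Q 2 x + Q 1 x * R 2) + 6 * (Q 1 x)\<^sup>2 * R 1) (at x)"
      by (auto intro!: derivative_eq_intros simp: algebra_simps)
    then show ?thesis using 4 by (simp add: Q_def[abs_def] R_def)
  qed
qed

lemma log_deriv_velocity_diff:
  assumes "k < 4" 
  shows "log_deriv_velocity k m c - log_deriv_velocity k m c' = log_deriv_velocity k m (\<lambda>j. c j - c' j)"
proof -
  have r: "ratio_velocity m (\<lambda>j. c j - c' j) k = ratio_velocity m c k - ratio_velocity m c' k" for k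
    by (simp add: ratio_velocity_def diff_divide_distrib algebra_simps)
  show ?thesis using assms
    by (cases rule: less_4_cases) (simp_all add: r algebra_simps diff_divide_distrib)
qed

lemma log_deriv_velocity_Suc:
  assumes "k < 4"
  shows "log_deriv_velocity k m (\<lambda>j. m (Suc j)) = log_deriv (Suc k) m"
  using assms
  by (cases rule: less_4_cases)
     (simp_all add: ratio_velocity_def numeral_eq_Suc algebra_simps)

text \<open>The \<open>k\<close>-th derivative of the mixture density in the direction that separates the two components,
  \<open>\<partial>/\<partial>t1 - \<partial>/\<partial>t2\<close>.\<close>

definition mixture_deriv ::
  "(real \<Rightarrow> real \<Rightarrow> real \<Rightarrow> real) \<Rightarrow> real \<Rightarrow> real \<Rightarrow> real \<Rightarrow> real \<Rightarrow> nat \<Rightarrow> real" where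
  "mixture_deriv f z t1 t2 e k = (theta_deriv f k z t1 e + (-1) ^ k * theta_deriv f k z t2 e) / 2"

lemma theta_deriv_0 [simp]: "theta_deriv f 0 z t e = f z t e"
  by (simp add: theta_deriv_def)

lemma mixture_deriv_0 [simp]: "mixture_deriv f z t1 t2 e 0 = mixture_density f z t1 t2 e"
  by (simp add: mixture_deriv_def mixture_density_def theta_deriv_def field_simps)

lemma mixture_density_diag [simp]: "mixture_density f z t t e = f z t e"
  by (simp add: mixture_density_def)

lemma log_deriv_diag:
  "log_deriv 2 (mixture_deriv f z t t e) = score f 2 t e z"
  "log_deriv (Suc 0) (mixture_deriv f z t t e) = 0"
  "log_deriv 3 (mixture_deriv f z t t e) = 0"
  by (simp_all add: numeral_eq_Suc mixture_deriv_def score_def)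

section \<open>Expansion of the log-likelihood at a homogeneous maximum\<close>

context regular_family
begin

lemma DERIV_theta_deriv:
  assumes "0 < f z \<theta> \<eta>" "t \<in> \<Theta>" "e \<in> \<E>"
  shows "((\<lambda>s. theta_deriv f r z s e) has_field_derivative theta_deriv f (Suc r) z t e) (at t)"
  using smooth_theta[OF assms, of r] by (simp add: theta_deriv_def field_differentiable_derivI)

lemma density_pos: "0 < f z \<theta> \<eta> \<Longrightarrow> t \<in> \<Theta> \<Longrightarrow> e \<in> \<E> \<Longrightarrow> 0 < f z t e"
  using common_support by blast

lemma mixture_density_pos:
  "0 < f z \<theta> \<eta> \<Longrightarrow> t1 \<in> \<Theta> \<Longrightarrow> t2 \<in> \<Theta> \<Longrightarrow> e \<in> \<E> \<Longrightarrow> 0 < mixture_density f z t1 t2 e"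
  by (simp add: mixture_density_def density_pos add_pos_pos)

context
  fixes z :: "nat \<Rightarrow> real" and N :: nat and e :: real
  assumes in_support: "\<forall>i\<in>{1..N}. 0 < f (z i) \<theta> \<eta>" and e: "e \<in> \<E>"
begin

private lemma supp: "i \<in> {1..N} \<Longrightarrow> 0 < f (z i) \<theta> \<eta>"
  using in_support by blast

abbreviation sum_log_deriv :: "nat \<Rightarrow> real \<Rightarrow> real \<Rightarrow> real" where
  "sum_log_deriv k x y \<equiv> \<Sum>i=1..N. log_deriv k (mixture_deriv f (z i) x y e)"

lemma loglik_eq: "loglik f z N x y e = sum_log_deriv 0 x y"
  by (simp add: loglik_def)

lemma DERIV_sum_log_deriv_line:
  assumes "c + v \<in> \<Theta>" "c - v \<in> \<Theta>" "k < 4"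
  shows "((\<lambda>v. sum_log_deriv k (c + v) (c - v)) has_field_derivative sum_log_deriv (Suc k) (c + v) (c - v)) (at v)"
proof (rule DERIV_sum)
  fix i assume i: "i \<in> {1..N}"
  have d: "((\<lambda>v. mixture_deriv f (z i) (c + v) (c - v) e j) has_field_derivative
      mixture_deriv f (z i) (c + v) (c - v) e (Suc j)) (at v)" for j
  proof -
    have "((\<lambda>v. theta_deriv f j (z i) (c + v) e) has_field_derivative theta_deriv f (Suc j) (z i) (c + v) e * 1) (at v)"
      by (rule DERIV_chain2[where f="\<lambda>s. theta_deriv f j (z i) s e" and g="\<lambda>v. c + v",
            OF DERIV_theta_deriv[OF supp[OF i] assms(1) e]]) (auto intro!: derivative_eq_intros)
    moreover have "((\<lambda>v. theta_deriv f j (z i) (c - v) e) has_field_derivative theta_deriv f (Suc j) (z i) (c - v) e * -1) (at v)"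
      by (rule DERIV_chain2[where f="\<lambda>s. theta_deriv f j (z i) s e" and g="\<lambda>v. c - v",
            OF DERIV_theta_deriv[OF supp[OF i] assms(2) e]]) (auto intro!: derivative_eq_intros)
    ultimately show ?thesis
      unfolding mixture_deriv_def by (auto intro!: derivative_eq_intros)
  qed
  have "((\<lambda>v. log_deriv k (mixture_deriv f (z i) (c + v) (c - v) e)) has_field_derivative
      log_deriv_velocity k (mixture_deriv f (z i) (c + v) (c - v) e) (\<lambda>j. mixture_deriv f (z i) (c + v) (c - v) e (Suc j))) (at v)"
    using mixture_density_pos[OF supp[OF i] assms(1,2) e] by (intro DERIV_log_deriv d \<open>k < 4\<close>) simp
  then show "((\<lambda>v. log_deriv k (mixture_deriv f (z i) (c + v) (c - v) e)) has_field_derivative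
      log_deriv (Suc k) (mixture_deriv f (z i) (c + v) (c - v) e)) (at v)"
    by (simp only: log_deriv_velocity_Suc[OF \<open>k < 4\<close>])
qed

text \<open>The velocities of \<open>mixture_deriv\<close> under the two partial derivatives differ exactly
  by the next \<open>mixture_deriv\<close>, and linearity of \<open>log_deriv_velocity\<close> does the rest.\<close>

lemma D_diff_iterate_loglik:
  assumes "x \<in> \<Theta>" "y \<in> \<Theta>" "k \<le> 4"
  shows "(D_diff ^^ k) (\<lambda>t1 t2. loglik f z N t1 t2 e) x y = sum_log_deriv k x y"
  using assms
proof (induction k arbitrary: x y)
  case 0
  then show ?case by (simp add: loglik_eq)
next
  case (Suc k)
  let ?g = "(D_diff ^^ k) (\<lambda>t1 t2. loglik f z N t1 t2 e)"
  let ?m = "\<lambda>i. mixture_deriv f (z i) x y e"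
  define cx where "cx i j = theta_deriv f (Suc j) (z i) x e / 2" for i j
  define cy where "cy i j = (-1) ^ j * theta_deriv f (Suc j) (z i) y e / 2" for i j
  have k: "k < 4" using Suc.prems by simp
  have "((\<lambda>s. sum_log_deriv k s y) has_field_derivative (\<Sum>i=1..N. log_deriv_velocity k (?m i) (cx i))) (at x)"
  proof (intro DERIV_sum DERIV_log_deriv[OF _ _ k])
    fix i j assume i: "i \<in> {1..N}"
    show "((\<lambda>s. mixture_deriv f (z i) s y e j) has_field_derivative cx i j) (at x)"
      unfolding mixture_deriv_def cx_def using DERIV_theta_deriv[OF supp[OF i] Suc.prems(1) e]
      by (auto intro!: derivative_eq_intros)
  qed (use mixture_density_pos supp e Suc.prems in auto)
  then have "((\<lambda>s. ?g s y) has_field_derivative (\<Sum>i=1..N. log_deriv_velocity k (?m i) (cx i))) (at x)"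
    by (rule has_field_derivative_transform_within_open[OF _ open_params(1)])
       (use Suc in simp_all)
  then have dx: "deriv (\<lambda>s. ?g s y) x = (\<Sum>i=1..N. log_deriv_velocity k (?m i) (cx i))"
    by (rule DERIV_imp_deriv)
  have "((\<lambda>s. sum_log_deriv k x s) has_field_derivative (\<Sum>i=1..N. log_deriv_velocity k (?m i) (cy i))) (at y)"
  proof (intro DERIV_sum DERIV_log_deriv[OF _ _ k])
    fix i j assume i: "i \<in> {1..N}"
    show "((\<lambda>s. mixture_deriv f (z i) x s e j) has_field_derivative cy i j) (at y)"
      unfolding mixture_deriv_def cy_def using DERIV_theta_deriv[OF supp[OF i] Suc.prems(2) e]
      by (auto intro!: derivative_eq_intros)
  qed (use mixture_density_pos supp e Suc.prems in auto)
  then have "((\<lambda>s. ?g x s) has_field_derivative (\<Sum>i=1..N. log_deriv_velocity k (?m i) (cy i))) (at y)"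
    by (rule has_field_derivative_transform_within_open[OF _ open_params(1)])
       (use Suc in simp_all)
  then have dy: "deriv (\<lambda>s. ?g x s) y = (\<Sum>i=1..N. log_deriv_velocity k (?m i) (cy i))"
    by (rule DERIV_imp_deriv)
  have "cx i j - cy i j = ?m i (Suc j)" for i j
    by (simp add: cx_def cy_def mixture_deriv_def field_simps)
  then have "log_deriv_velocity k (?m i) (cx i) - log_deriv_velocity k (?m i) (cy i) = log_deriv (Suc k) (?m i)" for i
    using k by (simp add: log_deriv_velocity_diff log_deriv_velocity_Suc)
  moreover have "(D_diff ^^ Suc k) (\<lambda>t1 t2. loglik f z N t1 t2 e) x y = D_diff ?g x y"
    by simp
  ultimately show ?case
    unfolding D_diff_def[of ?g] dx dy by (simp flip: sum_subtractf)
qed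

lemma C_bar_0_2: "t \<in> \<Theta> \<Longrightarrow> C_bar f z N t e 0 2 = (\<Sum>i=1..N. score f 2 t e (z i)) / N"
  using D_diff_iterate_loglik[of t t 2] by (simp add: C_bar_def C_coef_def log_deriv_diag del: funpow.simps)

lemma C_bar_0_4: "t \<in> \<Theta> \<Longrightarrow> C_bar f z N t e 0 4 = sum_log_deriv 4 t t / N"
  using D_diff_iterate_loglik[of t t 4] by (simp add: C_bar_def C_coef_def del: funpow.simps)

text \<open>Only even powers of the half-difference \<open>v\<close> occur because the mixture is symmetric in its
  components.\<close>

lemma loglik_expansion_off_diagonal:
  assumes "is_interval I" "I \<subseteq> \<Theta>" "c + v \<in> I" "c - v \<in> I"
  shows "\<exists>x\<in>I. \<exists>y\<in>I. loglik f z N (c + v) (c - v) e =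
    loglik f z N c c e + (\<Sum>i=1..N. score f 2 c e (z i)) * v\<^sup>2 / 2 + sum_log_deriv 4 x y * v ^ 4 / 24"
proof (cases "v = 0")
  case True
  then show ?thesis using assms(3) by (auto intro!: bexI[of _ c])
next
  case False
  have inI: "c + w \<in> I \<and> c - w \<in> I" if "\<bar>w\<bar> \<le> \<bar>v\<bar>" for w
  proof -
    have "c + w \<in> {min (c+v) (c-v)..max (c+v) (c-v)}" "c - w \<in> {min (c+v) (c-v)..max (c+v) (c-v)}"
      using that by (auto simp: min_def max_def)
    then show ?thesis
      using assms(1,3,4) unfolding is_interval_1
      by (metis (no_types, lifting) atLeastAtMost_iff max_def min_def)
  qed
  have d: "((\<lambda>v. sum_log_deriv m (c + v) (c - v)) has_field_derivative
      sum_log_deriv (Suc m) (c + w) (c - w)) (at w)" if "m < 4" "\<bar>w\<bar> \<le> \<bar>v\<bar>" for m w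
    using DERIV_sum_log_deriv_line inI[OF that(2)] assms(2) that(1) by blast
  have "\<exists>w. (if v < 0 then v < w \<and> w < 0 else 0 < w \<and> w < v) \<and> loglik f z N (c + v) (c - v) e =
      (\<Sum>m<4. (sum_log_deriv m (c + 0) (c - 0) / fact m) * (v - 0) ^ m)
      + (sum_log_deriv 4 (c + w) (c - w) / fact 4) * (v - 0) ^ 4"
    using False d by (intro Taylor[of 4 "\<lambda>k v. sum_log_deriv k (c + v) (c - v)" _ "-\<bar>v\<bar>" "\<bar>v\<bar>"])
      (auto simp: loglik_eq)
  then obtain w where w: "if v < 0 then v < w \<and> w < 0 else 0 < w \<and> w < v"
    and eq: "loglik f z N (c + v) (c - v) e =
      (\<Sum>m<4. (sum_log_deriv m (c + 0) (c - 0) / fact m) * (v - 0) ^ m)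
      + (sum_log_deriv 4 (c + w) (c - w) / fact 4) * (v - 0) ^ 4"
    by blast
  have "\<bar>w\<bar> \<le> \<bar>v\<bar>" using w by (auto split: if_splits)
  from inI[OF this] have w: "c + w \<in> I" "c - w \<in> I" by auto
  have first_four: "(\<Sum>m<4. g m) = g 0 + g 1 + g 2 + g 3" for g :: "nat \<Rightarrow> real"
    by (simp add: eval_nat_numeral)
  have "loglik f z N (c + v) (c - v) e =
      loglik f z N c c e + (\<Sum>i=1..N. score f 2 c e (z i)) * v\<^sup>2 / 2 + sum_log_deriv 4 (c + w) (c - w) * v ^ 4 / 24"
    unfolding eq first_four by (simp add: loglik_eq log_deriv_diag fact_numeral del: log_deriv.simps)
  with w show ?thesis by blast
qed

lemma DERIV_score:
  assumes "0 < f w \<theta> \<eta>" "s \<in> \<Theta>"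
  shows "((\<lambda>s. score f r s e w) has_field_derivative
    score f (Suc r) s e w - score f r s e w * score f 1 s e w) (at s)"
proof -
  have ne: "f w s e \<noteq> 0"
    using density_pos[OF assms e] by simp
  have d0: "((\<lambda>s. f w s e) has_field_derivative theta_deriv f 1 w s e) (at s)"
    using DERIV_theta_deriv[OF assms e, of 0] by simp
  from DERIV_divide[OF DERIV_theta_deriv[OF assms e] d0 ne, of r]
  show ?thesis
    using ne unfolding score_def by (simp add: diff_divide_distrib)
qed

lemma DERIV_loglik_diag:
  assumes "s \<in> \<Theta>"
  shows "((\<lambda>s. loglik f z N s s e) has_field_derivative (\<Sum>i=1..N. score f 1 s e (z i))) (at s)"
  unfolding loglik_def mixture_density_diag
proof (rule DERIV_sum)
  fix i assume "i \<in> {1..N}"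
  then have i: "0 < f (z i) \<theta> \<eta>" by (rule supp)
  have "((\<lambda>s. f (z i) s e) has_field_derivative theta_deriv f 1 (z i) s e) (at s)"
    using DERIV_theta_deriv[OF i assms e, of 0] by simp
  then show "((\<lambda>s. ln (f (z i) s e)) has_field_derivative score f 1 s e (z i)) (at s)"
    using density_pos[OF i assms e] unfolding score_def by (auto intro!: derivative_eq_intros)
qed

lemma DERIV_sum_score:
  assumes "s \<in> \<Theta>"
  shows "((\<lambda>s. \<Sum>i=1..N. score f r s e (z i)) has_field_derivative
    (\<Sum>i=1..N. score f (Suc r) s e (z i) - score f r s e (z i) * score f 1 s e (z i))) (at s)"
  using supp assms by (intro DERIV_sum DERIV_score) auto

lemma sum_score_1_at_maximum:
  assumes "t \<in> \<Theta>" and max: "\<And>s. s \<in> \<Theta> \<Longrightarrow> loglik f z N s s e \<le> loglik f z N t t e"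
  shows "(\<Sum>i=1..N. score f 1 t e (z i)) = 0"
proof -
  obtain r where r: "r > 0" "ball t r \<subseteq> \<Theta>" using open_params(1) assms(1) by (rule openE)
  show ?thesis
    by (rule DERIV_local_max[OF DERIV_loglik_diag[OF assms(1)] r(1)])
       (use r(2) max in \<open>auto simp: subset_iff dist_real_def\<close>)
qed

text \<open>The linear term vanishes because \<open>t\<close> maximizes the homogeneous likelihood.\<close>

lemma loglik_expansion_on_diagonal:
  assumes "is_interval I" "I \<subseteq> \<Theta>" "t \<in> I" "c \<in> I"
    and max: "\<And>s. s \<in> \<Theta> \<Longrightarrow> loglik f z N s s e \<le> loglik f z N t t e"
  shows "\<exists>s\<in>I. loglik f z N c c e = loglik f z N t t e
    + (\<Sum>i=1..N. score f 2 s e (z i) - (score f 1 s e (z i))\<^sup>2) * (c - t)\<^sup>2 / 2"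
proof (cases "c = t")
  case True
  then show ?thesis using assms by auto
next
  case False
  have inI: "s \<in> I" if "min c t \<le> s" "s \<le> max c t" for s
    using that assms(1,3,4) unfolding is_interval_1 by (metis max_def min_def)
  define d where "d m s = (if m = 0 then loglik f z N s s e else if m = 1 then \<Sum>i=1..N. score f 1 s e (z i)
    else \<Sum>i=1..N. score f 2 s e (z i) - (score f 1 s e (z i))\<^sup>2)" for m :: nat and s
  have "(d m has_field_derivative d (Suc m) s) (at s)" if "m < 2" "s \<in> I" for m s
  proof -
    have "s \<in> \<Theta>" using that assms(2) by blast
    moreover have "m = 0 \<or> m = 1" using that by auto
    ultimately show ?thesis
      using DERIV_loglik_diag[of s] DERIV_sum_score[of s 1]
      by (auto simp: d_def[abs_def] power2_eq_square numeral_2_eq_2)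
  qed
  then have "\<exists>s. (if c < t then c < s \<and> s < t else t < s \<and> s < c) \<and>
      loglik f z N c c e = (\<Sum>m<2. (d m t / fact m) * (c - t) ^ m) + (d 2 s / fact 2) * (c - t) ^ 2"
    using False inI by (intro Taylor[of 2 d _ "min c t" "max c t"]) (auto simp: d_def)
  then obtain s where s: "if c < t then c < s \<and> s < t else t < s \<and> s < c"
    and eq: "loglik f z N c c e = (\<Sum>m<2. (d m t / fact m) * (c - t) ^ m) + (d 2 s / fact 2) * (c - t) ^ 2"
    by blast
  have "s \<in> I" using s by (intro inI) (auto split: if_splits)
  moreover have "t \<in> \<Theta>" using assms by blast
  ultimately show ?thesis
    using eq sum_score_1_at_maximum[OF _ max] by (intro bexI[of _ s]) (auto simp: d_def eval_nat_numeral)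
qed

lemma sum_score_2_mean_value:
  assumes "is_interval I" "I \<subseteq> \<Theta>" "t \<in> I" "c \<in> I"
  shows "\<exists>s\<in>I. (\<Sum>i=1..N. score f 2 c e (z i)) = (\<Sum>i=1..N. score f 2 t e (z i))
    + (\<Sum>i=1..N. score f 3 s e (z i) - score f 2 s e (z i) * score f 1 s e (z i)) * (c - t)"
proof (cases "c = t")
  case True
  then show ?thesis using assms by auto
next
  case False
  have inI: "s \<in> I" if "min c t \<le> s" "s \<le> max c t" for s
    using that assms(1,3,4) unfolding is_interval_1 by (metis max_def min_def)
  let ?F = "\<lambda>s. \<Sum>i=1..N. score f 2 s e (z i)"
  let ?D = "\<lambda>s. \<Sum>i=1..N. score f 3 s e (z i) - score f 2 s e (z i) * score f 1 s e (z i)"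
  have d: "(?F has_field_derivative ?D s) (at s)" if "s \<in> I" for s
    using DERIV_sum_score[of s 2] that assms(2) by (auto simp: eval_nat_numeral)
  have "\<exists>s. s \<in> I \<and> ?F (max c t) - ?F (min c t) = (max c t - min c t) * ?D s"
  proof -
    have "min c t < max c t" using False by auto
    from MVT2[OF this, of ?F ?D] d inI show ?thesis by (meson less_imp_le)
  qed
  then obtain s where "s \<in> I" "?F (max c t) - ?F (min c t) = (max c t - min c t) * ?D s" by blast
  then show ?thesis
    by (intro bexI[of _ s]) (auto simp: max_def min_def algebra_simps split: if_splits)
qed

end

end


text \<open>Completing the square in \<open>v\<^sup>2\<close>.\<close>

lemma quadratic_minus_quartic_le:
  fixes b v K :: real
  assumes "K > 0"
  shows "b * v\<^sup>2 / 2 - K * v ^ 4 / 24 \<le> 3 / 2 * (max 0 b)\<^sup>2 / K"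
proof -
  define B where "B = max 0 b"
  have "b * v\<^sup>2 \<le> B * v\<^sup>2" by (intro mult_right_mono) (auto simp: B_def)
  moreover have "0 \<le> (K * v\<^sup>2 - 6 * B)\<^sup>2 / (24 * K)" using assms by simp
  moreover have "(K * v\<^sup>2 - 6 * B)\<^sup>2 / (24 * K) = K * v ^ 4 / 24 - B * v\<^sup>2 / 2 + 3 / 2 * B\<^sup>2 / K"
    using assms by (simp add: field_simps power2_eq_square power4_eq_xxxx)
  ultimately show ?thesis unfolding B_def by linarith
qed

context regular_family
begin

context
  fixes z :: "nat \<Rightarrow> real" and N :: nat and e :: real and I :: "real set" and t \<epsilon> \<kappa> :: real
  assumes supp: "\<forall>i\<in>{1..N}. 0 < f (z i) \<theta> \<eta>" and e: "e \<in> \<E>"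
    and N: "0 < N" and I: "is_interval I" "I \<subseteq> \<Theta>" "t \<in> I"
    and maximal: "\<And>s. s \<in> \<Theta> \<Longrightarrow> loglik f z N s s e \<le> loglik f z N t t e"
    and \<epsilon>: "0 < \<epsilon>"
begin

private lemma sum_le: "S / real N \<le> c \<Longrightarrow> S \<le> real N * c"
  using N by (simp add: field_simps)

private lemma sum_ge: "c \<le> S / real N \<Longrightarrow> real N * c \<le> S"
  using N by (simp add: field_simps)

text \<open>In the coordinates \<open>c - t\<close> and \<open>v\<close> (mean shift and half-difference of the components) the
  gain in log-likelihood per observation is \<open>- A (c - t)\<^sup>2 / 2 + b v\<^sup>2 / 2 + \<kappa> v\<^sup>4 / 24\<close> up to small relative errors. The cross
  term \<open>(c - t) v\<^sup>2\<close> has the same order as the leading terms; it is negligible because its coefficient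
  averages to \<open>0\<close>, which is where the orthogonality of the first two scores enters.\<close>

lemma loglik_contrast_le:
  assumes fisher: "\<And>s. s \<in> I \<Longrightarrow> (\<Sum>i=1..N. score f 2 s e (z i) - (score f 1 s e (z i))\<^sup>2) / N \<le> - \<epsilon>"
    and cross: "\<And>s. s \<in> I \<Longrightarrow> \<bar>(\<Sum>i=1..N. score f 3 s e (z i) - score f 2 s e (z i) * score f 1 s e (z i)) / N\<bar> \<le> \<epsilon>"
    and quartic: "\<And>x y. x \<in> I \<Longrightarrow> y \<in> I \<Longrightarrow> (\<Sum>i=1..N. log_deriv 4 (mixture_deriv f (z i) x y e)) / N \<le> \<kappa> + \<epsilon>"
    and \<kappa>: "\<kappa> + 4 * \<epsilon> < 0" and s: "s1 \<in> I" "s2 \<in> I"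
  shows "2 * (loglik f z N s1 s2 e - loglik f z N t t e) \<le> 3 * N * (max 0 (C_bar f z N t e 0 2))\<^sup>2 / (- \<kappa> - 4 * \<epsilon>)"
proof -
  define c v where "c = (s1 + s2) / 2" and "v = (s1 - s2) / 2"
  have sc: "c + v = s1" "c - v = s2" by (simp_all add: c_def v_def field_simps)
  have "min s1 s2 \<le> c" "c \<le> max s1 s2" by (auto simp: c_def)
  then have cI: "c \<in> I" using I(1) s unfolding is_interval_1 by (metis max_def min_def)
  define b where "b = C_bar f z N t e 0 2"
  have b: "(\<Sum>i=1..N. score f 2 t e (z i)) = N * b"
    using C_bar_0_2[OF supp e, where t=t] I N by (auto simp: b_def)
  obtain x y where xy: "x \<in> I" "y \<in> I" and 1: "loglik f z N s1 s2 e = loglik f z N c c e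
      + (\<Sum>i=1..N. score f 2 c e (z i)) * v\<^sup>2 / 2 + (\<Sum>i=1..N. log_deriv 4 (mixture_deriv f (z i) x y e)) * v ^ 4 / 24"
    using loglik_expansion_off_diagonal[OF supp e I(1,2), where c=c and v=v] s unfolding sc by blast
  obtain r where r: "r \<in> I" and 2: "loglik f z N c c e = loglik f z N t t e
      + (\<Sum>i=1..N. score f 2 r e (z i) - (score f 1 r e (z i))\<^sup>2) * (c - t)\<^sup>2 / 2"
    using loglik_expansion_on_diagonal[OF supp e I cI maximal] by blast
  obtain w where w: "w \<in> I" and 3: "(\<Sum>i=1..N. score f 2 c e (z i)) = (\<Sum>i=1..N. score f 2 t e (z i))
      + (\<Sum>i=1..N. score f 3 w e (z i) - score f 2 w e (z i) * score f 1 w e (z i)) * (c - t)"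
    using sum_score_2_mean_value[OF supp e I cI] by blast
  let ?A = "\<Sum>i=1..N. score f 2 r e (z i) - (score f 1 r e (z i))\<^sup>2"
  let ?B = "\<Sum>i=1..N. score f 3 w e (z i) - score f 2 w e (z i) * score f 1 w e (z i)"
  let ?Q = "\<Sum>i=1..N. log_deriv 4 (mixture_deriv f (z i) x y e)"
  have A: "?A * (c - t)\<^sup>2 \<le> N * (- \<epsilon>) * (c - t)\<^sup>2"
    using sum_le[OF fisher[OF r]] by (rule mult_right_mono) simp
  have Q: "?Q * v ^ 4 \<le> N * (\<kappa> + \<epsilon>) * v ^ 4"
    using sum_le[OF quartic[OF xy]] by (rule mult_right_mono) simp
  have "\<bar>?B\<bar> \<le> N * \<epsilon>"
    using cross[OF w] N by (simp add: abs_divide field_simps)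
  then have "\<bar>?B * (c - t)\<bar> * v\<^sup>2 \<le> (N * \<epsilon> * \<bar>c - t\<bar>) * v\<^sup>2"
    by (intro mult_right_mono) (auto simp: abs_mult intro: mult_right_mono)
  also have "\<dots> = N * \<epsilon> * (\<bar>c - t\<bar> * v\<^sup>2)" by simp
  also have "\<dots> \<le> N * \<epsilon> * ((c - t)\<^sup>2 + v ^ 4 / 4)"
  proof -
    have square: "(y - w / 2)\<^sup>2 = y\<^sup>2 + w\<^sup>2 / 4 - y * w" for y w :: real
      by (simp add: power2_eq_square field_simps)
    have "0 \<le> (\<bar>c - t\<bar> - v\<^sup>2 / 2)\<^sup>2" by simp
    also have "\<dots> = (c - t)\<^sup>2 + v ^ 4 / 4 - \<bar>c - t\<bar> * v\<^sup>2"
      unfolding square by simp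
    finally show ?thesis using \<epsilon> by (intro mult_left_mono) auto
  qed
  finally have B: "?B * (c - t) * v\<^sup>2 \<le> N * \<epsilon> * ((c - t)\<^sup>2 + v ^ 4 / 4)"
    by (smt (verit) abs_mult_self_eq mult_right_mono zero_le_power2)
  have "loglik f z N s1 s2 e - loglik f z N t t e = ?A * (c - t)\<^sup>2 / 2 + N * b * v\<^sup>2 / 2 + ?B * (c - t) * v\<^sup>2 / 2 + ?Q * v ^ 4 / 24"
    unfolding 1 2 3 b by (simp add: distrib_right add_divide_distrib)
  also have "\<dots> \<le> N * (- \<epsilon>) * (c - t)\<^sup>2 / 2 + N * b * v\<^sup>2 / 2 + N * \<epsilon> * ((c - t)\<^sup>2 + v ^ 4 / 4) / 2 + N * (\<kappa> + \<epsilon>) * v ^ 4 / 24"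
    using A B Q by linarith
  also have "\<dots> = N * (b * v\<^sup>2 / 2 - (- \<kappa> - 4 * \<epsilon>) * v ^ 4 / 24)"
    by (simp add: field_simps)
  also have "\<dots> \<le> N * (3 / 2 * (max 0 b)\<^sup>2 / (- \<kappa> - 4 * \<epsilon>))"
    using \<kappa> by (intro mult_left_mono quadratic_minus_quartic_le) auto
  finally have "2 * (loglik f z N s1 s2 e - loglik f z N t t e) \<le> 2 * (N * (3 / 2 * (max 0 b)\<^sup>2 / (- \<kappa> - 4 * \<epsilon>)))"
    by (rule mult_left_mono) simp
  also have "\<dots> = 3 * N * (max 0 b)\<^sup>2 / (- \<kappa> - 4 * \<epsilon>)"
    by (simp only: times_divide_eq_right times_divide_eq_left mult.assoc mult.left_commute) simp
  finally show ?thesis unfolding b_def .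
qed

text \<open>At \<open>c = t\<close> only the terms in \<open>v\<close> are left, and this \<open>v\<close> maximizes \<open>b v\<^sup>2 / 2 + \<kappa> v\<^sup>4 / 24\<close>.\<close>

lemma loglik_contrast_ge:
  assumes quartic: "\<And>x y. x \<in> I \<Longrightarrow> y \<in> I \<Longrightarrow> \<kappa> - \<epsilon> \<le> (\<Sum>i=1..N. log_deriv 4 (mixture_deriv f (z i) x y e)) / N"
    and \<kappa>: "\<kappa> < 0"
  defines "v \<equiv> sqrt (6 * max 0 (C_bar f z N t e 0 2) / (- \<kappa>))"
  assumes v: "t + v \<in> I" "t - v \<in> I"
  shows "3 * N * (max 0 (C_bar f z N t e 0 2))\<^sup>2 / (- \<kappa>) * (1 - \<epsilon> / (- \<kappa>))
    \<le> 2 * (loglik f z N (t + v) (t - v) e - loglik f z N t t e)"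
proof -
  define b B K where "b = C_bar f z N t e 0 2" and "B = max 0 b" and "K = - \<kappa>"
  have K: "K > 0" using \<kappa> by (simp add: K_def)
  have b: "(\<Sum>i=1..N. score f 2 t e (z i)) = N * b"
    using C_bar_0_2[OF supp e, where t=t] I N by (auto simp: b_def)
  have v2: "v\<^sup>2 = 6 * B / K"
  proof -
    have "v = sqrt (6 * B / K)" by (simp add: v_def B_def b_def K_def)
    then show ?thesis using K by (simp add: B_def)
  qed
  have v4: "v ^ 4 = 36 * B\<^sup>2 / K\<^sup>2"
  proof -
    have "v ^ 4 = (v\<^sup>2)\<^sup>2" by simp
    then show ?thesis unfolding v2 by (simp add: power_divide power_mult_distrib)
  qed
  have bv: "b * v\<^sup>2 = B * v\<^sup>2" unfolding v2 by (simp add: B_def max_def)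
  obtain x y where xy: "x \<in> I" "y \<in> I" and 1: "loglik f z N (t + v) (t - v) e = loglik f z N t t e
      + (\<Sum>i=1..N. score f 2 t e (z i)) * v\<^sup>2 / 2 + (\<Sum>i=1..N. log_deriv 4 (mixture_deriv f (z i) x y e)) * v ^ 4 / 24"
    using loglik_expansion_off_diagonal[OF supp e I(1,2) v] by blast
  have "N * (- K - \<epsilon>) * v ^ 4 \<le> (\<Sum>i=1..N. log_deriv 4 (mixture_deriv f (z i) x y e)) * v ^ 4"
    using sum_ge[OF quartic[OF xy]] by (intro mult_right_mono) (simp_all add: K_def)
  then have "N * (B * v\<^sup>2) + N * (- K - \<epsilon>) * v ^ 4 / 12 \<le> 2 * (loglik f z N (t + v) (t - v) e - loglik f z N t t e)"
    unfolding 1 b bv[symmetric] by (simp add: algebra_simps)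
  also have "N * (B * v\<^sup>2) + N * (- K - \<epsilon>) * v ^ 4 / 12 = 3 * N * B\<^sup>2 / K * (1 - \<epsilon> / K)"
    unfolding v2 v4 using K by (simp add: field_simps power2_eq_square)
  finally show ?thesis by (simp add: B_def b_def K_def)
qed

end

end


section \<open>Measurability, continuity and domination of the scores\<close>

context regular_family
begin

abbreviation law where "law \<equiv> model_law f \<theta> \<eta>"

lemma sets_law [measurable_cong]: "sets law = sets borel"
  by (simp add: model_law_def)

lemma true_density_measurable [measurable]: "(\<lambda>z. f z \<theta> \<eta>) \<in> borel_measurable borel"
  by (rule density_measurable[OF true_param])

lemma AE_law_support: "AE z in law. 0 < f z \<theta> \<eta>"
  unfolding model_law_def by (subst AE_density) auto

text \<open>Outside the common support all densities vanish, so that, as \<open>x / 0 = 0\<close> and \<open>ln 0 = 0\<close>, every function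
  of the data below is \<open>0\<close> there.\<close>

lemma density_outside: "\<not> 0 < f z \<theta> \<eta> \<Longrightarrow> t \<in> \<Theta> \<Longrightarrow> e \<in> \<E> \<Longrightarrow> f z t e = 0"
  using common_support[of t e z] density_nonneg[of t e z] by auto

lemma mixture_density_outside:
  "\<not> 0 < f z \<theta> \<eta> \<Longrightarrow> t1 \<in> \<Theta> \<Longrightarrow> t2 \<in> \<Theta> \<Longrightarrow> e \<in> \<E> \<Longrightarrow> mixture_density f z t1 t2 e = 0"
  by (simp add: mixture_density_def density_outside)

lemma score_outside: "\<not> 0 < f z \<theta> \<eta> \<Longrightarrow> t \<in> \<Theta> \<Longrightarrow> e \<in> \<E> \<Longrightarrow> score f r t e z = 0"
  by (simp add: score_def density_outside)

lemma log_deriv_4_eq: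
  "log_deriv 4 m = m 4 / m 0 - 4 * (m 1 / m 0) * (m 3 / m 0) - 3 * (m 2 / m 0)\<^sup>2
    + 12 * (m 1 / m 0)\<^sup>2 * (m 2 / m 0) - 6 * (m 1 / m 0) ^ 4"
  by (simp add: numeral_eq_Suc)

lemma log_deriv_4_outside:
  "\<not> 0 < f z \<theta> \<eta> \<Longrightarrow> t1 \<in> \<Theta> \<Longrightarrow> t2 \<in> \<Theta> \<Longrightarrow> e \<in> \<E> \<Longrightarrow> log_deriv 4 (mixture_deriv f z t1 t2 e) = 0"
  by (simp add: mixture_density_outside log_deriv_4_eq)

text \<open>Derivatives in \<open>t\<close> are limits of difference quotients, hence measurable in \<open>z\<close> by induction on the
  order.\<close>

lemma theta_deriv_measurable:
  assumes "t \<in> \<Theta>" "e \<in> \<E>"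
  shows "(\<lambda>z. if 0 < f z \<theta> \<eta> then theta_deriv f r z t e else 0) \<in> borel_measurable borel"
  using assms(1)
proof (induction r arbitrary: t)
  case 0
  note [measurable] = density_measurable[OF 0 assms(2)]
  show ?case unfolding theta_deriv_0 by measurable
next
  case (Suc r)
  let ?F = "\<lambda>t z. if 0 < f z \<theta> \<eta> then theta_deriv f r z t e else 0"
  obtain d where d: "d > 0" "ball t d \<subseteq> \<Theta>" using open_params(1) Suc.prems by (rule openE)
  define h where "h n = d / real (Suc (Suc n))" for n
  have h: "h n \<noteq> 0" "t + h n \<in> \<Theta>" for n
  proof -
    have "h n < d" "0 < h n" using d(1) by (simp_all add: h_def divide_less_eq add_pos_nonneg)
    then show "h n \<noteq> 0" "t + h n \<in> \<Theta>" using d(2) by (auto simp: subset_iff dist_real_def)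
  qed
  have "h \<longlonglongrightarrow> d * 0"
    unfolding h_def[abs_def] using tendsto_mult[OF tendsto_const LIMSEQ_Suc[OF LIMSEQ_Suc[OF lim_1_over_n]], of d] by simp
  then have h0: "filterlim h (at 0) sequentially"
    using h(1) by (intro filterlim_atI) auto
  show ?case
  proof (rule borel_measurable_LIMSEQ_real)
    show "(\<lambda>z. (?F (t + h n) z - ?F t z) / h n) \<in> borel_measurable borel" for n
      using Suc.IH[OF h(2)] Suc.IH[OF Suc.prems] by (intro borel_measurable_divide borel_measurable_diff) auto
    fix z :: real
    show "(\<lambda>n. (?F (t + h n) z - ?F t z) / h n) \<longlonglongrightarrow> (if 0 < f z \<theta> \<eta> then theta_deriv f (Suc r) z t e else 0)"
    proof (cases "0 < f z \<theta> \<eta>")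
      case True
      have "((\<lambda>h. (theta_deriv f r z (t + h) e - theta_deriv f r z t e) / h) \<longlongrightarrow> theta_deriv f (Suc r) z t e) (at 0)"
        using DERIV_theta_deriv[OF True Suc.prems assms(2), of r] by (simp add: DERIV_def)
      from filterlim_compose[OF this h0] True show ?thesis by simp
    qed simp
  qed
qed

lemma score_measurable:
  assumes "t \<in> \<Theta>" "e \<in> \<E>"
  shows "(\<lambda>z. score f r t e z) \<in> borel_measurable borel"
proof -
  have "(\<lambda>z. (if 0 < f z \<theta> \<eta> then theta_deriv f r z t e else 0) / f z t e) \<in> borel_measurable borel"
    by (intro borel_measurable_divide theta_deriv_measurable density_measurable assms)
  also have "(\<lambda>z. (if 0 < f z \<theta> \<eta> then theta_deriv f r z t e else 0) / f z t e) = (\<lambda>z. score f r t e z)"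
    using assms by (auto simp: score_def density_outside)
  finally show ?thesis .
qed

lemma mixture_density_measurable:
  assumes "t1 \<in> \<Theta>" "t2 \<in> \<Theta>" "e \<in> \<E>"
  shows "(\<lambda>z. mixture_density f z t1 t2 e) \<in> borel_measurable borel"
  unfolding mixture_density_def
  using density_measurable[OF assms(1,3)] density_measurable[OF assms(2,3)] by measurable

lemma log_deriv_4_measurable:
  assumes "t1 \<in> \<Theta>" "t2 \<in> \<Theta>" "e \<in> \<E>"
  shows "(\<lambda>z. log_deriv 4 (mixture_deriv f z t1 t2 e)) \<in> borel_measurable borel"
proof -
  define m where "m k z = (if 0 < f z \<theta> \<eta> then mixture_deriv f z t1 t2 e k else 0)" for k z
  have [measurable]: "m k \<in> borel_measurable borel" for k
  proof -
    have "m k = (\<lambda>z. ((if 0 < f z \<theta> \<eta> then theta_deriv f k z t1 e else 0)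
        + (-1) ^ k * (if 0 < f z \<theta> \<eta> then theta_deriv f k z t2 e else 0)) / 2)"
      by (auto simp: m_def mixture_deriv_def)
    moreover note [measurable] = theta_deriv_measurable[OF assms(1,3), of k] theta_deriv_measurable[OF assms(2,3), of k]
    ultimately show ?thesis by simp
  qed
  have "(\<lambda>z. log_deriv 4 (\<lambda>k. m k z)) \<in> borel_measurable borel"
    unfolding log_deriv_4_eq by measurable
  also have "(\<lambda>z. log_deriv 4 (\<lambda>k. m k z)) = (\<lambda>z. log_deriv 4 (mixture_deriv f z t1 t2 e))"
  proof
    fix z
    show "log_deriv 4 (\<lambda>k. m k z) = log_deriv 4 (mixture_deriv f z t1 t2 e)"
    proof (cases "0 < f z \<theta> \<eta>")
      case False
      then have "log_deriv 4 (\<lambda>k. m k z) = 0" by (simp add: m_def log_deriv_4_eq)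
      then show ?thesis using log_deriv_4_outside[OF False assms] by simp
    qed (simp add: m_def)
  qed
  finally show ?thesis .
qed

lemma continuous_on_density:
  "0 < f z \<theta> \<eta> \<Longrightarrow> continuous_on (\<Theta> \<times> \<E>) (\<lambda>p. f z (fst p) (snd p))"
  using continuous_theta_deriv[of z 0] by (simp add: case_prod_beta')

lemma continuous_on_score: "continuous_on (\<Theta> \<times> \<E>) (\<lambda>p. score f r (fst p) (snd p) z)"
proof (cases "0 < f z \<theta> \<eta>")
  case True
  have "continuous_on (\<Theta> \<times> \<E>) (\<lambda>p. theta_deriv f r z (fst p) (snd p) / f z (fst p) (snd p))"
    using continuous_theta_deriv[OF True, of r] density_pos[OF True]
    by (intro continuous_on_divide continuous_on_density True) (auto simp: case_prod_beta' less_imp_neq[THEN not_sym] dest: less_imp_neq)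
  then show ?thesis by (simp add: score_def)
next
  case False
  then have "score f r (fst p) (snd p) z = 0" if "p \<in> \<Theta> \<times> \<E>" for p
    using that by (intro score_outside) auto
  then show ?thesis by (simp cong: continuous_on_cong)
qed

lemma continuous_on_mixture_deriv:
  assumes "0 < f z \<theta> \<eta>"
  shows "continuous_on (\<Theta> \<times> \<Theta> \<times> \<E>) (\<lambda>(x, y, e). mixture_deriv f z x y e k)"
proof -
  have c: "continuous_on (\<Theta> \<times> \<E>) (\<lambda>p. theta_deriv f k z (fst p) (snd p))"
    using continuous_theta_deriv[OF assms, of k] by (simp add: case_prod_beta')
  have "continuous_on (\<Theta> \<times> \<Theta> \<times> \<E>) (\<lambda>p. theta_deriv f k z (fst p) (snd (snd p)))"
    by (rule continuous_on_compose2[OF c, of _ "\<lambda>p. (fst p, snd (snd p))", simplified])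
       (auto intro!: continuous_intros)
  moreover have "continuous_on (\<Theta> \<times> \<Theta> \<times> \<E>) (\<lambda>p. theta_deriv f k z (fst (snd p)) (snd (snd p)))"
    by (rule continuous_on_compose2[OF c, of _ "\<lambda>p. (fst (snd p), snd (snd p))", simplified])
       (auto intro!: continuous_intros)
  ultimately show ?thesis
    unfolding mixture_deriv_def case_prod_beta' by (intro continuous_intros) auto
qed

lemma continuous_on_mixture_density:
  assumes "0 < f z \<theta> \<eta>"
  shows "continuous_on (\<Theta> \<times> \<Theta> \<times> \<E>) (\<lambda>(x, y, e). mixture_density f z x y e)"
  using continuous_on_mixture_deriv[OF assms, of 0] by simp

lemma continuous_on_ln_mixture:
  "continuous_on (\<Theta> \<times> \<Theta> \<times> \<E>) (\<lambda>(x, y, e). ln (mixture_density f z x y e))"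
proof (cases "0 < f z \<theta> \<eta>")
  case True
  then show ?thesis
    using continuous_on_mixture_density[OF True] mixture_density_pos[OF True]
    unfolding case_prod_beta' by (intro continuous_on_ln) (auto simp: less_imp_neq[THEN not_sym])
next
  case False
  then have "ln (mixture_density f z (fst p) (fst (snd p)) (snd (snd p))) = 0" if "p \<in> \<Theta> \<times> \<Theta> \<times> \<E>" for p
    using that by (subst mixture_density_outside) auto
  then show ?thesis by (simp add: case_prod_beta' cong: continuous_on_cong)
qed

lemma continuous_on_log_deriv_4:
  "continuous_on (\<Theta> \<times> \<Theta> \<times> \<E>) (\<lambda>(x, y, e). log_deriv 4 (mixture_deriv f z x y e))"
proof (cases "0 < f z \<theta> \<eta>")
  case True
  have ne: "mixture_density f z (fst p) (fst (snd p)) (snd (snd p)) \<noteq> 0" if "p \<in> \<Theta> \<times> \<Theta> \<times> \<E>" for p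
    using mixture_density_pos[OF True, of "fst p" "fst (snd p)" "snd (snd p)"] that by auto
  define q where "q k p = mixture_deriv f z (fst p) (fst (snd p)) (snd (snd p)) k
    / mixture_density f z (fst p) (fst (snd p)) (snd (snd p))" for k p
  have q: "continuous_on (\<Theta> \<times> \<Theta> \<times> \<E>) (q k)" for k
    unfolding q_def[abs_def]
    using continuous_on_mixture_deriv[OF True, of k] continuous_on_mixture_density[OF True] ne
    unfolding case_prod_beta' by (intro continuous_on_divide) blast+
  have "continuous_on (\<Theta> \<times> \<Theta> \<times> \<E>)
      (\<lambda>p. q 4 p - 4 * q 1 p * q 3 p - 3 * (q 2 p)\<^sup>2 + 12 * (q 1 p)\<^sup>2 * q 2 p - 6 * q 1 p ^ 4)"
    by (intro continuous_intros q)
  then show ?thesis by (simp add: q_def log_deriv_4_eq case_prod_beta')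
next
  case False
  then have "log_deriv 4 (mixture_deriv f z (fst p) (fst (snd p)) (snd (snd p))) = 0" if "p \<in> \<Theta> \<times> \<Theta> \<times> \<E>" for p
    using that by (intro log_deriv_4_outside) auto
  then show ?thesis by (simp add: case_prod_beta' cong: continuous_on_cong)
qed

text \<open>Up to signs, the ratio is a convex combination of the scores of the two components, with weights
  proportional to their densities. So envelopes of the scores dominate all
  derivatives of the log-likelihood of the mixture, however far apart the two components are.\<close>

lemma mixture_ratio_le:
  assumes pos: "0 < f z \<theta> \<eta>" and t: "t1 \<in> \<Theta>" "t2 \<in> \<Theta>" "e \<in> \<E>"
    and B: "\<bar>score f k t1 e z\<bar> \<le> B" "\<bar>score f k t2 e z\<bar> \<le> B"
  shows "\<bar>mixture_deriv f z t1 t2 e k / mixture_deriv f z t1 t2 e 0\<bar> \<le> B"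
proof -
  have p: "0 < f z t1 e" "0 < f z t2 e" using density_pos[OF pos] t by auto
  have 1: "\<bar>theta_deriv f k z t1 e\<bar> \<le> B * f z t1 e" "\<bar>theta_deriv f k z t2 e\<bar> \<le> B * f z t2 e"
    using B p by (auto simp: score_def abs_divide field_simps)
  have "\<bar>(-1) ^ k * theta_deriv f k z t2 e\<bar> = \<bar>theta_deriv f k z t2 e\<bar>"
    by (simp add: abs_mult power_abs)
  then have "\<bar>theta_deriv f k z t1 e + (-1) ^ k * theta_deriv f k z t2 e\<bar> \<le> B * (f z t1 e + f z t2 e)"
    using 1 abs_triangle_ineq[of "theta_deriv f k z t1 e" "(-1) ^ k * theta_deriv f k z t2 e"]
    by (simp only: distrib_left)
  then show ?thesis
    unfolding mixture_deriv_0 unfolding mixture_density_def mixture_deriv_def using p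
    by (simp add: abs_divide field_simps add_pos_pos)
qed

lemma log_deriv_4_le:
  assumes "1 \<le> B" and q: "\<And>k. k \<in> {1..4} \<Longrightarrow> \<bar>m k / m 0\<bar> \<le> B"
  shows "\<bar>log_deriv 4 m\<bar> \<le> 26 * B ^ 4"
proof -
  define q where "q k = m k / m 0" for k
  have Q: "\<bar>q 1\<bar> \<le> B" "\<bar>q 2\<bar> \<le> B" "\<bar>q 3\<bar> \<le> B" "\<bar>q 4\<bar> \<le> B" using assms(2) by (auto simp: q_def)
  have pw: "B ^ j \<le> B ^ 4" if "j \<le> 4" for j using \<open>1 \<le> B\<close> that by (intro power_increasing)
  have B0: "0 \<le> B" using assms(1) by simp
  have a: "\<bar>q 4\<bar> \<le> B ^ 4" using Q(4) pw[of 1] by simp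
  have b: "\<bar>q 1 * q 3\<bar> \<le> B ^ 4"
    using mult_mono[OF Q(1,3)] B0 pw[of 2] by (simp add: abs_mult power2_eq_square)
  have c: "\<bar>(q 2)\<^sup>2\<bar> \<le> B ^ 4"
    using mult_mono[OF Q(2,2)] B0 pw[of 2] by (simp add: power2_eq_square)
  have d1: "(q 1)\<^sup>2 \<le> B\<^sup>2" using power_mono[OF Q(1), of 2] by simp
  have d: "\<bar>(q 1)\<^sup>2 * q 2\<bar> \<le> B ^ 4"
    using mult_mono[OF d1 Q(2)] B0 pw[of 3] by (simp add: abs_mult power2_eq_square power3_eq_cube)
  have e: "\<bar>q 1 ^ 4\<bar> \<le> B ^ 4" using power_mono[OF Q(1), of 4] by simp
  have "log_deriv 4 m = q 4 - 4 * (q 1 * q 3) - 3 * (q 2)\<^sup>2 + 12 * ((q 1)\<^sup>2 * q 2) - 6 * q 1 ^ 4"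
    by (simp add: q_def log_deriv_4_eq)
  then show ?thesis using a b c d e by linarith
qed

text \<open>The maximum of the four score envelopes and \<open>1\<close>. All derivatives of log-likelihoods below are
  polynomials of degree at most \<open>4\<close> in ratios bounded by \<open>B\<close>, hence dominated by a multiple of \<open>B\<^sup>4\<close>.\<close>

lemma common_envelope:
  obtains U B where "open U" "(\<theta>, \<eta>) \<in> U" "integrable law (\<lambda>z. B z ^ 4)" "\<And>z. (1::real) \<le> B z"
    "\<And>r t e z. r \<in> {1..4::nat} \<Longrightarrow> t \<in> \<Theta> \<Longrightarrow> e \<in> \<E> \<Longrightarrow> (t, e) \<in> U \<Longrightarrow> \<bar>score f r t e z\<bar> \<le> B z"
proof -
  define P where "P r U H \<longleftrightarrow> open U \<and> (\<theta>, \<eta>) \<in> U \<and> (\<forall>p::nat. integrable law (\<lambda>z. H z ^ p)) \<and>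
    (\<forall>(t, e) \<in> U \<inter> \<Theta> \<times> \<E>. \<forall>z. 0 < f z \<theta> \<eta> \<longrightarrow> \<bar>score f r t e z\<bar> \<le> H z)" for r U H
  have "\<forall>r\<in>{1..4}. \<exists>U H. P r U H"
    unfolding P_def by (intro ballI score_envelope) simp
  then obtain U H where "\<forall>r\<in>{1..4}. P r (U r) (H r)" by metis
  then have UH: "P r (U r) (H r)" if "r \<in> {1..4}" for r using that by blast
  have open_U: "open (U r)" "(\<theta>, \<eta>) \<in> U r" and intH: "integrable law (\<lambda>z. H r z ^ p)"
    if "r \<in> {1..4}" for r and p :: nat
    using UH[OF that] unfolding P_def by simp_all
  have bound: "\<bar>score f r t e z\<bar> \<le> H r z"
    if "r \<in> {1..4}" "(t, e) \<in> U r" "t \<in> \<Theta>" "e \<in> \<E>" "0 < f z \<theta> \<eta>" for r t e z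
    using UH[OF that(1)] that unfolding P_def by fast
  define B where "B z = Max ((\<lambda>r. if r = 0 then 1 else \<bar>H r z\<bar>) ` {0..4})" for z
  have B1: "1 \<le> B z" for z unfolding B_def by (intro Max_ge) (auto intro!: image_eqI[of _ _ 0])
  have BH: "\<bar>H r z\<bar> \<le> B z" if "r \<in> {1..4}" for r z
    unfolding B_def using that by (intro Max_ge) (auto intro!: image_eqI[of _ _ r])
  have B4: "B z ^ 4 \<le> 1 + (\<Sum>r=1..4. H r z ^ 4)" for z
  proof -
    have "B z \<in> (\<lambda>r. if r = 0 then 1 else \<bar>H r z\<bar>) ` {0..4}" unfolding B_def by (intro Max_in) auto
    then obtain r where "r \<in> {0..4}" "B z = (if r = 0 then 1 else \<bar>H r z\<bar>)" by blast
    note r = this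
    show ?thesis
    proof (cases "r = 0")
      case True
      then show ?thesis using r by (simp add: sum_nonneg)
    next
      case False
      have "H r z ^ 4 \<le> (\<Sum>r=1..4. H r z ^ 4)" using r False by (intro member_le_sum) auto
      then show ?thesis using r False by simp
    qed
  qed
  interpret prob_space law
    by standard (use density_total[OF true_param] in \<open>simp add: model_law_def emeasure_density\<close>)
  have [measurable]: "B \<in> borel_measurable law"
  proof -
    have [measurable]: "H r \<in> borel_measurable law" if "r \<in> {0..4} - {0}" for r
      using intH[of r 1] that by auto
    have "(\<lambda>z. if r = 0 then 1 else \<bar>H r z\<bar>) \<in> borel_measurable law" if "r \<in> {0..4}" for r
      using that by (cases "r = 0") auto
    then show ?thesis unfolding B_def by (intro borel_measurable_Max) auto
  qed
  have "integrable law (\<lambda>z. 1 + (\<Sum>r=1..4. H r z ^ 4))"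
    using intH by (intro Bochner_Integration.integrable_add Bochner_Integration.integrable_sum) auto
  then have intB: "integrable law (\<lambda>z. B z ^ 4)"
    by (rule Bochner_Integration.integrable_bound) (use B4 in \<open>auto intro!: AE_I2 order.trans[OF _ abs_ge_self]\<close>)
  show ?thesis
  proof (rule that[of "\<Inter>r\<in>{1..4}. U r" B])
    show "open (\<Inter>r\<in>{1..4}. U r)" using open_U by (intro open_INT) auto
    show "(\<theta>, \<eta>) \<in> (\<Inter>r\<in>{1..4}. U r)" using open_U by auto
    fix r t e z assume *: "r \<in> {1..4::nat}" "t \<in> \<Theta>" "e \<in> \<E>" "(t, e) \<in> (\<Inter>r\<in>{1..4}. U r)"
    show "\<bar>score f r t e z\<bar> \<le> B z"
    proof (cases "0 < f z \<theta> \<eta>")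
      case True
      have "\<bar>score f r t e z\<bar> \<le> H r z" using * True by (intro bound) auto
      then show ?thesis using BH[OF *(1), of z] by linarith
    next
      case False
      then show ?thesis using score_outside[OF False *(2,3), of r] B1[of z] by simp
    qed
  qed (use B1 intB in auto)
qed

end


section \<open>Averages near the true parameter\<close>

lemma open_box_pair:
  assumes "open W" "(a, b) \<in> W"
  shows "\<exists>\<rho>>0. \<forall>x\<in>ball a \<rho>. \<forall>y\<in>ball b \<rho>. (x::real, y::real) \<in> W"
proof -
  obtain A B where AB: "open A" "open B" "a \<in> A" "b \<in> B" "A \<times> B \<subseteq> W"
    using assms by (metis open_prod_elim mem_Sigma_iff)
  obtain r where "r > 0" "ball a r \<subseteq> A" using AB by (meson openE)
  moreover obtain s where "s > 0" "ball b s \<subseteq> B" using AB by (meson openE)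
  ultimately show ?thesis using AB(5)
    by (intro exI[of _ "min r s"]) (auto simp: subset_iff)
qed

lemma open_box_triple:
  assumes "open W" "(a, b, c) \<in> W"
  shows "\<exists>\<rho>>0. \<forall>x\<in>ball a \<rho>. \<forall>y\<in>ball b \<rho>. \<forall>w\<in>ball c \<rho>. (x::real, y::real, w::real) \<in> W"
proof -
  obtain A B where AB: "open A" "open B" "a \<in> A" "(b, c) \<in> B" "A \<times> B \<subseteq> W"
    using assms by (metis open_prod_elim mem_Sigma_iff)
  obtain r where "r > 0" "ball a r \<subseteq> A" using AB by (meson openE)
  moreover obtain s where "s > 0" "\<forall>x\<in>ball b s. \<forall>y\<in>ball c s. (x, y) \<in> B"
    using open_box_pair[OF AB(2,4)] by blast
  ultimately show ?thesis using AB(5)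
    by (intro exI[of _ "min r s"]) (auto simp: subset_iff)
qed

locale homogeneous_sample = regular_family f \<Theta> \<E> \<theta> \<eta> + iid_sample M Z "model_law f \<theta> \<eta>"
  for f :: "real \<Rightarrow> real \<Rightarrow> real \<Rightarrow> real" and \<Theta> \<E> \<theta> \<eta> and M :: "'a measure" and Z
begin

lemma whp_in_support: "whp M (\<lambda>N \<omega>. \<forall>i\<in>{1..N}. 0 < f (Z i \<omega>) \<theta> \<eta>)"
proof (rule whp_AE)
  fix N
  have "AE \<omega> in M. 0 < f (Z i \<omega>) \<theta> \<eta>" if "i \<in> {1..N}" for i
  proof -
    have "AE z in distr M borel (Z i). 0 < f z \<theta> \<eta>"
      using that by (subst law) (auto intro: AE_law_support)
    then show ?thesis using that by (subst (asm) AE_distr_iff) auto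
  qed
  then show "AE \<omega> in M. \<forall>i\<in>{1..N}. 0 < f (Z i \<omega>) \<theta> \<eta>"
    by (intro AE_finite_allI) auto
qed

definition fisher :: real where
  "fisher = (\<integral>z. (score f 1 \<theta> \<eta> z)\<^sup>2 \<partial>law)"

text \<open>On the diagonal the odd \<open>mixture_deriv\<close> vanish, so this is \<open>E (\<xi>\<^sub>4 - 3 \<xi>\<^sub>2\<^sup>2)\<close> in terms of the scores.\<close>

definition quartic_mean :: real where
  "quartic_mean = (\<integral>z. log_deriv 4 (mixture_deriv f z \<theta> \<theta> \<eta>) \<partial>law)"

lemma fisher_pos: "0 < fisher"
  using information_pos_def[of 1 0] by (simp add: fisher_def)

text \<open>The uniform law for the polynomials in the scores that occur as derivatives of homogeneous
  log-likelihoods; the constant \<open>2\<close> accommodates a difference of two monomials.\<close>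

lemma uniform_law_score_pair:
  fixes g :: "real \<Rightarrow> real \<Rightarrow> real \<Rightarrow> real"
  assumes meas: "\<And>t e. t \<in> \<Theta> \<Longrightarrow> e \<in> \<E> \<Longrightarrow> g t e \<in> borel_measurable borel"
    and cont: "\<And>z. continuous_on (\<Theta> \<times> \<E>) (\<lambda>p. g (fst p) (snd p) z)"
    and bound: "\<And>t e z B. 1 \<le> B \<Longrightarrow> (\<And>r. r \<in> {1..4} \<Longrightarrow> \<bar>score f r t e z\<bar> \<le> B) \<Longrightarrow> \<bar>g t e z\<bar> \<le> 2 * B ^ 4"
    and "0 < \<epsilon>"
  shows "\<exists>\<rho>>0. whp M (\<lambda>N \<omega>. \<forall>t\<in>ball \<theta> \<rho> \<inter> \<Theta>. \<forall>e\<in>ball \<eta> \<rho> \<inter> \<E>. \<bar>avg (g t e) N \<omega> - (\<integral>z. g \<theta> \<eta> z \<partial>law)\<bar> \<le> \<epsilon>)"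
proof -
  obtain U B where U: "open U" "(\<theta>, \<eta>) \<in> U" and B: "integrable law (\<lambda>z. B z ^ 4)" "\<And>z. (1::real) \<le> B z"
    "\<And>r t e z. r \<in> {1..4::nat} \<Longrightarrow> t \<in> \<Theta> \<Longrightarrow> e \<in> \<E> \<Longrightarrow> (t, e) \<in> U \<Longrightarrow> \<bar>score f r t e z\<bar> \<le> B z"
    by (rule common_envelope) (rule that)
  have "\<exists>W. open W \<and> (\<theta>, \<eta>) \<in> W \<and> whp M (\<lambda>N \<omega>. \<forall>p\<in>W \<inter> \<Theta> \<times> \<E>.
      \<bar>avg (\<lambda>z. g (fst p) (snd p) z) N \<omega> - (\<integral>z. g (fst (\<theta>, \<eta>)) (snd (\<theta>, \<eta>)) z \<partial>law)\<bar> \<le> \<epsilon>)"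
  proof (rule uniform_law[where S="\<Theta> \<times> \<E>" and U=U and G="\<lambda>z. 2 * B z ^ 4"])
    show "\<bar>g (fst p) (snd p) z\<bar> \<le> 2 * B z ^ 4" if "p \<in> U \<inter> \<Theta> \<times> \<E>" for z p
      using that B by (intro bound) auto
  qed (use meas cont true_param U B(1) \<open>0 < \<epsilon>\<close> in auto)
  then obtain W where W: "open W" "(\<theta>, \<eta>) \<in> W" and whp: "whp M (\<lambda>N \<omega>. \<forall>p\<in>W \<inter> \<Theta> \<times> \<E>.
      \<bar>avg (\<lambda>z. g (fst p) (snd p) z) N \<omega> - (\<integral>z. g (fst (\<theta>, \<eta>)) (snd (\<theta>, \<eta>)) z \<partial>law)\<bar> \<le> \<epsilon>)"
    by blast
  obtain \<rho> where "\<rho> > 0" "\<forall>x\<in>ball \<theta> \<rho>. \<forall>y\<in>ball \<eta> \<rho>. (x, y) \<in> W"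
    using open_box_pair[OF W] by blast
  note \<rho> = this
  have "whp M (\<lambda>N \<omega>. \<forall>t\<in>ball \<theta> \<rho> \<inter> \<Theta>. \<forall>e\<in>ball \<eta> \<rho> \<inter> \<E>. \<bar>avg (g t e) N \<omega> - (\<integral>z. g \<theta> \<eta> z \<partial>law)\<bar> \<le> \<epsilon>)"
    using whp
  proof (rule whp_mono, intro ballI)
    fix N \<omega> t e
    assume all: "\<forall>p\<in>W \<inter> \<Theta> \<times> \<E>.
      \<bar>avg (\<lambda>z. g (fst p) (snd p) z) N \<omega> - (\<integral>z. g (fst (\<theta>, \<eta>)) (snd (\<theta>, \<eta>)) z \<partial>law)\<bar> \<le> \<epsilon>"
      and te: "t \<in> ball \<theta> \<rho> \<inter> \<Theta>" "e \<in> ball \<eta> \<rho> \<inter> \<E>"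
    have "(t, e) \<in> W \<inter> \<Theta> \<times> \<E>" using te \<rho>(2) by blast
    from bspec[OF all this] show "\<bar>avg (g t e) N \<omega> - (\<integral>z. g \<theta> \<eta> z \<partial>law)\<bar> \<le> \<epsilon>" by simp
  qed
  then show ?thesis using \<rho>(1) by blast
qed

lemma score_le_power_4:
  fixes a b B :: real
  assumes "1 \<le> B"
  shows "\<bar>a\<bar> \<le> B \<Longrightarrow> \<bar>a\<bar> \<le> B ^ 4" "\<bar>a\<bar> \<le> B \<Longrightarrow> \<bar>b\<bar> \<le> B \<Longrightarrow> \<bar>a * b\<bar> \<le> B ^ 4"
proof -
  show "\<bar>a\<bar> \<le> B ^ 4" if "\<bar>a\<bar> \<le> B"
    using that power_increasing[of 1 4 B] assms by simp
  show "\<bar>a * b\<bar> \<le> B ^ 4" if "\<bar>a\<bar> \<le> B" "\<bar>b\<bar> \<le> B"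
    using mult_mono[OF that] power_increasing[of 2 4 B] assms by (simp add: abs_mult power2_eq_square)
qed

lemma integrable_score:
  assumes "r \<in> {1..4}"
  shows "integrable law (score f r \<theta> \<eta>)"
    and "r' \<in> {1..4} \<Longrightarrow> integrable law (\<lambda>z. score f r \<theta> \<eta> z * score f r' \<theta> \<eta> z)"
proof -
  obtain U B where U: "open U" "(\<theta>, \<eta>) \<in> U" and B: "integrable law (\<lambda>z. B z ^ 4)" "\<And>z. (1::real) \<le> B z"
    "\<And>r t e z. r \<in> {1..4::nat} \<Longrightarrow> t \<in> \<Theta> \<Longrightarrow> e \<in> \<E> \<Longrightarrow> (t, e) \<in> U \<Longrightarrow> \<bar>score f r t e z\<bar> \<le> B z"
    by (rule common_envelope) (rule that)
  have [measurable]: "score f r \<theta> \<eta> \<in> borel_measurable borel" for r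
    using score_measurable[OF true_param] by simp
  have *: "\<bar>score f r \<theta> \<eta> z\<bar> \<le> B z" if "r \<in> {1..4}" for r z using B(3)[OF that true_param U(2)] .
  show "integrable law (score f r \<theta> \<eta>)"
    using B(1) by (rule Bochner_Integration.integrable_bound)
      (use score_le_power_4(1)[OF B(2) *[OF assms]] in auto)
  show "integrable law (\<lambda>z. score f r \<theta> \<eta> z * score f r' \<theta> \<eta> z)" if "r' \<in> {1..4}"
    using B(1) by (rule Bochner_Integration.integrable_bound)
      (use score_le_power_4(2)[OF B(2) *[OF assms] *[OF that]] in auto)
qed

text \<open>The limits are the means at the true parameter. In the last part \<open>\<xi>\<^sub>3\<close> has mean \<open>0\<close> and \<open>\<xi>\<^sub>1 \<xi>\<^sub>2\<close> does
  by orthogonality; these averages are those of the derivative of \<open>\<xi>\<^sub>2\<close> in \<open>t\<close>.\<close>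

lemma averages_of_scores:
  assumes "0 < \<epsilon>"
  shows "\<exists>\<rho>>0. whp M (\<lambda>N \<omega>. \<forall>t\<in>ball \<theta> \<rho> \<inter> \<Theta>. \<forall>e\<in>ball \<eta> \<rho> \<inter> \<E>. \<bar>avg (score f 2 t e) N \<omega>\<bar> \<le> \<epsilon>)"
    and "\<exists>\<rho>>0. whp M (\<lambda>N \<omega>. \<forall>t\<in>ball \<theta> \<rho> \<inter> \<Theta>. \<forall>e\<in>ball \<eta> \<rho> \<inter> \<E>.
      avg (\<lambda>z. score f 2 t e z - (score f 1 t e z)\<^sup>2) N \<omega> \<le> - fisher + \<epsilon>)"
    and "(\<integral>z. score f 1 \<theta> \<eta> z * score f 2 \<theta> \<eta> z \<partial>law) = 0 \<Longrightarrow>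
      \<exists>\<rho>>0. whp M (\<lambda>N \<omega>. \<forall>t\<in>ball \<theta> \<rho> \<inter> \<Theta>. \<forall>e\<in>ball \<eta> \<rho> \<inter> \<E>.
        \<bar>avg (\<lambda>z. score f 3 t e z - score f 2 t e z * score f 1 t e z) N \<omega>\<bar> \<le> \<epsilon>)"
proof -
  have pow: "2 * B ^ 4 \<ge> B ^ 4" if "1 \<le> B" for B :: real using that by simp
  have "\<exists>\<rho>>0. whp M (\<lambda>N \<omega>. \<forall>t\<in>ball \<theta> \<rho> \<inter> \<Theta>. \<forall>e\<in>ball \<eta> \<rho> \<inter> \<E>.
      \<bar>avg (score f 2 t e) N \<omega> - (\<integral>z. score f 2 \<theta> \<eta> z \<partial>law)\<bar> \<le> \<epsilon>)"
  proof (rule uniform_law_score_pair)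
    show "\<bar>score f 2 t e z\<bar> \<le> 2 * B ^ 4" if "1 \<le> B" "\<And>r. r \<in> {1..4} \<Longrightarrow> \<bar>score f r t e z\<bar> \<le> B" for t e z B
      using score_le_power_4(1)[OF that(1) that(2)[of 2]] pow[OF that(1)] by simp
  qed (use score_measurable continuous_on_score assms in auto)
  then show "\<exists>\<rho>>0. whp M (\<lambda>N \<omega>. \<forall>t\<in>ball \<theta> \<rho> \<inter> \<Theta>. \<forall>e\<in>ball \<eta> \<rho> \<inter> \<E>. \<bar>avg (score f 2 t e) N \<omega>\<bar> \<le> \<epsilon>)"
    using score_mean_zero[of 2] by simp
  have "\<exists>\<rho>>0. whp M (\<lambda>N \<omega>. \<forall>t\<in>ball \<theta> \<rho> \<inter> \<Theta>. \<forall>e\<in>ball \<eta> \<rho> \<inter> \<E>.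
      \<bar>avg (\<lambda>z. score f 2 t e z - (score f 1 t e z)\<^sup>2) N \<omega> - (\<integral>z. score f 2 \<theta> \<eta> z - (score f 1 \<theta> \<eta> z)\<^sup>2 \<partial>law)\<bar> \<le> \<epsilon>)"
  proof (rule uniform_law_score_pair)
    show "\<bar>score f 2 t e z - (score f 1 t e z)\<^sup>2\<bar> \<le> 2 * B ^ 4" if "1 \<le> B" "\<And>r. r \<in> {1..4} \<Longrightarrow> \<bar>score f r t e z\<bar> \<le> B" for t e z B
    proof -
      have "\<bar>score f 2 t e z\<bar> \<le> B ^ 4" "\<bar>score f 1 t e z * score f 1 t e z\<bar> \<le> B ^ 4"
        using score_le_power_4(1)[OF that(1) that(2)[of 2]] score_le_power_4(2)[OF that(1) that(2)[of 1] that(2)[of 1]]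
        by simp_all
      then show ?thesis unfolding power2_eq_square by linarith
    qed
  qed (use score_measurable continuous_on_score assms in \<open>auto intro!: continuous_intros borel_measurable_diff borel_measurable_power\<close>)
  moreover have "(\<integral>z. score f 2 \<theta> \<eta> z - (score f 1 \<theta> \<eta> z)\<^sup>2 \<partial>law) = - fisher"
    using integrable_score(1)[of 2] integrable_score(2)[of 1 1] score_mean_zero[of 2]
    by (simp add: fisher_def power2_eq_square)
  ultimately obtain \<rho> where "\<rho> > 0" and whp: "whp M (\<lambda>N \<omega>. \<forall>t\<in>ball \<theta> \<rho> \<inter> \<Theta>. \<forall>e\<in>ball \<eta> \<rho> \<inter> \<E>.
      \<bar>avg (\<lambda>z. score f 2 t e z - (score f 1 t e z)\<^sup>2) N \<omega> - (- fisher)\<bar> \<le> \<epsilon>)" by auto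
  from whp have "whp M (\<lambda>N \<omega>. \<forall>t\<in>ball \<theta> \<rho> \<inter> \<Theta>. \<forall>e\<in>ball \<eta> \<rho> \<inter> \<E>.
      avg (\<lambda>z. score f 2 t e z - (score f 1 t e z)\<^sup>2) N \<omega> \<le> - fisher + \<epsilon>)"
    by (rule whp_mono) (simp add: abs_le_iff algebra_simps)
  with \<open>\<rho> > 0\<close> show "\<exists>\<rho>>0. whp M (\<lambda>N \<omega>. \<forall>t\<in>ball \<theta> \<rho> \<inter> \<Theta>. \<forall>e\<in>ball \<eta> \<rho> \<inter> \<E>.
      avg (\<lambda>z. score f 2 t e z - (score f 1 t e z)\<^sup>2) N \<omega> \<le> - fisher + \<epsilon>)" by blast
  assume ortho: "(\<integral>z. score f 1 \<theta> \<eta> z * score f 2 \<theta> \<eta> z \<partial>law) = 0"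
  have "\<exists>\<rho>>0. whp M (\<lambda>N \<omega>. \<forall>t\<in>ball \<theta> \<rho> \<inter> \<Theta>. \<forall>e\<in>ball \<eta> \<rho> \<inter> \<E>.
      \<bar>avg (\<lambda>z. score f 3 t e z - score f 2 t e z * score f 1 t e z) N \<omega>
        - (\<integral>z. score f 3 \<theta> \<eta> z - score f 2 \<theta> \<eta> z * score f 1 \<theta> \<eta> z \<partial>law)\<bar> \<le> \<epsilon>)"
  proof (rule uniform_law_score_pair)
    show "\<bar>score f 3 t e z - score f 2 t e z * score f 1 t e z\<bar> \<le> 2 * B ^ 4" if "1 \<le> B" "\<And>r. r \<in> {1..4} \<Longrightarrow> \<bar>score f r t e z\<bar> \<le> B" for t e z B
    proof -
      have "\<bar>score f 3 t e z\<bar> \<le> B ^ 4" "\<bar>score f 2 t e z * score f 1 t e z\<bar> \<le> B ^ 4"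
        using score_le_power_4(1)[OF that(1) that(2)[of 3]] score_le_power_4(2)[OF that(1) that(2)[of 2] that(2)[of 1]]
        by simp_all
      then show ?thesis by linarith
    qed
  qed (use score_measurable continuous_on_score assms in \<open>auto intro!: continuous_intros borel_measurable_diff borel_measurable_times\<close>)
  moreover have "(\<integral>z. score f 3 \<theta> \<eta> z - score f 2 \<theta> \<eta> z * score f 1 \<theta> \<eta> z \<partial>law) = 0"
    using integrable_score(1)[of 3] integrable_score(2)[of 2 1] score_mean_zero[of 3] ortho
    by (simp add: mult.commute)
  ultimately show "\<exists>\<rho>>0. whp M (\<lambda>N \<omega>. \<forall>t\<in>ball \<theta> \<rho> \<inter> \<Theta>. \<forall>e\<in>ball \<eta> \<rho> \<inter> \<E>.
        \<bar>avg (\<lambda>z. score f 3 t e z - score f 2 t e z * score f 1 t e z) N \<omega>\<bar> \<le> \<epsilon>)" by simp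
qed

lemma averages_of_log_deriv_4:
  assumes "0 < \<epsilon>"
  shows "\<exists>\<rho>>0. whp M (\<lambda>N \<omega>. \<forall>x\<in>ball \<theta> \<rho> \<inter> \<Theta>. \<forall>y\<in>ball \<theta> \<rho> \<inter> \<Theta>. \<forall>e\<in>ball \<eta> \<rho> \<inter> \<E>.
      \<bar>avg (\<lambda>z. log_deriv 4 (mixture_deriv f z x y e)) N \<omega> - quartic_mean\<bar> \<le> \<epsilon>)"
proof -
  obtain U B where U: "open U" "(\<theta>, \<eta>) \<in> U" and B: "integrable law (\<lambda>z. B z ^ 4)" "\<And>z. (1::real) \<le> B z"
    "\<And>r t e z. r \<in> {1..4::nat} \<Longrightarrow> t \<in> \<Theta> \<Longrightarrow> e \<in> \<E> \<Longrightarrow> (t, e) \<in> U \<Longrightarrow> \<bar>score f r t e z\<bar> \<le> B z"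
    by (rule common_envelope) (rule that)
  define V where "V = (\<lambda>p. (fst p, snd (snd p))) -` U \<inter> (\<lambda>p. (fst (snd p), snd (snd p))) -` U"
  have V: "open V" "(\<theta>, \<theta>, \<eta>) \<in> V"
    unfolding V_def using U by (auto intro!: open_Int open_vimage continuous_intros)
  have "\<exists>W. open W \<and> (\<theta>, \<theta>, \<eta>) \<in> W \<and> whp M (\<lambda>N \<omega>. \<forall>p\<in>W \<inter> \<Theta> \<times> \<Theta> \<times> \<E>.
      \<bar>avg (\<lambda>z. (\<lambda>(x, y, e). log_deriv 4 (mixture_deriv f z x y e)) p) N \<omega>
        - (\<integral>z. (\<lambda>(x, y, e). log_deriv 4 (mixture_deriv f z x y e)) (\<theta>, \<theta>, \<eta>) \<partial>law)\<bar> \<le> \<epsilon>)"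
  proof (rule uniform_law[where S="\<Theta> \<times> \<Theta> \<times> \<E>" and U=V and G="\<lambda>z. 26 * B z ^ 4"])
    fix z p assume "p \<in> V \<inter> \<Theta> \<times> \<Theta> \<times> \<E>"
    then obtain x y e where p: "p = (x, y, e)" "x \<in> \<Theta>" "y \<in> \<Theta>" "e \<in> \<E>" "(x, e) \<in> U" "(y, e) \<in> U"
      by (cases p) (auto simp: V_def)
    have "\<bar>log_deriv 4 (mixture_deriv f z x y e)\<bar> \<le> 26 * B z ^ 4"
    proof (cases "0 < f z \<theta> \<eta>")
      case True
      then show ?thesis using B p by (intro log_deriv_4_le mixture_ratio_le) auto
    next
      case False
      have "0 \<le> B z ^ 4" using B(2)[of z] by simp
      then show ?thesis unfolding log_deriv_4_outside[OF False p(2-4)] by simp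
    qed
    then show "\<bar>(\<lambda>(x, y, e). log_deriv 4 (mixture_deriv f z x y e)) p\<bar> \<le> 26 * B z ^ 4" by (simp add: p)
  qed (use log_deriv_4_measurable continuous_on_log_deriv_4 true_param V B(1) \<open>0 < \<epsilon>\<close> in auto)
  then obtain W where W: "open W" "(\<theta>, \<theta>, \<eta>) \<in> W" and whp: "whp M (\<lambda>N \<omega>. \<forall>p\<in>W \<inter> \<Theta> \<times> \<Theta> \<times> \<E>.
      \<bar>avg (\<lambda>z. (\<lambda>(x, y, e). log_deriv 4 (mixture_deriv f z x y e)) p) N \<omega> - quartic_mean\<bar> \<le> \<epsilon>)"
    unfolding quartic_mean_def by auto
  obtain \<rho> where "\<rho> > 0" "\<forall>x\<in>ball \<theta> \<rho>. \<forall>y\<in>ball \<theta> \<rho>. \<forall>e\<in>ball \<eta> \<rho>. (x, y, e) \<in> W"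
    using open_box_triple[OF W] by blast
  note \<rho> = this
  have "whp M (\<lambda>N \<omega>. \<forall>x\<in>ball \<theta> \<rho> \<inter> \<Theta>. \<forall>y\<in>ball \<theta> \<rho> \<inter> \<Theta>. \<forall>e\<in>ball \<eta> \<rho> \<inter> \<E>.
      \<bar>avg (\<lambda>z. log_deriv 4 (mixture_deriv f z x y e)) N \<omega> - quartic_mean\<bar> \<le> \<epsilon>)"
    using whp
  proof (rule whp_mono, intro ballI)
    fix N \<omega> x y e
    assume all: "\<forall>p\<in>W \<inter> \<Theta> \<times> \<Theta> \<times> \<E>.
      \<bar>avg (\<lambda>z. (\<lambda>(x, y, e). log_deriv 4 (mixture_deriv f z x y e)) p) N \<omega> - quartic_mean\<bar> \<le> \<epsilon>"
      and xye: "x \<in> ball \<theta> \<rho> \<inter> \<Theta>" "y \<in> ball \<theta> \<rho> \<inter> \<Theta>" "e \<in> ball \<eta> \<rho> \<inter> \<E>"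
    have "(x, y, e) \<in> W \<inter> \<Theta> \<times> \<Theta> \<times> \<E>" using xye \<rho>(2) by blast
    from bspec[OF all this] show "\<bar>avg (\<lambda>z. log_deriv 4 (mixture_deriv f z x y e)) N \<omega> - quartic_mean\<bar> \<le> \<epsilon>"
      by simp
  qed
  then show ?thesis using \<rho>(1) by blast
qed

end


section \<open>Consistency of the fitted mixture\<close>

context regular_family
begin

definition truncated_log_ratio :: "real \<Rightarrow> real \<times> real \<times> real \<Rightarrow> real" where
  "truncated_log_ratio z = (\<lambda>(x, y, e). max (ln (mixture_density f z x y e / f z \<theta> \<eta>)) (-1))"

lemma truncated_log_ratio_outside:
  "\<not> 0 < f z \<theta> \<eta> \<Longrightarrow> x \<in> \<Theta> \<Longrightarrow> y \<in> \<Theta> \<Longrightarrow> e \<in> \<E> \<Longrightarrow> truncated_log_ratio z (x, y, e) = 0"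
  by (simp add: truncated_log_ratio_def mixture_density_outside)

lemma continuous_on_truncated_log_ratio: "continuous_on (\<Theta> \<times> \<Theta> \<times> \<E>) (truncated_log_ratio z)"
proof (cases "0 < f z \<theta> \<eta>")
  case True
  have "0 < mixture_density f z (fst p) (fst (snd p)) (snd (snd p)) / f z \<theta> \<eta>" if "p \<in> \<Theta> \<times> \<Theta> \<times> \<E>" for p
    using mixture_density_pos[OF True, of "fst p" "fst (snd p)" "snd (snd p)"] that True by auto
  then have ne: "\<forall>p\<in>\<Theta> \<times> \<Theta> \<times> \<E>. mixture_density f z (fst p) (fst (snd p)) (snd (snd p)) / f z \<theta> \<eta> \<noteq> 0"
    by (metis less_irrefl)
  have "continuous_on (\<Theta> \<times> \<Theta> \<times> \<E>) (\<lambda>p. mixture_density f z (fst p) (fst (snd p)) (snd (snd p)))"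
    using continuous_on_mixture_density[OF True] by (simp add: case_prod_beta')
  then have "continuous_on (\<Theta> \<times> \<Theta> \<times> \<E>) (\<lambda>p. ln (mixture_density f z (fst p) (fst (snd p)) (snd (snd p)) / f z \<theta> \<eta>))"
    using True ne by (intro continuous_on_ln continuous_on_divide continuous_on_const) auto
  then show ?thesis
    unfolding truncated_log_ratio_def case_prod_beta' by (intro continuous_on_max continuous_on_const)
next
  case False
  then have "truncated_log_ratio z p = 0" if "p \<in> \<Theta> \<times> \<Theta> \<times> \<E>" for p
    using truncated_log_ratio_outside[OF False, of "fst p" "fst (snd p)" "snd (snd p)"] that by auto
  then show ?thesis by (simp cong: continuous_on_cong)
qed

lemma truncated_log_ratio_measurable:
  assumes "p \<in> \<Theta> \<times> \<Theta> \<times> \<E>"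
  shows "(\<lambda>z. truncated_log_ratio z p) \<in> borel_measurable borel"
proof -
  obtain x y e where p: "p = (x, y, e)" "x \<in> \<Theta>" "y \<in> \<Theta>" "e \<in> \<E>" using assms by auto
  note [measurable] = mixture_density_measurable[OF p(2-4)]
  show ?thesis unfolding truncated_log_ratio_def p(1) by simp
qed

lemma truncated_log_ratio_le:
  assumes "x \<in> \<Theta>" "y \<in> \<Theta>" "e \<in> \<E>"
    and "0 < f z \<theta> \<eta> \<Longrightarrow> ln (f z x e / f z \<theta> \<eta>) \<le> a" "0 < f z \<theta> \<eta> \<Longrightarrow> ln (f z y e / f z \<theta> \<eta>) \<le> b"
  shows "truncated_log_ratio z (x, y, e) \<le> \<bar>a\<bar> + \<bar>b\<bar>"
proof (cases "0 < f z \<theta> \<eta>")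
  case True
  have p: "0 < f z x e / f z \<theta> \<eta>" "0 < f z y e / f z \<theta> \<eta>"
    using density_pos[OF True] assms(1-3) True by auto
  have "mixture_density f z x y e / f z \<theta> \<eta> \<le> max (f z x e / f z \<theta> \<eta>) (f z y e / f z \<theta> \<eta>)"
    by (simp add: mixture_density_def add_divide_distrib)
  then have "ln (mixture_density f z x y e / f z \<theta> \<eta>) \<le> ln (max (f z x e / f z \<theta> \<eta>) (f z y e / f z \<theta> \<eta>))"
    using mixture_density_pos[OF True assms(1-3)] True p by (intro ln_mono) auto
  also have "\<dots> \<le> max a b" using assms(4,5)[OF True] by (simp add: max_def) 
  finally show ?thesis unfolding truncated_log_ratio_def by auto
next
  case False
  then show ?thesis using truncated_log_ratio_outside[OF False assms(1-3)] by simp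
qed

text \<open>The Kullback-Leibler inequality, for the log-ratio truncated at \<open>-1\<close>. Truncation keeps the mean
  finite, and it preserves the bound \<open>max (ln x) (-1) \<le> x - 1\<close> for \<open>x > 0\<close>, with equality only at \<open>x = 1\<close>. Since the ratio
  of the two densities has mean \<open>1\<close>, a mean of at least \<open>0\<close> would force them to agree.\<close>

lemma truncated_log_ratio_mean_neg:
  assumes x: "x \<in> \<Theta>" and y: "y \<in> \<Theta>" and ne: "(x, y) \<noteq> (\<theta>, \<theta>)"
    and int: "integrable law (\<lambda>z. truncated_log_ratio z (x, y, \<eta>))"
  shows "(\<integral>z. truncated_log_ratio z (x, y, \<eta>) \<partial>law) < 0"
proof (rule ccontr)
  assume "\<not> ?thesis"
  then have ge: "0 \<le> (\<integral>z. truncated_log_ratio z (x, y, \<eta>) \<partial>law)" by simp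
  let ?g = "\<lambda>z. mixture_density f z x y \<eta>"
  define R where "R z = ?g z / f z \<theta> \<eta>" for z
  note \<eta> = true_param(2)
  have [measurable]: "?g \<in> borel_measurable borel" by (rule mixture_density_measurable[OF x y \<eta>])
  have [measurable]: "R \<in> borel_measurable borel" unfolding R_def by measurable
  have g0: "0 \<le> ?g z" for z by (simp add: mixture_density_def density_nonneg x y \<eta>)
  have f0: "0 \<le> f z \<theta> \<eta>" for z by (rule density_nonneg[OF true_param])
  have R: "f z \<theta> \<eta> * R z = ?g z" for z
    using mixture_density_outside[OF _ x y \<eta>, of z] f0[of z] by (auto simp: R_def)
  have density1: "has_bochner_integral lborel (\<lambda>z. f z t \<eta>) 1" if "t \<in> \<Theta>" for t
    using density_total[OF that \<eta>] density_nonneg[OF that \<eta>] density_measurable[OF that \<eta>]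
    by (intro has_bochner_integral_nn_integral) auto
  have g1: "has_bochner_integral lborel ?g 1"
    using has_bochner_integral_add[OF has_bochner_integral_mult_right[OF density1[OF x], of "1/2"]
        has_bochner_integral_mult_right[OF density1[OF y], of "1/2"]]
    by (simp add: mixture_density_def)
  interpret prob_space law
    by standard (use density_total[OF true_param] in \<open>simp add: model_law_def emeasure_density\<close>)
  have intR: "integrable law R" and R1: "(\<integral>z. R z \<partial>law) = 1"
    unfolding model_law_def using g1 f0
    by (simp_all add: integrable_density integral_density R has_bochner_integral_iff)
  have "(\<integral>z. R z - 1 \<partial>law) = 0" using intR R1 prob_space by simp
  have le: "truncated_log_ratio z (x, y, \<eta>) \<le> R z - 1" if "0 < f z \<theta> \<eta>" for z
  proof -
    have "0 < R z" using mixture_density_pos[OF that x y \<eta>] that by (simp add: R_def)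
    then show ?thesis using ln_le_minus_one[of "R z"] by (simp add: truncated_log_ratio_def R_def)
  qed
  have AEle: "AE z in law. truncated_log_ratio z (x, y, \<eta>) \<le> R z - 1"
    using AE_law_support le by auto
  have intR1: "integrable law (\<lambda>z. R z - 1)" using intR by auto
  have "(\<integral>z. truncated_log_ratio z (x, y, \<eta>) \<partial>law) \<le> (\<integral>z. R z - 1 \<partial>law)"
    using int intR1 AEle by (rule integral_mono_AE)
  then have "(\<integral>z. truncated_log_ratio z (x, y, \<eta>) \<partial>law) = (\<integral>z. R z - 1 \<partial>law)"
    using ge \<open>(\<integral>z. R z - 1 \<partial>law) = 0\<close> by simp
  from integral_ineq_eq_0_then_AE[OF AEle int intR1 this]
  have "AE z in law. truncated_log_ratio z (x, y, \<eta>) = R z - 1" .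
  then have "AE z in law. 0 < f z \<theta> \<eta> \<longrightarrow> ?g z = f z \<theta> \<eta>"
  proof eventually_elim
    case (elim z)
    show ?case
    proof
      assume pos: "0 < f z \<theta> \<eta>"
      then have "0 < R z" using mixture_density_pos[OF pos x y \<eta>] by (simp add: R_def)
      moreover have "max (ln (R z)) (-1) = R z - 1" using elim by (simp add: truncated_log_ratio_def R_def)
      ultimately have "ln (R z) = R z - 1" by (simp add: max_def split: if_splits)
      then have "R z = 1" using \<open>0 < R z\<close> by (intro ln_eq_minus_one) auto
      then show "?g z = f z \<theta> \<eta>" using pos by (simp add: R_def)
    qed
  qed
  then have "AE z in lborel. ?g z = f z \<theta> \<eta>"
    unfolding model_law_def
  proof (subst (asm) AE_density)
    assume "AE z in lborel. 0 < ennreal (f z \<theta> \<eta>) \<longrightarrow> 0 < f z \<theta> \<eta> \<longrightarrow> ?g z = f z \<theta> \<eta>"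
    then show ?thesis
    proof eventually_elim
      case (elim z)
      then show ?case
        using mixture_density_outside[OF _ x y \<eta>, of z] f0[of z] by (cases "0 < f z \<theta> \<eta>") auto
    qed
  qed simp
  from identifiable[OF x y this] ne show False by simp
qed

end

context homogeneous_sample
begin

text \<open>The truncated log-ratio lies above the log-ratio, so that its negative mean pushes the likelihood strictly
  below that of the truth, on a whole neighbourhood by the one-sided uniform law.\<close>

lemma loglik_gap_near:
  assumes x: "x \<in> \<Theta>" and y: "y \<in> \<Theta>" and ne: "(x, y) \<noteq> (\<theta>, \<theta>)"
  shows "\<exists>W. open W \<and> (x, y, \<eta>) \<in> W \<and> whp M (\<lambda>N \<omega>. \<forall>(s, t, e)\<in>W \<inter> \<Theta> \<times> \<Theta> \<times> \<E>.
    loglik f (\<lambda>i. Z i \<omega>) N s t e < loglik f (\<lambda>i. Z i \<omega>) N \<theta> \<theta> \<eta>)"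
proof -
  obtain U1 G1 where U1: "open U1" "(x, \<eta>) \<in> U1" "integrable law G1"
    "\<forall>(s, e) \<in> U1 \<inter> \<Theta> \<times> \<E>. \<forall>z. 0 < f z \<theta> \<eta> \<longrightarrow> ln (f z s e / f z \<theta> \<eta>) \<le> G1 z"
    using loglik_envelope[OF x] by (elim exE conjE) (rule that)
  obtain U2 G2 where U2: "open U2" "(y, \<eta>) \<in> U2" "integrable law G2"
    "\<forall>(s, e) \<in> U2 \<inter> \<Theta> \<times> \<E>. \<forall>z. 0 < f z \<theta> \<eta> \<longrightarrow> ln (f z s e / f z \<theta> \<eta>) \<le> G2 z"
    using loglik_envelope[OF y] by (elim exE conjE) (rule that)
  define U where "U = (\<lambda>p. (fst p, snd (snd p))) -` U1 \<inter> (\<lambda>p. (fst (snd p), snd (snd p))) -` U2"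
  define G where "G z = \<bar>G1 z\<bar> + \<bar>G2 z\<bar>" for z
  have U: "open U" "(x, y, \<eta>) \<in> U"
    unfolding U_def using U1 U2 by (auto intro!: open_Int open_vimage continuous_intros)
  have G: "integrable law G" unfolding G_def using U1 U2 by auto
  have dom: "truncated_log_ratio z p \<le> G z" if pU: "p \<in> U \<inter> \<Theta> \<times> \<Theta> \<times> \<E>" for z p
  proof -
    obtain s t e where p: "p = (s, t, e)" "s \<in> \<Theta>" "t \<in> \<Theta>" "e \<in> \<E>" "(s, e) \<in> U1" "(t, e) \<in> U2"
      using pU by (cases p) (auto simp: U_def)
    show ?thesis unfolding p(1) G_def
    proof (rule truncated_log_ratio_le[OF p(2-4)])
      show "ln (f z s e / f z \<theta> \<eta>) \<le> G1 z" if "0 < f z \<theta> \<eta>" using U1(4) p that by fast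
      show "ln (f z t e / f z \<theta> \<eta>) \<le> G2 z" if "0 < f z \<theta> \<eta>" using U2(4) p that by fast
    qed
  qed
  have p0: "(x, y, \<eta>) \<in> \<Theta> \<times> \<Theta> \<times> \<E>" using x y true_param by simp
  interpret law: prob_space law by (rule prob_space_D)
  have int: "integrable law (\<lambda>z. truncated_log_ratio z (x, y, \<eta>))"
  proof (rule Bochner_Integration.integrable_bound)
    show "integrable law (\<lambda>z. 1 + G z)" using G by auto
    show "AE z in law. norm (truncated_log_ratio z (x, y, \<eta>)) \<le> norm (1 + G z)"
    proof (rule AE_I2)
      fix z
      have "- 1 \<le> truncated_log_ratio z (x, y, \<eta>)" by (simp add: truncated_log_ratio_def)
      moreover have "truncated_log_ratio z (x, y, \<eta>) \<le> G z" using dom U p0 by blast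
      moreover have "0 \<le> G z" by (simp add: G_def)
      ultimately show "norm (truncated_log_ratio z (x, y, \<eta>)) \<le> norm (1 + G z)" by simp
    qed
  qed (use truncated_log_ratio_measurable[OF p0] in measurable)
  define \<delta> where "\<delta> = - (\<integral>z. truncated_log_ratio z (x, y, \<eta>) \<partial>law) / 2"
  have \<delta>: "\<delta> > 0" "(\<integral>z. truncated_log_ratio z (x, y, \<eta>) \<partial>law) + \<delta> = - \<delta>"
    using truncated_log_ratio_mean_neg[OF x y ne int] by (simp_all add: \<delta>_def)
  obtain W where W: "open W" "(x, y, \<eta>) \<in> W" and "whp M (\<lambda>N \<omega>. \<forall>p\<in>W \<inter> \<Theta> \<times> \<Theta> \<times> \<E>.
      avg (\<lambda>z. truncated_log_ratio z p) N \<omega> \<le> (\<integral>z. truncated_log_ratio z (x, y, \<eta>) \<partial>law) + \<delta>)"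
  proof -
    have "\<exists>W. open W \<and> (x, y, \<eta>) \<in> W \<and> whp M (\<lambda>N \<omega>. \<forall>p\<in>W \<inter> \<Theta> \<times> \<Theta> \<times> \<E>.
        avg (\<lambda>z. truncated_log_ratio z p) N \<omega> \<le> (\<integral>z. truncated_log_ratio z (x, y, \<eta>) \<partial>law) + \<delta>)"
      by (rule uniform_upper_law[where \<phi>=truncated_log_ratio, OF _ _ p0 U _ G int \<delta>(1)])
        (fact truncated_log_ratio_measurable continuous_on_truncated_log_ratio dom)+
    then show ?thesis by (elim exE conjE) (rule that)
  qed
  note whp = this(3)
  have "whp M (\<lambda>N \<omega>. 1 \<le> N)" by (intro whp_eventually eventually_sequentiallyI[of 1]) auto
  from whp_conj[OF whp whp_conj[OF whp_in_support this]]
  have "whp M (\<lambda>N \<omega>. \<forall>(s, t, e)\<in>W \<inter> \<Theta> \<times> \<Theta> \<times> \<E>.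
    loglik f (\<lambda>i. Z i \<omega>) N s t e < loglik f (\<lambda>i. Z i \<omega>) N \<theta> \<theta> \<eta>)"
  proof (rule whp_mono)
    fix N \<omega>
    assume *: "(\<forall>p\<in>W \<inter> \<Theta> \<times> \<Theta> \<times> \<E>. avg (\<lambda>z. truncated_log_ratio z p) N \<omega>
        \<le> (\<integral>z. truncated_log_ratio z (x, y, \<eta>) \<partial>law) + \<delta>) \<and>
      (\<forall>i\<in>{1..N}. 0 < f (Z i \<omega>) \<theta> \<eta>) \<and> 1 \<le> N"
    show "\<forall>(s, t, e)\<in>W \<inter> \<Theta> \<times> \<Theta> \<times> \<E>. loglik f (\<lambda>i. Z i \<omega>) N s t e < loglik f (\<lambda>i. Z i \<omega>) N \<theta> \<theta> \<eta>"
    proof clarify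
      fix s t e assume ste: "(s, t, e) \<in> W" "s \<in> \<Theta>" "t \<in> \<Theta>" "e \<in> \<E>"
      then have "avg (\<lambda>z. truncated_log_ratio z (s, t, e)) N \<omega> \<le> - \<delta>"
        unfolding \<delta>(2)[symmetric] using * by blast
      then have "avg (\<lambda>z. truncated_log_ratio z (s, t, e)) N \<omega> < 0" using \<delta>(1) by linarith
      then have neg: "(\<Sum>i=1..N. truncated_log_ratio (Z i \<omega>) (s, t, e)) < 0"
        using * by (simp add: divide_less_0_iff)
      have "loglik f (\<lambda>i. Z i \<omega>) N s t e - loglik f (\<lambda>i. Z i \<omega>) N \<theta> \<theta> \<eta>
          = (\<Sum>i=1..N. ln (mixture_density f (Z i \<omega>) s t e / f (Z i \<omega>) \<theta> \<eta>))"
        unfolding loglik_def sum_subtractf[symmetric]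
      proof (intro sum.cong refl)
        fix i assume "i \<in> {1..N}"
        then have pos: "0 < f (Z i \<omega>) \<theta> \<eta>" using * by blast
        show "ln (mixture_density f (Z i \<omega>) s t e) - ln (mixture_density f (Z i \<omega>) \<theta> \<theta> \<eta>)
            = ln (mixture_density f (Z i \<omega>) s t e / f (Z i \<omega>) \<theta> \<eta>)"
          using pos mixture_density_pos[OF pos ste(2-4)] by (simp add: ln_div)
      qed
      also have "\<dots> \<le> (\<Sum>i=1..N. truncated_log_ratio (Z i \<omega>) (s, t, e))"
        by (intro sum_mono) (simp add: truncated_log_ratio_def)
      finally show "loglik f (\<lambda>i. Z i \<omega>) N s t e < loglik f (\<lambda>i. Z i \<omega>) N \<theta> \<theta> \<eta>" using neg by linarith
    qed
  qed
  with W show ?thesis by blast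
qed

text \<open>Wald's consistency theorem. The compact set of pairs away from \<open>(\<theta>, \<theta>)\<close> is covered by finitely many of
  the neighbourhoods above.\<close>

lemma loglik_gap:
  assumes K: "compact K" "K \<subseteq> \<Theta>" and "0 < \<rho>"
    and \<eta>h: "\<And>N \<omega>. \<omega> \<in> space M \<Longrightarrow> \<eta>h N \<omega> \<in> \<E>" "converges_in_prob M \<eta>h \<eta>"
  shows "whp M (\<lambda>N \<omega>. \<forall>s\<in>K. \<forall>t\<in>K. (s, t) \<in> ball \<theta> \<rho> \<times> ball \<theta> \<rho> \<or>
    loglik f (\<lambda>i. Z i \<omega>) N s t (\<eta>h N \<omega>) < loglik f (\<lambda>i. Z i \<omega>) N \<theta> \<theta> \<eta>)"
proof -
  define C where "C = K \<times> K - ball \<theta> \<rho> \<times> ball \<theta> \<rho>"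
  have C: "compact C" unfolding C_def using K(1) by (intro compact_diff compact_Times open_Times) auto
  define good where "good V \<longleftrightarrow> whp M (\<lambda>N \<omega>. \<forall>(s, t)\<in>V \<inter> \<Theta> \<times> \<Theta>.
    loglik f (\<lambda>i. Z i \<omega>) N s t (\<eta>h N \<omega>) < loglik f (\<lambda>i. Z i \<omega>) N \<theta> \<theta> \<eta>)" for V
  have "\<exists>V. open V \<and> p \<in> V \<and> good V" if p: "p \<in> C" for p
  proof -
    obtain x y where xy: "p = (x, y)" "x \<in> \<Theta>" "y \<in> \<Theta>" "(x, y) \<noteq> (\<theta>, \<theta>)"
    proof -
      obtain x y where xy: "p = (x, y)" by (cases p)
      then have "x \<in> K" "y \<in> K" "(x, y) \<notin> ball \<theta> \<rho> \<times> ball \<theta> \<rho>" using p by (simp_all add: C_def)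
      moreover have "(\<theta>, \<theta>) \<in> ball \<theta> \<rho> \<times> ball \<theta> \<rho>" using \<open>0 < \<rho>\<close> by simp
      ultimately show ?thesis using that[of x y] xy K(2) by (metis subsetD)
    qed
    obtain W where W: "open W" "(x, y, \<eta>) \<in> W" and whp: "whp M (\<lambda>N \<omega>. \<forall>(s, t, e)\<in>W \<inter> \<Theta> \<times> \<Theta> \<times> \<E>.
        loglik f (\<lambda>i. Z i \<omega>) N s t e < loglik f (\<lambda>i. Z i \<omega>) N \<theta> \<theta> \<eta>)"
      using loglik_gap_near[OF xy(2-4)] by (elim exE conjE) (rule that)
    obtain r where r: "r > 0" "\<forall>s\<in>ball x r. \<forall>t\<in>ball y r. \<forall>e\<in>ball \<eta> r. (s, t, e) \<in> W"
      using open_box_triple[OF W] by (elim exE conjE) (rule that)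
    have "whp M (\<lambda>N \<omega>. \<bar>\<eta>h N \<omega> - \<eta>\<bar> \<le> r / 2)"
      using r(1) by (intro converges_in_prob_whp \<eta>h(2)) simp
    from whp_conj[OF whp this] have "good (ball x r \<times> ball y r)"
      unfolding good_def
    proof (rule whp_mono)
      fix N \<omega> assume \<omega>: "\<omega> \<in> space M"
      assume *: "(\<forall>(s, t, e)\<in>W \<inter> \<Theta> \<times> \<Theta> \<times> \<E>.
        loglik f (\<lambda>i. Z i \<omega>) N s t e < loglik f (\<lambda>i. Z i \<omega>) N \<theta> \<theta> \<eta>) \<and> \<bar>\<eta>h N \<omega> - \<eta>\<bar> \<le> r / 2"
      then have near: "\<eta>h N \<omega> \<in> ball \<eta> r" using r(1) by (simp add: dist_real_def abs_minus_commute)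
      show "\<forall>(s, t)\<in>(ball x r \<times> ball y r) \<inter> \<Theta> \<times> \<Theta>.
        loglik f (\<lambda>i. Z i \<omega>) N s t (\<eta>h N \<omega>) < loglik f (\<lambda>i. Z i \<omega>) N \<theta> \<theta> \<eta>"
      proof clarify
        fix s t assume st: "s \<in> ball x r" "t \<in> ball y r" "s \<in> \<Theta>" "t \<in> \<Theta>"
        then have "(s, t, \<eta>h N \<omega>) \<in> W \<inter> \<Theta> \<times> \<Theta> \<times> \<E>" using near r(2) \<eta>h(1)[OF \<omega>] by simp
        with * show "loglik f (\<lambda>i. Z i \<omega>) N s t (\<eta>h N \<omega>) < loglik f (\<lambda>i. Z i \<omega>) N \<theta> \<theta> \<eta>" by fast
      qed
    qed
    then show ?thesis using r(1) xy(1) by (intro exI[of _ "ball x r \<times> ball y r"]) (auto intro: open_Times)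
  qed
  then obtain V where V: "\<And>p. p \<in> C \<Longrightarrow> open (V p) \<and> p \<in> V p \<and> good (V p)" by metis
  obtain F where F: "F \<subseteq> C" "finite F" "C \<subseteq> (\<Union>p\<in>F. V p)"
    by (rule compactE_image[OF C, of C V]) (use V in auto)
  have "whp M (\<lambda>N \<omega>. \<forall>p\<in>F. \<forall>(s, t)\<in>V p \<inter> \<Theta> \<times> \<Theta>.
    loglik f (\<lambda>i. Z i \<omega>) N s t (\<eta>h N \<omega>) < loglik f (\<lambda>i. Z i \<omega>) N \<theta> \<theta> \<eta>)"
  proof (rule whp_Ball[OF F(2)])
    fix p assume "p \<in> F"
    then have "good (V p)" using V F(1) by blast
    then show "whp M (\<lambda>N \<omega>. \<forall>(s, t)\<in>V p \<inter> \<Theta> \<times> \<Theta>.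
      loglik f (\<lambda>i. Z i \<omega>) N s t (\<eta>h N \<omega>) < loglik f (\<lambda>i. Z i \<omega>) N \<theta> \<theta> \<eta>)" unfolding good_def .
  qed
  then show ?thesis
  proof (rule whp_mono)
    fix N \<omega> assume *: "\<forall>p\<in>F. \<forall>(s, t)\<in>V p \<inter> \<Theta> \<times> \<Theta>.
      loglik f (\<lambda>i. Z i \<omega>) N s t (\<eta>h N \<omega>) < loglik f (\<lambda>i. Z i \<omega>) N \<theta> \<theta> \<eta>"
    show "\<forall>s\<in>K. \<forall>t\<in>K. (s, t) \<in> ball \<theta> \<rho> \<times> ball \<theta> \<rho> \<or>
      loglik f (\<lambda>i. Z i \<omega>) N s t (\<eta>h N \<omega>) < loglik f (\<lambda>i. Z i \<omega>) N \<theta> \<theta> \<eta>"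
    proof (intro ballI)
      fix s t assume st: "s \<in> K" "t \<in> K"
      show "(s, t) \<in> ball \<theta> \<rho> \<times> ball \<theta> \<rho> \<or> loglik f (\<lambda>i. Z i \<omega>) N s t (\<eta>h N \<omega>) < loglik f (\<lambda>i. Z i \<omega>) N \<theta> \<theta> \<eta>"
      proof (cases "(s, t) \<in> ball \<theta> \<rho> \<times> ball \<theta> \<rho>")
        case False
        then have "(s, t) \<in> C" using st by (simp add: C_def)
        then obtain p where "p \<in> F" "(s, t) \<in> V p" using F(3) by blast
        with * st K(2) show ?thesis by fast
      qed simp
    qed
  qed
qed

end


section \<open>The limit law of a squared positive part\<close>

lemma normal_density_eq_distr_std:
  assumes "0 < \<sigma>"
  shows "density lborel (\<lambda>x. ennreal (normal_density 0 \<sigma> x))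
    = distr (density lborel (\<lambda>x. ennreal (std_normal_density x))) borel (\<lambda>x. \<sigma> * x)"
proof -
  let ?S = "density lborel (\<lambda>x. ennreal (std_normal_density x))"
  interpret S: prob_space ?S by (rule prob_space_normal_density) simp
  have "distributed ?S lborel (\<lambda>x. x) (\<lambda>x. ennreal (std_normal_density x))"
    unfolding distributed_def
    by (auto intro!: measure_eqI simp: emeasure_distr)
  from S.normal_density_affine[OF this, of \<sigma> 0] assms
  have "distributed ?S lborel (\<lambda>x. \<sigma> * x) (\<lambda>x. ennreal (normal_density 0 \<sigma> x))" by simp
  then have "distr ?S lborel (\<lambda>x. \<sigma> * x) = density lborel (\<lambda>x. ennreal (normal_density 0 \<sigma> x))"
    by (rule distributed_distr_eq_density)
  moreover have "distr ?S lborel (\<lambda>x. \<sigma> * x) = distr ?S borel (\<lambda>x. \<sigma> * x)"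
    by (rule distr_cong) auto
  ultimately show ?thesis by simp
qed

lemma isCont_normal_cdf:
  assumes "0 < \<sigma>"
  shows "isCont (cdf (density lborel (\<lambda>x. ennreal (normal_density 0 \<sigma> x)))) y"
proof -
  let ?D = "density lborel (\<lambda>x. ennreal (normal_density 0 \<sigma> x))"
  interpret D: prob_space ?D by (rule prob_space_normal_density) (fact assms)
  interpret D: real_distribution ?D by standard simp_all
  have "emeasure ?D {y} = 0"
    by (subst emeasure_density) (auto simp: nn_integral_null_set null_sets_def)
  then show ?thesis unfolding D.isCont_cdf by (simp add: measure_def)
qed

context prob_space
begin

text \<open>A multiplicative sandwich at every precision \<open>\<kappa> > 1\<close> turns the weak limit of \<open>Y\<close> into that of \<open>X\<close>:
  the distribution function of \<open>X\<close> at \<open>x \<ge> 0\<close> is squeezed between those of \<open>Y\<close> at \<open>a / \<kappa>\<close> and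
  \<open>\<kappa> a\<close>, with \<open>a = sqrt (x / c)\<close>, and the normal distribution function is continuous.\<close>

lemma converges_in_distr_squared_positive_part:
  assumes X [measurable]: "\<And>N. X N \<in> borel_measurable M"
    and Y: "converges_in_distr M Y (density lborel (\<lambda>x. ennreal (normal_density 0 \<sigma> x)))"
    and \<sigma>: "0 < \<sigma>" and c: "0 < c"
    and sandwich: "\<And>\<kappa>. 1 < \<kappa> \<Longrightarrow> whp M (\<lambda>N \<omega>. c * (max 0 (Y N \<omega>) / \<kappa>)\<^sup>2 \<le> X N \<omega> \<and> X N \<omega> \<le> c * (\<kappa> * max 0 (Y N \<omega>))\<^sup>2)"
  shows "converges_in_distr M X (distr (density lborel (\<lambda>x. ennreal (std_normal_density x))) borel
    (\<lambda>x. c * \<sigma>\<^sup>2 * (max 0 x)\<^sup>2))"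
proof -
  let ?S = "density lborel (\<lambda>x. ennreal (std_normal_density x))"
  let ?D = "density lborel (\<lambda>x. ennreal (normal_density 0 \<sigma> x))"
  have Ym [measurable]: "Y N \<in> borel_measurable M" for N using Y by (simp add: converges_in_distr_def)
  define F where "F = cdf ?D"
  have F_cont: "isCont F y" for y unfolding F_def by (rule isCont_normal_cdf[OF \<sigma>])
  have Y_lim: "(\<lambda>N. prob {\<omega>\<in>space M. Y N \<omega> \<le> y}) \<longlonglongrightarrow> F y" for y
  proof -
    have "(\<lambda>N. cdf (distr M borel (Y N)) y) \<longlonglongrightarrow> F y"
      using Y F_cont unfolding converges_in_distr_def weak_conv_m_def weak_conv_def F_def by blast
    moreover have "cdf (distr M borel (Y N)) y = prob {\<omega>\<in>space M. Y N \<omega> \<le> y}" for N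
      unfolding cdf_def by (subst measure_distr) (auto intro!: arg_cong[where f=prob])
    ultimately show ?thesis by simp
  qed
  define G where "G = cdf (distr ?S borel (\<lambda>x. c * \<sigma>\<^sup>2 * (max 0 x)\<^sup>2))"
  have G_eq: "G x = measure ?S {z. c * \<sigma>\<^sup>2 * (max 0 z)\<^sup>2 \<le> x}" for x
    unfolding G_def cdf_def by (subst measure_distr) (auto intro!: arg_cong[where f="measure ?S"])
  have F_eq: "F y = measure ?S {z. \<sigma> * z \<le> y}" for y
    unfolding F_def normal_density_eq_distr_std[OF \<sigma>] cdf_def
    by (subst measure_distr) (auto intro!: arg_cong[where f="measure ?S"])
  have G_neg: "G x = 0" if "x < 0" for x
  proof -
    have "\<not> c * \<sigma>\<^sup>2 * (max 0 z)\<^sup>2 \<le> x" for z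
    proof -
      have "0 \<le> c * \<sigma>\<^sup>2 * (max 0 z)\<^sup>2" using c by simp
      then show ?thesis using that by linarith
    qed
    then show ?thesis by (simp add: G_eq)
  qed
  have G_F: "G x = F (sqrt (x / c))" if "0 \<le> x" for x
  proof -
    have "c * \<sigma>\<^sup>2 * (max 0 z)\<^sup>2 \<le> x \<longleftrightarrow> \<sigma> * z \<le> sqrt (x / c)" for z
    proof -
      have 1: "\<sigma> * max 0 z = max 0 (\<sigma> * z)" using \<sigma> by (simp add: max_def mult_le_0_iff zero_le_mult_iff)
      have "c * \<sigma>\<^sup>2 * (max 0 z)\<^sup>2 \<le> x \<longleftrightarrow> (\<sigma> * max 0 z)\<^sup>2 \<le> x / c"
        using c by (simp add: power_mult_distrib field_simps)
      also have "\<dots> \<longleftrightarrow> \<sigma> * max 0 z \<le> sqrt (x / c)"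
        using \<sigma> by (metis abs_of_nonneg less_imp_le max.cobounded1 mult_nonneg_nonneg real_sqrt_abs real_sqrt_le_iff)
      also have "\<dots> \<longleftrightarrow> \<sigma> * z \<le> sqrt (x / c)" unfolding 1 using that c by simp
      finally show ?thesis .
    qed
    then show ?thesis by (simp add: G_eq F_eq)
  qed
  have X_lim: "(\<lambda>N. prob {\<omega>\<in>space M. X N \<omega> \<le> x}) \<longlonglongrightarrow> G x" for x
  proof (cases "x < 0")
    case True
    have "whp M (\<lambda>N \<omega>. \<omega> \<notin> {\<omega>\<in>space M. X N \<omega> \<le> x})"
      using sandwich[of 2]
    proof (rule whp_mono)
      fix N \<omega> assume *: "c * (max 0 (Y N \<omega>) / 2)\<^sup>2 \<le> X N \<omega> \<and> X N \<omega> \<le> c * (2 * max 0 (Y N \<omega>))\<^sup>2"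
      have "0 \<le> c * (max 0 (Y N \<omega>) / 2)\<^sup>2" using c by simp
      then show "\<omega> \<notin> {\<omega>\<in>space M. X N \<omega> \<le> x}" using * True by simp
    qed simp
    then have "(\<lambda>N. prob {\<omega>\<in>space M. X N \<omega> \<le> x}) \<longlonglongrightarrow> 0"
      by (rule whp_not_imp_prob_zero) measurable
    then show ?thesis using G_neg[OF True] by simp
  next
    case False
    define a where "a = sqrt (x / c)"
    have a: "0 \<le> a" "c * a\<^sup>2 = x" using False c by (simp_all add: a_def)
    have Gx: "G x = F a" using G_F[of x] False by (simp add: a_def)
    show ?thesis
    proof (rule LIMSEQ_I)
      fix r :: real assume "0 < r"
      then obtain d where d: "d > 0" "\<And>y. \<bar>y - a\<bar> < d \<Longrightarrow> \<bar>F y - F a\<bar> < r / 3"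
        using F_cont[of a] unfolding isCont_def LIM_def dist_real_def
        by (metis abs_0 diff_self divide_pos_pos zero_less_numeral)
      define \<kappa> where "\<kappa> = 1 + d / (2 * (a + 1))"
      have \<kappa>: "1 < \<kappa>" using d(1) a(1) by (simp add: \<kappa>_def)
      have shift: "a * (\<kappa> - 1) < d"
      proof -
        have "a * (\<kappa> - 1) = d * (a / (2 * (a + 1)))" by (simp add: \<kappa>_def)
        also have "\<dots> < d * 1" using d(1) a(1) by (intro mult_strict_left_mono) (simp_all add: divide_less_eq)
        finally show ?thesis by simp
      qed
      have up: "\<bar>F (\<kappa> * a) - F a\<bar> < r / 3"
      proof (rule d(2))
        have "1 * a \<le> \<kappa> * a" using a(1) \<kappa> by (intro mult_right_mono) auto
        then show "\<bar>\<kappa> * a - a\<bar> < d" using shift by (simp add: algebra_simps)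
      qed
      have "a - a / \<kappa> \<le> a * (\<kappa> - 1)"
      proof -
        have "a - a / \<kappa> = a * (\<kappa> - 1) / \<kappa>" using \<kappa> by (simp add: field_simps)
        also have "\<dots> \<le> a * (\<kappa> - 1) / 1" using a(1) \<kappa> by (intro divide_left_mono) auto
        finally show ?thesis by simp
      qed
      moreover have "a / \<kappa> \<le> a" using divide_left_mono[of 1 \<kappa> a] a(1) \<kappa> by simp
      ultimately have down: "\<bar>F (a / \<kappa>) - F a\<bar> < r / 3"
        using shift by (intro d(2)) simp
      obtain A where A: "\<And>N. A N \<in> events" "(\<lambda>N. prob (A N)) \<longlonglongrightarrow> 1"
        "\<And>N \<omega>. \<omega> \<in> A N \<Longrightarrow> c * (max 0 (Y N \<omega>) / \<kappa>)\<^sup>2 \<le> X N \<omega> \<and> X N \<omega> \<le> c * (\<kappa> * max 0 (Y N \<omega>))\<^sup>2"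
        by (rule whpE[OF sandwich[OF \<kappa>]]) (rule that)
      have compl: "prob (space M - A N) = 1 - prob (A N)" for N using A(1) by (rule prob_compl)
      have upper: "prob {\<omega>\<in>space M. X N \<omega> \<le> x} \<le> prob {\<omega>\<in>space M. Y N \<omega> \<le> \<kappa> * a} + (1 - prob (A N))" for N
      proof -
        have "{\<omega>\<in>space M. X N \<omega> \<le> x} \<subseteq> {\<omega>\<in>space M. Y N \<omega> \<le> \<kappa> * a} \<union> (space M - A N)"
        proof safe
          fix \<omega> assume "\<omega> \<in> space M" "X N \<omega> \<le> x" "\<omega> \<in> A N"
          then have "c * (max 0 (Y N \<omega>) / \<kappa>)\<^sup>2 \<le> c * a\<^sup>2" using A(3)[of \<omega> N] a(2) by linarith
          then have "(max 0 (Y N \<omega>) / \<kappa>)\<^sup>2 \<le> a\<^sup>2" using c by simp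
          then have "max 0 (Y N \<omega>) / \<kappa> \<le> a" using a(1) by (rule power2_le_imp_le)
          then show "Y N \<omega> \<le> \<kappa> * a" using \<kappa> by (simp add: divide_le_eq mult.commute)
        qed
        then have "prob {\<omega>\<in>space M. X N \<omega> \<le> x} \<le> prob ({\<omega>\<in>space M. Y N \<omega> \<le> \<kappa> * a} \<union> (space M - A N))"
          using A(1) by (intro finite_measure_mono) auto
        also have "\<dots> \<le> prob {\<omega>\<in>space M. Y N \<omega> \<le> \<kappa> * a} + prob (space M - A N)"
          using A(1) by (intro measure_Un_le) auto
        finally show ?thesis unfolding compl .
      qed
      have lower: "prob {\<omega>\<in>space M. Y N \<omega> \<le> a / \<kappa>} - (1 - prob (A N)) \<le> prob {\<omega>\<in>space M. X N \<omega> \<le> x}" for N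
      proof -
        have "{\<omega>\<in>space M. Y N \<omega> \<le> a / \<kappa>} \<subseteq> {\<omega>\<in>space M. X N \<omega> \<le> x} \<union> (space M - A N)"
        proof safe
          fix \<omega> assume "\<omega> \<in> space M" "Y N \<omega> \<le> a / \<kappa>" "\<omega> \<in> A N"
          have "0 \<le> a / \<kappa>" using a(1) \<kappa> by simp
          then have "max 0 (Y N \<omega>) \<le> a / \<kappa>" using \<open>Y N \<omega> \<le> a / \<kappa>\<close> by simp
          then have "\<kappa> * max 0 (Y N \<omega>) \<le> a" using \<kappa> by (simp add: le_divide_eq mult.commute)
          then have "(\<kappa> * max 0 (Y N \<omega>))\<^sup>2 \<le> a\<^sup>2" using \<kappa> by (intro power_mono) auto
          then have "c * (\<kappa> * max 0 (Y N \<omega>))\<^sup>2 \<le> c * a\<^sup>2" using c by (intro mult_left_mono) auto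
          then show "X N \<omega> \<le> x" using A(3)[OF \<open>\<omega> \<in> A N\<close>] a(2) by linarith
        qed
        then have "prob {\<omega>\<in>space M. Y N \<omega> \<le> a / \<kappa>} \<le> prob ({\<omega>\<in>space M. X N \<omega> \<le> x} \<union> (space M - A N))"
          using A(1) by (intro finite_measure_mono) auto
        also have "\<dots> \<le> prob {\<omega>\<in>space M. X N \<omega> \<le> x} + prob (space M - A N)"
          using A(1) by (intro measure_Un_le) auto
        finally show ?thesis unfolding compl by linarith
      qed
      have bounds: "F (\<kappa> * a) + (1 - 1) < F a + r" "F a - r < F (a / \<kappa>) - (1 - 1)"
        using up down \<open>0 < r\<close> by linarith+
      have "(\<lambda>N. prob {\<omega>\<in>space M. Y N \<omega> \<le> \<kappa> * a} + (1 - prob (A N))) \<longlonglongrightarrow> F (\<kappa> * a) + (1 - 1)"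
        by (intro tendsto_intros Y_lim A)
      then have ev1: "\<forall>\<^sub>F N in sequentially. prob {\<omega>\<in>space M. Y N \<omega> \<le> \<kappa> * a} + (1 - prob (A N)) < F a + r"
        using bounds(1) by (rule order_tendstoD(2))
      have "(\<lambda>N. prob {\<omega>\<in>space M. Y N \<omega> \<le> a / \<kappa>} - (1 - prob (A N))) \<longlonglongrightarrow> F (a / \<kappa>) - (1 - 1)"
        by (intro tendsto_intros Y_lim A)
      then have ev2: "\<forall>\<^sub>F N in sequentially. F a - r < prob {\<omega>\<in>space M. Y N \<omega> \<le> a / \<kappa>} - (1 - prob (A N))"
        using bounds(2) by (rule order_tendstoD(1))
      have "\<forall>\<^sub>F N in sequentially. norm (prob {\<omega>\<in>space M. X N \<omega> \<le> x} - G x) < r"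
        using ev1 ev2
      proof eventually_elim
        case (elim N)
        have "prob {\<omega>\<in>space M. X N \<omega> \<le> x} < F a + r" "F a - r < prob {\<omega>\<in>space M. X N \<omega> \<le> x}"
          using elim upper[of N] lower[of N] by linarith+
        then show ?case unfolding Gx real_norm_def by linarith
      qed
      then show "\<exists>no. \<forall>n\<ge>no. norm (prob {\<omega>\<in>space M. X n \<omega> \<le> x} - G x) < r"
        unfolding eventually_sequentially .
    qed
  qed
  have "cdf (distr M borel (X N)) x = prob {\<omega>\<in>space M. X N \<omega> \<le> x}" for N x
    unfolding cdf_def by (subst measure_distr) (auto intro!: arg_cong[where f=prob])
  then show ?thesis
    using X_lim X unfolding converges_in_distr_def weak_conv_m_def weak_conv_def G_def by simp
qed

end


section \<open>Asymptotics of the contrast statistic\<close>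

context regular_family
begin

lemma loglik_measurable:
  assumes Z: "\<And>i. i \<in> {1..N} \<Longrightarrow> Z i \<in> borel_measurable M"
    and X: "X \<in> borel_measurable M" "Y \<in> borel_measurable M" "H \<in> borel_measurable M"
    and range: "\<And>\<omega>. \<omega> \<in> space M \<Longrightarrow> X \<omega> \<in> \<Theta> \<and> Y \<omega> \<in> \<Theta> \<and> H \<omega> \<in> \<E>"
  shows "(\<lambda>\<omega>. loglik f (\<lambda>i. Z i \<omega>) N (X \<omega>) (Y \<omega>) (H \<omega>)) \<in> borel_measurable M"
  unfolding loglik_def
proof (rule borel_measurable_sum)
  fix i assume i: "i \<in> {1..N}"
  define \<phi> where "\<phi> z = (\<lambda>(x, y, e). ln (mixture_density f z x y e))" for z
  note [measurable] = X Z[OF i]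
  have "(\<lambda>\<omega>. \<phi> (Z i \<omega>) (X \<omega>, Y \<omega>, H \<omega>)) \<in> borel_measurable M"
  proof (rule borel_measurable_Caratheodory[where S="\<Theta> \<times> \<Theta> \<times> \<E>"])
    fix p assume "p \<in> \<Theta> \<times> \<Theta> \<times> \<E>"
    then obtain x y e where p: "p = (x, y, e)" "x \<in> \<Theta>" "y \<in> \<Theta>" "e \<in> \<E>" by auto
    note [measurable] = mixture_density_measurable[OF p(2-4)]
    show "(\<lambda>\<omega>. \<phi> (Z i \<omega>) p) \<in> borel_measurable M" unfolding \<phi>_def p(1) by simp
  next
    show "continuous_on (\<Theta> \<times> \<Theta> \<times> \<E>) (\<phi> (Z i \<omega>))" for \<omega>
      unfolding \<phi>_def by (rule continuous_on_ln_mixture)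
    show "(\<lambda>\<omega>. (X \<omega>, Y \<omega>, H \<omega>)) \<in> borel_measurable M" by measurable
  qed (use range in auto)
  then show "(\<lambda>\<omega>. ln (mixture_density f (Z i \<omega>) (X \<omega>) (Y \<omega>) (H \<omega>))) \<in> borel_measurable M"
    by (simp add: \<phi>_def)
qed

lemma continuous_on_loglik:
  assumes "e \<in> \<E>"
  shows "continuous_on (\<Theta> \<times> \<Theta>) (\<lambda>(x, y). loglik f z N x y e)"
  unfolding loglik_def case_prod_beta'
proof (rule continuous_on_sum)
  fix i
  have "continuous_on (\<Theta> \<times> \<Theta>) (\<lambda>p. (\<lambda>(x, y, e). ln (mixture_density f (z i) x y e)) (fst p, snd p, e))"
    by (rule continuous_on_compose2[OF continuous_on_ln_mixture]) (use assms in \<open>auto intro!: continuous_intros\<close>)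
  then show "continuous_on (\<Theta> \<times> \<Theta>) (\<lambda>p. ln (mixture_density f (z i) (fst p) (snd p) e))" by simp
qed

lemma plc_measurable:
  assumes Z: "\<And>i. i \<in> {1..N} \<Longrightarrow> Z i \<in> borel_measurable M"
    and th [measurable]: "\<theta>h \<in> borel_measurable M" "\<eta>h \<in> borel_measurable M"
    and range: "\<And>\<omega>. \<omega> \<in> space M \<Longrightarrow> \<theta>h \<omega> \<in> \<Theta> \<and> \<eta>h \<omega> \<in> \<E>"
  shows "(\<lambda>\<omega>. plc f \<Theta> (\<lambda>i. Z i \<omega>) N (\<theta>h \<omega>) (\<eta>h \<omega>)) \<in> borel_measurable M"
proof -
  have "(\<lambda>\<omega>. SUP p\<in>\<Theta> \<times> \<Theta>. (\<lambda>(x, y). loglik f (\<lambda>i. Z i \<omega>) N x y (\<eta>h \<omega>)) p) \<in> borel_measurable M"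
  proof (rule borel_measurable_SUP_continuous)
    fix p assume "p \<in> \<Theta> \<times> \<Theta>"
    then obtain x y where "p = (x, y)" "x \<in> \<Theta>" "y \<in> \<Theta>" by auto
    then show "(\<lambda>\<omega>. (\<lambda>(x, y). loglik f (\<lambda>i. Z i \<omega>) N x y (\<eta>h \<omega>)) p) \<in> borel_measurable M"
      using Z th range by (auto intro!: loglik_measurable)
  next
    fix \<omega> assume "\<omega> \<in> space M"
    then show "continuous_on (\<Theta> \<times> \<Theta>) (\<lambda>(x, y). loglik f (\<lambda>i. Z i \<omega>) N x y (\<eta>h \<omega>))"
      using range by (intro continuous_on_loglik) blast
  qed
  moreover have "(\<lambda>\<omega>. loglik f (\<lambda>i. Z i \<omega>) N (\<theta>h \<omega>) (\<theta>h \<omega>) (\<eta>h \<omega>)) \<in> borel_measurable M"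
    using Z th range by (intro loglik_measurable) auto
  ultimately show ?thesis
    unfolding plc_def by (intro borel_measurable_times borel_measurable_diff) simp_all
qed

end

locale fitted_sample = homogeneous_sample f \<Theta> \<E> \<theta> \<eta> M Z
  for f :: "real \<Rightarrow> real \<Rightarrow> real \<Rightarrow> real" and \<Theta> \<E> \<theta> \<eta> and M :: "'a measure" and Z +
  fixes \<theta>h \<eta>h :: "nat \<Rightarrow> 'a \<Rightarrow> real"
  assumes mle: "consistent_mle M Z f \<Theta> \<E> \<theta>h \<eta>h \<theta> \<eta>"
    and tight: "mixture_max_tight M Z f \<Theta> \<eta>h"
    and orthogonal: "(\<integral>z. score f 1 \<theta> \<eta> z * score f 2 \<theta> \<eta> z \<partial>law) = 0"
begin

abbreviation L :: "nat \<Rightarrow> 'a \<Rightarrow> real \<Rightarrow> real \<Rightarrow> real" where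
  "L N \<omega> x y \<equiv> loglik f (\<lambda>i. Z i \<omega>) N x y (\<eta>h N \<omega>)"

abbreviation contrast :: "nat \<Rightarrow> 'a \<Rightarrow> real" where
  "contrast N \<omega> \<equiv> plc f \<Theta> (\<lambda>i. Z i \<omega>) N (\<theta>h N \<omega>) (\<eta>h N \<omega>)"

abbreviation C :: "nat \<Rightarrow> nat \<Rightarrow> 'a \<Rightarrow> real" where
  "C j N \<omega> \<equiv> C_bar f (\<lambda>i. Z i \<omega>) N (\<theta>h N \<omega>) (\<eta>h N \<omega>) 0 j"

lemma estimate_in_params: "\<omega> \<in> space M \<Longrightarrow> \<theta>h N \<omega> \<in> \<Theta> \<and> \<eta>h N \<omega> \<in> \<E>"
  using mle by (simp add: consistent_mle_def)

lemma estimate_converges: "converges_in_prob M \<theta>h \<theta>" "converges_in_prob M \<eta>h \<eta>"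
  using mle by (simp_all add: consistent_mle_def)

lemma contrast_measurable: "contrast N \<in> borel_measurable M"
proof (rule plc_measurable)
  show "\<theta>h N \<in> borel_measurable M" "\<eta>h N \<in> borel_measurable M"
    using estimate_converges by (simp_all add: converges_in_prob_def)
qed (use estimate_in_params in auto)

lemma whp_maximum:
  "whp M (\<lambda>N \<omega>. \<forall>t\<in>\<Theta>. \<forall>e\<in>\<E>. loglik f (\<lambda>i. Z i \<omega>) N t t e \<le> L N \<omega> (\<theta>h N \<omega>) (\<theta>h N \<omega>))"
proof -
  have "(\<lambda>N. prob {\<omega>\<in>space M. is_mle f \<Theta> \<E> (\<lambda>i. Z i \<omega>) N (\<theta>h N \<omega>) (\<eta>h N \<omega>)}) \<longlonglongrightarrow> 1"
    using mle by (simp add: consistent_mle_def)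
  from whp_prob[OF this] show ?thesis
    by (rule whp_mono) (force simp: is_mle_def is_arg_max_def not_less)
qed

lemma whp_estimate_near:
  assumes "0 < \<rho>"
  shows "whp M (\<lambda>N \<omega>. \<theta>h N \<omega> \<in> ball \<theta> \<rho> \<and> \<eta>h N \<omega> \<in> ball \<eta> \<rho>)"
proof -
  have "whp M (\<lambda>N \<omega>. \<bar>\<theta>h N \<omega> - \<theta>\<bar> \<le> \<rho> / 2 \<and> \<bar>\<eta>h N \<omega> - \<eta>\<bar> \<le> \<rho> / 2)"
    using assms by (intro whp_conj converges_in_prob_whp estimate_converges) auto
  then show ?thesis
  proof (rule whp_mono)
    fix N \<omega> assume "\<bar>\<theta>h N \<omega> - \<theta>\<bar> \<le> \<rho> / 2 \<and> \<bar>\<eta>h N \<omega> - \<eta>\<bar> \<le> \<rho> / 2"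
    then show "\<theta>h N \<omega> \<in> ball \<theta> \<rho> \<and> \<eta>h N \<omega> \<in> ball \<eta> \<rho>"
      using assms by (simp add: dist_real_def abs_minus_commute)
  qed
qed

text \<open>The best mixture is at least as likely as the fitted homogeneous density, which is at least as likely as
  the true density. By the likelihood gap, only pairs close to \<open>(\<theta>, \<theta>)\<close> achieve that.\<close>

lemma whp_fitted_mixture_near:
  assumes "0 < \<rho>"
  shows "whp M (\<lambda>N \<omega>. \<exists>s\<in>ball \<theta> \<rho> \<inter> \<Theta>. \<exists>t\<in>ball \<theta> \<rho> \<inter> \<Theta>. \<forall>x\<in>\<Theta>. \<forall>y\<in>\<Theta>. L N \<omega> x y \<le> L N \<omega> s t)"
proof -
  obtain K where K: "compact K" "K \<subseteq> \<Theta>" and "(\<lambda>N. prob {\<omega>\<in>space M. \<exists>p \<in> K \<times> K. is_arg_max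
      (\<lambda>(t1, t2). L N \<omega> t1 t2) (\<lambda>q. q \<in> \<Theta> \<times> \<Theta>) p}) \<longlonglongrightarrow> 1"
    using tight unfolding mixture_max_tight_def by (elim exE conjE) (rule that)
  note argmax = whp_prob[OF this(3)]
  have gap: "whp M (\<lambda>N \<omega>. \<forall>s\<in>K. \<forall>t\<in>K. (s, t) \<in> ball \<theta> \<rho> \<times> ball \<theta> \<rho> \<or>
    L N \<omega> s t < loglik f (\<lambda>i. Z i \<omega>) N \<theta> \<theta> \<eta>)"
    using estimate_in_params estimate_converges(2) by (intro loglik_gap K assms) auto
  show ?thesis
    using whp_conj[OF argmax whp_conj[OF gap whp_maximum]]
  proof (rule whp_mono)
    fix N \<omega> assume \<omega>: "\<omega> \<in> space M"
    assume *: "\<omega> \<in> {\<omega>\<in>space M. \<exists>p \<in> K \<times> K. is_arg_max (\<lambda>(t1, t2). L N \<omega> t1 t2) (\<lambda>q. q \<in> \<Theta> \<times> \<Theta>) p} \<and>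
      (\<forall>s\<in>K. \<forall>t\<in>K. (s, t) \<in> ball \<theta> \<rho> \<times> ball \<theta> \<rho> \<or> L N \<omega> s t < loglik f (\<lambda>i. Z i \<omega>) N \<theta> \<theta> \<eta>) \<and>
      (\<forall>t\<in>\<Theta>. \<forall>e\<in>\<E>. loglik f (\<lambda>i. Z i \<omega>) N t t e \<le> L N \<omega> (\<theta>h N \<omega>) (\<theta>h N \<omega>))"
    then obtain p where p: "p \<in> K \<times> K" "is_arg_max (\<lambda>(t1, t2). L N \<omega> t1 t2) (\<lambda>q. q \<in> \<Theta> \<times> \<Theta>) p" by blast
    obtain s t where st: "p = (s, t)" by (cases p)
    have max: "L N \<omega> x y \<le> L N \<omega> s t" if "x \<in> \<Theta>" "y \<in> \<Theta>" for x y
      using p(2) that unfolding is_arg_max_def st by (force simp: not_less)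
    have "loglik f (\<lambda>i. Z i \<omega>) N \<theta> \<theta> \<eta> \<le> L N \<omega> s t"
      using * true_param max estimate_in_params[OF \<omega>] by (meson order.trans)
    then have "(s, t) \<in> ball \<theta> \<rho> \<times> ball \<theta> \<rho>" using * p(1) st by fastforce
    then show "\<exists>s\<in>ball \<theta> \<rho> \<inter> \<Theta>. \<exists>t\<in>ball \<theta> \<rho> \<inter> \<Theta>. \<forall>x\<in>\<Theta>. \<forall>y\<in>\<Theta>. L N \<omega> x y \<le> L N \<omega> s t"
      using max p(1) st K(2) by (intro bexI[of _ s] bexI[of _ t]) auto
  qed
qed

lemma whp_C_2_small:
  assumes "0 < \<epsilon>"
  shows "whp M (\<lambda>N \<omega>. \<bar>C 2 N \<omega>\<bar> \<le> \<epsilon>)"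
proof -
  obtain \<rho> where "\<rho> > 0" and whp: "whp M (\<lambda>N \<omega>. \<forall>t\<in>ball \<theta> \<rho> \<inter> \<Theta>. \<forall>e\<in>ball \<eta> \<rho> \<inter> \<E>. \<bar>avg (score f 2 t e) N \<omega>\<bar> \<le> \<epsilon>)"
    using averages_of_scores(1)[OF assms] by (elim exE conjE) (rule that)
  show ?thesis
    using whp_conj[OF whp_conj[OF whp whp_in_support] whp_estimate_near[OF \<open>\<rho> > 0\<close>]]
  proof (rule whp_mono)
    fix N \<omega> assume \<omega>: "\<omega> \<in> space M"
    assume *: "((\<forall>t\<in>ball \<theta> \<rho> \<inter> \<Theta>. \<forall>e\<in>ball \<eta> \<rho> \<inter> \<E>. \<bar>avg (score f 2 t e) N \<omega>\<bar> \<le> \<epsilon>)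
      \<and> (\<forall>i\<in>{1..N}. 0 < f (Z i \<omega>) \<theta> \<eta>)) \<and> \<theta>h N \<omega> \<in> ball \<theta> \<rho> \<and> \<eta>h N \<omega> \<in> ball \<eta> \<rho>"
    then have "C 2 N \<omega> = avg (score f 2 (\<theta>h N \<omega>) (\<eta>h N \<omega>)) N \<omega>"
      using estimate_in_params[OF \<omega>] by (intro C_bar_0_2) auto
    then show "\<bar>C 2 N \<omega>\<bar> \<le> \<epsilon>" using * estimate_in_params[OF \<omega>] by auto
  qed
qed

text \<open>Limits in probability are unique: two events of probability tending to one eventually meet.\<close>

lemma C_4_limit:
  assumes "converges_in_prob M (C 4) c"
  shows "c = quartic_mean"
proof -
  have "\<bar>c - quartic_mean\<bar> \<le> 2 * \<epsilon>" if "0 < \<epsilon>" for \<epsilon>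
  proof -
    obtain \<rho> where "\<rho> > 0" and whp: "whp M (\<lambda>N \<omega>. \<forall>x\<in>ball \<theta> \<rho> \<inter> \<Theta>. \<forall>y\<in>ball \<theta> \<rho> \<inter> \<Theta>. \<forall>e\<in>ball \<eta> \<rho> \<inter> \<E>.
        \<bar>avg (\<lambda>z. log_deriv 4 (mixture_deriv f z x y e)) N \<omega> - quartic_mean\<bar> \<le> \<epsilon>)"
      using averages_of_log_deriv_4[OF \<open>0 < \<epsilon>\<close>] by (elim exE conjE) (rule that)
    have "\<forall>\<^sub>F N in sequentially. \<exists>\<omega>\<in>space M. ((\<forall>x\<in>ball \<theta> \<rho> \<inter> \<Theta>. \<forall>y\<in>ball \<theta> \<rho> \<inter> \<Theta>. \<forall>e\<in>ball \<eta> \<rho> \<inter> \<E>.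
        \<bar>avg (\<lambda>z. log_deriv 4 (mixture_deriv f z x y e)) N \<omega> - quartic_mean\<bar> \<le> \<epsilon>) \<and> (\<forall>i\<in>{1..N}. 0 < f (Z i \<omega>) \<theta> \<eta>))
        \<and> ((\<theta>h N \<omega> \<in> ball \<theta> \<rho> \<and> \<eta>h N \<omega> \<in> ball \<eta> \<rho>) \<and> \<bar>C 4 N \<omega> - c\<bar> \<le> \<epsilon>)"
      by (intro whp_witness whp_conj whp whp_in_support whp_estimate_near \<open>\<rho> > 0\<close> converges_in_prob_whp assms \<open>0 < \<epsilon>\<close>)
    then obtain N \<omega> where \<omega>: "\<omega> \<in> space M" and avgs: "\<forall>x\<in>ball \<theta> \<rho> \<inter> \<Theta>. \<forall>y\<in>ball \<theta> \<rho> \<inter> \<Theta>. \<forall>e\<in>ball \<eta> \<rho> \<inter> \<E>.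
        \<bar>avg (\<lambda>z. log_deriv 4 (mixture_deriv f z x y e)) N \<omega> - quartic_mean\<bar> \<le> \<epsilon>"
      and supp: "\<forall>i\<in>{1..N}. 0 < f (Z i \<omega>) \<theta> \<eta>" and near: "\<theta>h N \<omega> \<in> ball \<theta> \<rho>" "\<eta>h N \<omega> \<in> ball \<eta> \<rho>"
      and c: "\<bar>C 4 N \<omega> - c\<bar> \<le> \<epsilon>"
      by (auto dest!: eventually_happens)
    have "C 4 N \<omega> = avg (\<lambda>z. log_deriv 4 (mixture_deriv f z (\<theta>h N \<omega>) (\<theta>h N \<omega>) (\<eta>h N \<omega>))) N \<omega>"
      using supp estimate_in_params[OF \<omega>] by (intro C_bar_0_4) auto
    moreover have "\<bar>avg (\<lambda>z. log_deriv 4 (mixture_deriv f z (\<theta>h N \<omega>) (\<theta>h N \<omega>) (\<eta>h N \<omega>))) N \<omega> - quartic_mean\<bar> \<le> \<epsilon>"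
      using avgs near estimate_in_params[OF \<omega>] by blast
    ultimately show ?thesis using c by linarith
  qed
  from this[of "\<bar>c - quartic_mean\<bar> / 4"] show ?thesis by force
qed

text \<open>The reduction to the curvature \<open>C 2\<close>. The upper bound is the maximum of the quadratic-quartic
  approximation; the lower bound evaluates the likelihood at the pair that attains it, \<open>\<theta>h \<plusminus> v\<close> with
  \<open>v\<^sup>2 = 6 max 0 (C 2) / (- quartic_mean)\<close>.\<close>

lemma contrast_sandwich:
  assumes neg: "quartic_mean < 0" and \<kappa>: "1 < \<kappa>"
  defines "b \<equiv> \<lambda>N \<omega>. max 0 (sqrt N * C 2 N \<omega>)"
  shows "whp M (\<lambda>N \<omega>. 3 / (- quartic_mean) * (b N \<omega> / \<kappa>)\<^sup>2 \<le> contrast N \<omega> \<and>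
    contrast N \<omega> \<le> 3 / (- quartic_mean) * (\<kappa> * b N \<omega>)\<^sup>2)"
proof -
  define K where "K = - quartic_mean"
  have K: "0 < K" using neg by (simp add: K_def)
  have \<kappa>2: "0 < 1 - 1 / \<kappa>\<^sup>2" using \<kappa> by (simp add: divide_less_eq power_less_one_iff)
  \<comment> \<open>The first bound keeps the curvature along the diagonal below \<open>- \<epsilon>\<close>. The second makes the relative
    errors \<open>K / (K - 4 \<epsilon>)\<close> and \<open>1 - \<epsilon> / K\<close> of the two one-sided bounds at most \<open>\<kappa>\<^sup>2\<close> and at least \<open>1 / \<kappa>\<^sup>2\<close>.\<close>
  define \<epsilon> where "\<epsilon> = min (fisher / 2) (K * (1 - 1 / \<kappa>\<^sup>2) / 4)"
  have \<epsilon>: "0 < \<epsilon>" using fisher_pos K \<kappa>2 by (simp add: \<epsilon>_def)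
  have \<epsilon>_fisher: "- fisher + \<epsilon> \<le> - \<epsilon>" by (simp add: \<epsilon>_def min_def)
  have \<epsilon>_K: "4 * \<epsilon> \<le> K * (1 - 1 / \<kappa>\<^sup>2)" by (simp add: \<epsilon>_def min_def)
  have K_upper: "K / \<kappa>\<^sup>2 \<le> K - 4 * \<epsilon>" using \<epsilon>_K by (simp add: algebra_simps)
  have K_lower: "1 / \<kappa>\<^sup>2 \<le> 1 - \<epsilon> / K"
  proof -
    have "\<epsilon> \<le> K * (1 - 1 / \<kappa>\<^sup>2)" using \<epsilon>_K \<epsilon> by linarith
    then have "\<epsilon> / K \<le> 1 - 1 / \<kappa>\<^sup>2" using K by (simp add: divide_le_eq mult.commute)
    then show ?thesis by linarith
  qed
  obtain \<rho>1 where \<rho>1: "\<rho>1 > 0" "whp M (\<lambda>N \<omega>. \<forall>t\<in>ball \<theta> \<rho>1 \<inter> \<Theta>. \<forall>e\<in>ball \<eta> \<rho>1 \<inter> \<E>.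
      avg (\<lambda>z. score f 2 t e z - (score f 1 t e z)\<^sup>2) N \<omega> \<le> - fisher + \<epsilon>)"
    using averages_of_scores(2)[OF \<epsilon>] by (elim exE conjE) (rule that)
  obtain \<rho>2 where \<rho>2: "\<rho>2 > 0" "whp M (\<lambda>N \<omega>. \<forall>t\<in>ball \<theta> \<rho>2 \<inter> \<Theta>. \<forall>e\<in>ball \<eta> \<rho>2 \<inter> \<E>.
      \<bar>avg (\<lambda>z. score f 3 t e z - score f 2 t e z * score f 1 t e z) N \<omega>\<bar> \<le> \<epsilon>)"
    using averages_of_scores(3)[OF \<epsilon> orthogonal] by (elim exE conjE) (rule that)
  obtain \<rho>3 where \<rho>3: "\<rho>3 > 0" "whp M (\<lambda>N \<omega>. \<forall>x\<in>ball \<theta> \<rho>3 \<inter> \<Theta>. \<forall>y\<in>ball \<theta> \<rho>3 \<inter> \<Theta>. \<forall>e\<in>ball \<eta> \<rho>3 \<inter> \<E>.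
      \<bar>avg (\<lambda>z. log_deriv 4 (mixture_deriv f z x y e)) N \<omega> - quartic_mean\<bar> \<le> \<epsilon>)"
    using averages_of_log_deriv_4[OF \<epsilon>] by (elim exE conjE) (rule that)
  obtain \<rho>4 where \<rho>4: "\<rho>4 > 0" "ball \<theta> \<rho>4 \<subseteq> \<Theta>" using open_params(1) true_param(1) by (rule openE)
  define \<rho> where "\<rho> = min (min \<rho>1 \<rho>2) (min \<rho>3 \<rho>4)"
  have \<rho>: "0 < \<rho>" "\<rho> \<le> \<rho>1" "\<rho> \<le> \<rho>2" "\<rho> \<le> \<rho>3" "\<rho> \<le> \<rho>4"
    using \<rho>1(1) \<rho>2(1) \<rho>3(1) \<rho>4(1) by (auto simp: \<rho>_def)
  define I where "I = ball \<theta> \<rho>"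
  have I: "is_interval I" "I \<subseteq> \<Theta>"
    using \<rho>4(2) \<rho>(5) unfolding I_def by (auto simp: is_interval_ball_real)
  have sub: "I \<subseteq> ball \<theta> \<rho>1 \<inter> \<Theta>" "I \<subseteq> ball \<theta> \<rho>2 \<inter> \<Theta>" "I \<subseteq> ball \<theta> \<rho>3 \<inter> \<Theta>"
    using \<rho> I(2) unfolding I_def by auto
  \<comment> \<open>Small enough for the maximizing half-difference, whose square is \<open>6 max 0 (C 2) / K\<close>, to stay below \<open>\<rho> / 2\<close>.\<close>
  have small: "whp M (\<lambda>N \<omega>. \<bar>C 2 N \<omega>\<bar> \<le> K * \<rho>\<^sup>2 / 25)"
    using K \<rho>(1) by (intro whp_C_2_small) simp
  have "whp M (\<lambda>N \<omega>. 1 \<le> N)" by (intro whp_eventually eventually_sequentiallyI[of 1]) auto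
  from whp_conj[OF whp_conj[OF whp_conj[OF \<rho>1(2) \<rho>2(2)] whp_conj[OF \<rho>3(2) whp_in_support]]
      whp_conj[OF whp_conj[OF whp_maximum whp_fitted_mixture_near[OF \<rho>(1)]]
        whp_conj[OF whp_conj[OF small this] whp_estimate_near[OF half_gt_zero[OF \<rho>(1)]]]]]
  show ?thesis
  proof (rule whp_mono)
    fix N \<omega> assume \<omega>: "\<omega> \<in> space M"
    let ?t = "\<theta>h N \<omega>" and ?e = "\<eta>h N \<omega>" and ?z = "\<lambda>i. Z i \<omega>"
    assume *: "(((\<forall>t\<in>ball \<theta> \<rho>1 \<inter> \<Theta>. \<forall>e\<in>ball \<eta> \<rho>1 \<inter> \<E>.
        avg (\<lambda>z. score f 2 t e z - (score f 1 t e z)\<^sup>2) N \<omega> \<le> - fisher + \<epsilon>) \<and>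
      (\<forall>t\<in>ball \<theta> \<rho>2 \<inter> \<Theta>. \<forall>e\<in>ball \<eta> \<rho>2 \<inter> \<E>.
        \<bar>avg (\<lambda>z. score f 3 t e z - score f 2 t e z * score f 1 t e z) N \<omega>\<bar> \<le> \<epsilon>)) \<and>
      (\<forall>x\<in>ball \<theta> \<rho>3 \<inter> \<Theta>. \<forall>y\<in>ball \<theta> \<rho>3 \<inter> \<Theta>. \<forall>e\<in>ball \<eta> \<rho>3 \<inter> \<E>.
        \<bar>avg (\<lambda>z. log_deriv 4 (mixture_deriv f z x y e)) N \<omega> - quartic_mean\<bar> \<le> \<epsilon>) \<and>
      (\<forall>i\<in>{1..N}. 0 < f (Z i \<omega>) \<theta> \<eta>)) \<and>
      ((\<forall>t\<in>\<Theta>. \<forall>e\<in>\<E>. loglik f (\<lambda>i. Z i \<omega>) N t t e \<le> L N \<omega> (\<theta>h N \<omega>) (\<theta>h N \<omega>)) \<and>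
      (\<exists>s\<in>ball \<theta> \<rho> \<inter> \<Theta>. \<exists>t\<in>ball \<theta> \<rho> \<inter> \<Theta>. \<forall>x\<in>\<Theta>. \<forall>y\<in>\<Theta>. L N \<omega> x y \<le> L N \<omega> s t)) \<and>
      (\<bar>C 2 N \<omega>\<bar> \<le> K * \<rho>\<^sup>2 / 25 \<and> 1 \<le> N) \<and> \<theta>h N \<omega> \<in> ball \<theta> (\<rho> / 2) \<and> \<eta>h N \<omega> \<in> ball \<eta> (\<rho> / 2)"
    have e\<E>: "?e \<in> \<E>" using estimate_in_params[OF \<omega>] by blast
    have "?e \<in> ball \<eta> \<rho>" using * \<rho>(1) by auto
    then have e: "?e \<in> ball \<eta> \<rho>1 \<inter> \<E>" "?e \<in> ball \<eta> \<rho>2 \<inter> \<E>" "?e \<in> ball \<eta> \<rho>3 \<inter> \<E>"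
      using e\<E> \<rho> by auto
    have t: "?t \<in> I" using * \<rho>(1) by (auto simp: I_def)
    have N: "0 < N" using * by simp
    have supp: "\<forall>i\<in>{1..N}. 0 < f (?z i) \<theta> \<eta>" using * by blast
    have maximal: "loglik f ?z N s s ?e \<le> loglik f ?z N ?t ?t ?e" if "s \<in> \<Theta>" for s
      using * that e\<E> by blast
    have fisher_avg: "avg (\<lambda>z. score f 2 s ?e z - (score f 1 s ?e z)\<^sup>2) N \<omega> \<le> - \<epsilon>" if "s \<in> I" for s
    proof -
      have "avg (\<lambda>z. score f 2 s ?e z - (score f 1 s ?e z)\<^sup>2) N \<omega> \<le> - fisher + \<epsilon>"
        using * sub(1) e(1) that by blast
      then show ?thesis using \<epsilon>_fisher by (rule order.trans)
    qed
    have cross: "\<bar>avg (\<lambda>z. score f 3 s ?e z - score f 2 s ?e z * score f 1 s ?e z) N \<omega>\<bar> \<le> \<epsilon>" if "s \<in> I" for s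
      using * sub(2) e(2) that by blast
    have quartic: "\<bar>avg (\<lambda>z. log_deriv 4 (mixture_deriv f z x y ?e)) N \<omega> - quartic_mean\<bar> \<le> \<epsilon>"
      if "x \<in> I" "y \<in> I" for x y
      using * sub(3) e(3) that by blast
    have quartic_le: "avg (\<lambda>z. log_deriv 4 (mixture_deriv f z x y ?e)) N \<omega> \<le> quartic_mean + \<epsilon>"
      and quartic_ge: "quartic_mean - \<epsilon> \<le> avg (\<lambda>z. log_deriv 4 (mixture_deriv f z x y ?e)) N \<omega>"
      if "x \<in> I" "y \<in> I" for x y
      using quartic[OF that] by linarith+
    have b2: "(b N \<omega>)\<^sup>2 = N * (max 0 (C 2 N \<omega>))\<^sup>2"
    proof -
      have "b N \<omega> = sqrt N * max 0 (C 2 N \<omega>)"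
        by (simp add: b_def max_mult_distrib_left)
      then show ?thesis by (simp add: power_mult_distrib)
    qed
    obtain s1 s2 where s: "s1 \<in> I" "s2 \<in> I" and max: "\<And>x y. x \<in> \<Theta> \<Longrightarrow> y \<in> \<Theta> \<Longrightarrow> L N \<omega> x y \<le> L N \<omega> s1 s2"
      using * unfolding I_def by blast
    have sup: "(SUP (t1, t2) \<in> \<Theta> \<times> \<Theta>. L N \<omega> t1 t2) = L N \<omega> s1 s2"
      using s I(2) max by (intro cSup_eq_maximum) (auto simp: image_iff intro!: bexI[of _ "(s1, s2)"])
    have contrast_eq: "contrast N \<omega> = 2 * (L N \<omega> s1 s2 - L N \<omega> ?t ?t)"
      unfolding plc_def sup ..
    have K_pos: "0 < K / \<kappa>\<^sup>2" using K \<kappa> by simp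
    have "quartic_mean + 4 * \<epsilon> < 0"
      using K_pos K_upper unfolding K_def by linarith
    then have "2 * (L N \<omega> s1 s2 - L N \<omega> ?t ?t) \<le> 3 * N * (max 0 (C 2 N \<omega>))\<^sup>2 / (- quartic_mean - 4 * \<epsilon>)"
      using supp e\<E> N I t maximal \<epsilon> fisher_avg cross quartic_le s
      by (intro loglik_contrast_le[where I=I])
    then have "contrast N \<omega> \<le> 3 * (b N \<omega>)\<^sup>2 / (K - 4 * \<epsilon>)"
      unfolding contrast_eq b2 K_def by (simp add: mult.assoc)
    also have "\<dots> \<le> 3 * (b N \<omega>)\<^sup>2 / (K / \<kappa>\<^sup>2)"
      using K_upper K_pos less_le_trans[OF K_pos K_upper] by (intro divide_left_mono mult_pos_pos) simp_all
    finally have upper: "contrast N \<omega> \<le> 3 / K * (\<kappa> * b N \<omega>)\<^sup>2"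
      by (simp add: power_mult_distrib mult_ac)
    define v where "v = sqrt (6 * max 0 (C 2 N \<omega>) / (- quartic_mean))"
    have "v \<le> sqrt ((\<rho> / 2)\<^sup>2)"
      unfolding v_def
    proof (rule real_sqrt_le_mono)
      have "max 0 (C 2 N \<omega>) \<le> K * \<rho>\<^sup>2 / 25" using * K by auto
      also have "\<dots> \<le> K * \<rho>\<^sup>2 / 24" using K by (intro divide_left_mono) auto
      finally have "6 * max 0 (C 2 N \<omega>) / K \<le> 6 * (K * \<rho>\<^sup>2 / 24) / K"
        using K by (intro divide_right_mono mult_left_mono) auto
      then show "6 * max 0 (C 2 N \<omega>) / (- quartic_mean) \<le> (\<rho> / 2)\<^sup>2"
        using K by (simp add: K_def power_divide)
    qed
    then have "v \<le> \<rho> / 2" using \<rho>(1) by simp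
    moreover have "0 \<le> v" using neg unfolding v_def by (intro real_sqrt_ge_zero divide_nonneg_pos) auto
    moreover have "\<bar>?t - \<theta>\<bar> < \<rho> / 2" using * by (simp add: dist_real_def abs_minus_commute)
    ultimately have v: "?t + v \<in> I" "?t - v \<in> I"
      unfolding I_def mem_ball dist_real_def by linarith+
    have "3 * N * (max 0 (C 2 N \<omega>))\<^sup>2 / (- quartic_mean) * (1 - \<epsilon> / (- quartic_mean))
        \<le> 2 * (L N \<omega> (?t + v) (?t - v) - L N \<omega> ?t ?t)"
      unfolding v_def
      using supp e\<E> N I t maximal \<epsilon> quartic_ge neg v[unfolded v_def]
      by (intro loglik_contrast_ge[where I=I])
    also have "\<dots> \<le> contrast N \<omega>"
      unfolding contrast_eq using max v I(2) by (auto simp: subset_iff)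
    finally have ge: "3 * (b N \<omega>)\<^sup>2 / K * (1 - \<epsilon> / K) \<le> contrast N \<omega>"
      unfolding b2 K_def by (simp add: mult.assoc)
    have "3 / K * (b N \<omega> / \<kappa>)\<^sup>2 = 3 * (b N \<omega>)\<^sup>2 / K * (1 / \<kappa>\<^sup>2)"
      by (simp add: power_divide)
    also have "\<dots> \<le> 3 * (b N \<omega>)\<^sup>2 / K * (1 - \<epsilon> / K)"
      using K K_lower by (intro mult_left_mono) auto
    finally have "3 / K * (b N \<omega> / \<kappa>)\<^sup>2 \<le> contrast N \<omega>" using ge by linarith
    with upper show "3 / (- quartic_mean) * (b N \<omega> / \<kappa>)\<^sup>2 \<le> contrast N \<omega> \<and>
        contrast N \<omega> \<le> 3 / (- quartic_mean) * (\<kappa> * b N \<omega>)\<^sup>2"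
      unfolding K_def by blast
  qed
qed

end

theorem theorem2p2:
  fixes M :: "'a measure"
    and Z :: "nat \<Rightarrow> 'a \<Rightarrow> real"
    and f :: "real \<Rightarrow> real \<Rightarrow> real \<Rightarrow> real"
    and \<Theta> \<E> :: "real set"
    and \<theta> \<eta> C04 :: real
    and \<theta>h \<eta>h :: "nat \<Rightarrow> 'a \<Rightarrow> real"
  defines "\<Lambda> \<equiv> \<lambda>N \<omega>. plc f \<Theta> (\<lambda>i. Z i \<omega>) N (\<theta>h N \<omega>) (\<eta>h N \<omega>)"
    and "Cbar \<equiv> \<lambda>i j N \<omega>. C_bar f (\<lambda>k. Z k \<omega>) N (\<theta>h N \<omega>) (\<eta>h N \<omega>) i j"
  assumes "prob_space M"
    and "regular_family f \<Theta> \<E> \<theta> \<eta>"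
    and "iid_model M Z f \<theta> \<eta>"
    and "consistent_mle M Z f \<Theta> \<E> \<theta>h \<eta>h \<theta> \<eta>"
    and "mixture_max_tight M Z f \<Theta> \<eta>h"
    and "(\<integral>\<omega>. score f 1 \<theta> \<eta> (Z 1 \<omega>) * score f 2 \<theta> \<eta> (Z 1 \<omega>) \<partial>M) = 0"
    and "converges_in_prob M (Cbar 0 4) C04"
    and "C04 < 0"
  shows "((\<lambda>N. \<P>(\<omega> in M. Cbar 0 2 N \<omega> = 0)) \<longlonglongrightarrow> 1 \<longrightarrow> converges_in_prob M \<Lambda> 0) \<and>
    (\<forall>\<sigma>>0. converges_in_distr M (\<lambda>N \<omega>. sqrt (real N) * Cbar 0 2 N \<omega>)
          (density lborel (\<lambda>x. ennreal (normal_density 0 \<sigma> x))) \<longrightarrow>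
      (\<exists>c::real. c\<^sup>2 > 0 \<and> converges_in_distr M \<Lambda>
          (distr (density lborel (\<lambda>x. ennreal (std_normal_density x))) borel
            (\<lambda>x. c\<^sup>2 * (max 0 x)\<^sup>2))))"
proof -
  interpret P: prob_space M by fact
  interpret R: regular_family f \<Theta> \<E> \<theta> \<eta> by fact
  have law: "distr M borel (Z i) = model_law f \<theta> \<eta>" if "1 \<le> i" for i
  proof -
    have "distr M lborel (Z i) = model_law f \<theta> \<eta>"
      using \<open>iid_model M Z f \<theta> \<eta>\<close> that unfolding iid_model_def model_law_def
      by (blast dest: distributed_distr_eq_density)
    moreover have "distr M lborel (Z i) = distr M borel (Z i)" by (rule distr_cong) auto
    ultimately show ?thesis by simp
  qed
  interpret S: homogeneous_sample f \<Theta> \<E> \<theta> \<eta> M Z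
    by unfold_locales (use \<open>iid_model M Z f \<theta> \<eta>\<close> law in \<open>auto simp: iid_model_def\<close>)
  interpret F: fitted_sample f \<Theta> \<E> \<theta> \<eta> M Z \<theta>h \<eta>h
  proof
    have [measurable]: "score f r \<theta> \<eta> \<in> borel_measurable borel" for r
      using R.score_measurable[OF R.true_param] by simp
    show "(\<integral>z. score f 1 \<theta> \<eta> z * score f 2 \<theta> \<eta> z \<partial>model_law f \<theta> \<eta>) = 0"
      using S.integral_eq[of 1 "\<lambda>z. score f 1 \<theta> \<eta> z * score f 2 \<theta> \<eta> z"] assms(8) by simp
  qed fact+
  have "C04 = S.quartic_mean"
    using assms(9) unfolding Cbar_def by (rule F.C_4_limit)
  then have neg: "S.quartic_mean < 0" using \<open>C04 < 0\<close> by simp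
  have \<Lambda> [measurable]: "\<Lambda> N \<in> borel_measurable M" for N
    unfolding \<Lambda>_def by (rule F.contrast_measurable)
  have sandwich: "whp M (\<lambda>N \<omega>. 3 / (- S.quartic_mean) * (max 0 (sqrt N * Cbar 0 2 N \<omega>) / \<kappa>)\<^sup>2 \<le> \<Lambda> N \<omega> \<and>
    \<Lambda> N \<omega> \<le> 3 / (- S.quartic_mean) * (\<kappa> * max 0 (sqrt N * Cbar 0 2 N \<omega>))\<^sup>2)" if "1 < \<kappa>" for \<kappa>
    unfolding \<Lambda>_def Cbar_def using neg that by (rule F.contrast_sandwich)
  show ?thesis
  proof (intro conjI impI allI)
    assume "(\<lambda>N. \<P>(\<omega> in M. Cbar 0 2 N \<omega> = 0)) \<longlonglongrightarrow> 1"
    then have "whp M (\<lambda>N \<omega>. \<omega> \<in> {\<omega>\<in>space M. Cbar 0 2 N \<omega> = 0})" by (rule P.whp_prob)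
    from P.whp_conj[OF this sandwich[of 2]]
    have zero: "whp M (\<lambda>N \<omega>. \<Lambda> N \<omega> = 0)" by (rule P.whp_mono) auto
    show "converges_in_prob M \<Lambda> 0"
      by (rule P.whp_converges_in_prob) (auto intro: P.whp_mono[OF zero])
  next
    fix \<sigma> :: real
    assume "0 < \<sigma>" and conv: "converges_in_distr M (\<lambda>N \<omega>. sqrt (real N) * Cbar 0 2 N \<omega>)
          (density lborel (\<lambda>x. ennreal (normal_density 0 \<sigma> x)))"
    define c where "c = sqrt (3 / (- S.quartic_mean) * \<sigma>\<^sup>2)"
    have "0 < 3 / (- S.quartic_mean) * \<sigma>\<^sup>2"
      using neg \<open>0 < \<sigma>\<close> by (intro mult_pos_pos divide_pos_pos) auto
    then have c: "c\<^sup>2 = 3 / (- S.quartic_mean) * \<sigma>\<^sup>2" "0 < c\<^sup>2" unfolding c_def by simp_all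
    have "converges_in_distr M \<Lambda> (distr (density lborel (\<lambda>x. ennreal (std_normal_density x))) borel
            (\<lambda>x. c\<^sup>2 * (max 0 x)\<^sup>2))"
      unfolding c(1) using neg \<open>0 < \<sigma>\<close>
      by (intro P.converges_in_distr_squared_positive_part[OF \<Lambda> conv] sandwich) (auto intro: divide_pos_neg)
    then show "\<exists>c::real. c\<^sup>2 > 0 \<and> converges_in_distr M \<Lambda>
          (distr (density lborel (\<lambda>x. ennreal (std_normal_density x))) borel
            (\<lambda>x. c\<^sup>2 * (max 0 x)\<^sup>2))" using c(2) by blast
  qed
qed

end
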